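(* Let $A$ be a real closed ring. Then $A$ is real closed $*$ if and only if $A$ is a Baer ring.
   Context: All rings are commutative with $1$. A poring is a ring $A$ with a partial ordering given by a set $A^+\subseteq A$ closed under addition and multiplication, containing all squares, with $A^+\cap(-A^+)=\{0\}$. $\mathrm{Sper}\,A$ is the real spectrum: the set of prime cones $\alpha$ of $A$ with $A^+\subseteq\alpha$, with the Harrison topology, and $\mathrm{supp}:\mathrm{Sper}\,A\to\mathrm{Spec}\,A$ is $\alpha\mapsto\alpha\cap-\alpha$. If no ordering is mentioned, $A^+=\sum A^2$ (sums of squares). Real closed integral domain: a partially ordered integral domain $A$ such that (1) $\mathrm{Quot}(A)$ is a real closed field; (2) $A$ is integrally closed in $\mathrm{Quot}(A)$; (3) for every $a\in A$ the image of the radical ideal $\sqrt{aA}$ in the localization $A_a$ is convex in $A_a$. Real closed ring: a ring $A$ such that (1) $A$ is reduced; (2) $\mathrm{supp}:\mathrm{Sper}\,A\to\mathrm{Spec}\,A$ is a homeomorphism; (3) $A/\mathfrak p$ is a real closed integral domain for every $\mathfrak p\in\mathrm{Spec}\,A$; (4) $\sqrt{aA}+\sqrt{bA}=\sqrt{aA+bA}$ for all $a,b\in A$. (The partial ordering of a real closed ring is necessarily $\sum A^2$.) A ring $A$ is formally real if $\sum a_i^2=0$ implies all $a_i=0$. A ring extension $B\supseteq A$ is essential if every nonzero ideal of $B$ meets $A$ in a nonzero ideal. A formally real ring $A$ is real closed $*$ if there is no formally real ring properly containing $A$ that is both an integral and an essential extension of $A$. A ring $R$ is Baer if the annihilator of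 every subset of $R$ is of the form $eR$ with $e=e^2\in R$. *)

theory Defs
  imports "HOL-Algebra.Algebra" "HOL-Analysis.Function_Topology"
begin

section \<open>Partially ordered rings and real spectra\<close>

definition sums_of_squares :: "('a, 'm) ring_scheme \<Rightarrow> 'a set" where
  "sums_of_squares R =
     {\<Oplus>\<^bsub>R\<^esub>i\<in>{..<n}. f i \<otimes>\<^bsub>R\<^esub> f i | (n::nat) f. f \<in> {..<n} \<rightarrow> carrier R}"

definition formally_real :: "('a, 'm) ring_scheme \<Rightarrow> bool" where
  "formally_real R \<longleftrightarrow>
     (\<forall>(n::nat) f. f \<in> {..<n} \<rightarrow> carrier R \<longrightarrow> (\<Oplus>\<^bsub>R\<^esub>i\<in>{..<n}. f i \<otimes>\<^bsub>R\<^esub> f i) = \<zero>\<^bsub>R\<^esub>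
        \<longrightarrow> (\<forall>i<n. f i = \<zero>\<^bsub>R\<^esub>))"

definition poring :: "('a, 'm) ring_scheme \<Rightarrow> 'a set \<Rightarrow> bool" where
  "poring R P \<longleftrightarrow> cring R \<and> P \<subseteq> carrier R
     \<and> (\<forall>x\<in>P. \<forall>y\<in>P. x \<oplus>\<^bsub>R\<^esub> y \<in> P \<and> x \<otimes>\<^bsub>R\<^esub> y \<in> P)
     \<and> (\<forall>x\<in>carrier R. x \<otimes>\<^bsub>R\<^esub> x \<in> P)
     \<and> P \<inter> {\<ominus>\<^bsub>R\<^esub> x | x. x \<in> P} = {\<zero>\<^bsub>R\<^esub>}"

text \<open>Here \<open>x \<le> y\<close> means that \<open>y - x\<close> lies in the positive cone \<open>P\<close>.\<close>

definition convex_in :: "('a, 'm) ring_scheme \<Rightarrow> 'a set \<Rightarrow> 'a set \<Rightarrow> bool" where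
  "convex_in R P C \<longleftrightarrow>
     (\<forall>x\<in>C. \<forall>z\<in>C. \<forall>y\<in>carrier R. y \<ominus>\<^bsub>R\<^esub> x \<in> P \<and> z \<ominus>\<^bsub>R\<^esub> y \<in> P \<longrightarrow> y \<in> C)"

definition cone_supp :: "('a, 'm) ring_scheme \<Rightarrow> 'a set \<Rightarrow> 'a set" where
  "cone_supp R \<alpha> = \<alpha> \<inter> {\<ominus>\<^bsub>R\<^esub> x | x. x \<in> \<alpha>}"

definition prime_cone :: "('a, 'm) ring_scheme \<Rightarrow> 'a set \<Rightarrow> bool" where
  "prime_cone R \<alpha> \<longleftrightarrow> \<alpha> \<subseteq> carrier R
     \<and> (\<forall>x\<in>\<alpha>. \<forall>y\<in>\<alpha>. x \<oplus>\<^bsub>R\<^esub> y \<in> \<alpha> \<and> x \<otimes>\<^bsub>R\<^esub> y \<in> \<alpha>)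
     \<and> \<alpha> \<union> {\<ominus>\<^bsub>R\<^esub> x | x. x \<in> \<alpha>} = carrier R
     \<and> primeideal (cone_supp R \<alpha>) R"

definition Sper :: "('a, 'm) ring_scheme \<Rightarrow> 'a set \<Rightarrow> 'a set set" where
  "Sper R P = {\<alpha>. prime_cone R \<alpha> \<and> P \<subseteq> \<alpha>}"

text \<open>
  The subbasic open sets consist of the prime cones at which \<open>a\<close> is strictly positive,
  that is, \<open>- a \<notin> \<alpha>\<close>. Taking \<open>a = 1\<close> shows that the whole of \<open>Sper\<close> is among them.
\<close>

definition harrison_topology :: "('a, 'm) ring_scheme \<Rightarrow> 'a set \<Rightarrow> 'a set topology" where
  "harrison_topology R P =
     topology_generated_by {{\<alpha> \<in> Sper R P. \<ominus>\<^bsub>R\<^esub> a \<notin> \<alpha>} | a. a \<in> carrier R}"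

definition Spec :: "('a, 'm) ring_scheme \<Rightarrow> 'a set set" where
  "Spec R = {\<pp>. primeideal \<pp> R}"

definition zariski_topology :: "('a, 'm) ring_scheme \<Rightarrow> 'a set topology" where
  "zariski_topology R = topology_generated_by {{\<pp> \<in> Spec R. a \<notin> \<pp>} | a. a \<in> carrier R}"


section \<open>Localizations\<close>

text \<open>
  The fraction \<open>r / s\<close> is the class of all pairs \<open>(x, y)\<close> with \<open>u (r y - x s) = 0\<close> for some
  \<open>u\<close> in the multiplicative set \<open>S\<close>.
\<close>

definition loc_frac :: "('a, 'm) ring_scheme \<Rightarrow> 'a set \<Rightarrow> 'a \<Rightarrow> 'a \<Rightarrow> ('a \<times> 'a) set" where
  "loc_frac R S r s =
     {(x, y). x \<in> carrier R \<and> y \<in> S \<and> (\<exists>u\<in>S. u \<otimes>\<^bsub>R\<^esub> (r \<otimes>\<^bsub>R\<^esub> y) = u \<otimes>\<^bsub>R\<^esub> (x \<otimes>\<^bsub>R\<^esub> s))}"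

definition localization :: "('a, 'm) ring_scheme \<Rightarrow> 'a set \<Rightarrow> ('a \<times> 'a) set ring" where
  "localization R S =
     \<lparr>carrier = {loc_frac R S r s | r s. r \<in> carrier R \<and> s \<in> S},
      monoid.mult = (\<lambda>M N. \<Union>(r, s)\<in>M. \<Union>(r', s')\<in>N. loc_frac R S (r \<otimes>\<^bsub>R\<^esub> r') (s \<otimes>\<^bsub>R\<^esub> s')),
      monoid.one = loc_frac R S \<one>\<^bsub>R\<^esub> \<one>\<^bsub>R\<^esub>,
      ring.zero = loc_frac R S \<zero>\<^bsub>R\<^esub> \<one>\<^bsub>R\<^esub>,
      ring.add = (\<lambda>M N. \<Union>(r, s)\<in>M. \<Union>(r', s')\<in>N.
               loc_frac R S (r \<otimes>\<^bsub>R\<^esub> s' \<oplus>\<^bsub>R\<^esub> r' \<otimes>\<^bsub>R\<^esub> s) (s \<otimes>\<^bsub>R\<^esub> s'))\<rparr>"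

definition loc_map :: "('a, 'm) ring_scheme \<Rightarrow> 'a set \<Rightarrow> 'a \<Rightarrow> ('a \<times> 'a) set" where
  "loc_map R S r = loc_frac R S r \<one>\<^bsub>R\<^esub>"

definition loc_cone :: "('a, 'm) ring_scheme \<Rightarrow> 'a set \<Rightarrow> 'a set \<Rightarrow> ('a \<times> 'a) set set" where
  "loc_cone R P S = {loc_frac R S x (s \<otimes>\<^bsub>R\<^esub> s) | x s. x \<in> P \<and> s \<in> S}"

abbreviation nonzeros :: "('a, 'm) ring_scheme \<Rightarrow> 'a set" where
  "nonzeros R \<equiv> carrier R - {\<zero>\<^bsub>R\<^esub>}"

abbreviation powers_of :: "('a, 'm) ring_scheme \<Rightarrow> 'a \<Rightarrow> 'a set" where
  "powers_of R a \<equiv> {a [^]\<^bsub>R\<^esub> n | n::nat. True}"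


section \<open>Real closed domains and real closed rings\<close>

text \<open>
  Polynomials are coefficient lists, leading coefficient first, so that \<open>\<one> # p\<close> is monic.
\<close>

definition integral_over :: "('a, 'm) ring_scheme \<Rightarrow> 'a set \<Rightarrow> 'a \<Rightarrow> bool" where
  "integral_over B K x \<longleftrightarrow> (\<exists>p. set p \<subseteq> K \<and> ring.eval B (\<one>\<^bsub>B\<^esub> # p) x = \<zero>\<^bsub>B\<^esub>)"

definition real_closed_field :: "('a, 'm) ring_scheme \<Rightarrow> bool" where
  "real_closed_field K \<longleftrightarrow> field K \<and> formally_real K
     \<and> (\<forall>x\<in>carrier K. \<exists>y\<in>carrier K. x = y \<otimes>\<^bsub>K\<^esub> y \<or> x = \<ominus>\<^bsub>K\<^esub> (y \<otimes>\<^bsub>K\<^esub> y))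
     \<and> (\<forall>p. polynomial\<^bsub>K\<^esub> (carrier K) p \<and> odd (degree p)
           \<longrightarrow> (\<exists>x\<in>carrier K. ring.eval K p x = \<zero>\<^bsub>K\<^esub>))"

definition radical :: "('a, 'm) ring_scheme \<Rightarrow> 'a set \<Rightarrow> 'a set" where
  "radical R I = {x \<in> carrier R. \<exists>n::nat. x [^]\<^bsub>R\<^esub> n \<in> I}"

definition real_closed_domain :: "('a, 'm) ring_scheme \<Rightarrow> 'a set \<Rightarrow> bool" where
  "real_closed_domain R P \<longleftrightarrow> domain R \<and> poring R P
     \<and> real_closed_field (localization R (nonzeros R))
     \<and> (\<forall>x\<in>carrier (localization R (nonzeros R)).
           integral_over (localization R (nonzeros R)) (loc_map R (nonzeros R) ` carrier R) x
             \<longrightarrow> x \<in> loc_map R (nonzeros R) ` carrier R)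
     \<and> (\<forall>a\<in>carrier R.
           convex_in (localization R (powers_of R a)) (loc_cone R P (powers_of R a))
             (loc_map R (powers_of R a) ` radical R (PIdl\<^bsub>R\<^esub> a)))"

text \<open>
  A ring without a specified ordering is ordered by its sums of squares. In the factor ring
  \<open>R Quot \<pp>\<close> these are exactly the images of the sums of squares of \<open>R\<close>.
\<close>

definition real_closed_ring :: "('a, 'm) ring_scheme \<Rightarrow> bool" where
  "real_closed_ring R \<longleftrightarrow> cring R
     \<and> (\<forall>x\<in>carrier R. (\<exists>n::nat. x [^]\<^bsub>R\<^esub> n = \<zero>\<^bsub>R\<^esub>) \<longrightarrow> x = \<zero>\<^bsub>R\<^esub>)
     \<and> homeomorphic_map (harrison_topology R (sums_of_squares R)) (zariski_topology R)
         (cone_supp R)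
     \<and> (\<forall>\<pp>\<in>Spec R. real_closed_domain (R Quot \<pp>) (sums_of_squares (R Quot \<pp>)))
     \<and> (\<forall>a\<in>carrier R. \<forall>b\<in>carrier R.
           radical R (PIdl\<^bsub>R\<^esub> a) <+>\<^bsub>R\<^esub> radical R (PIdl\<^bsub>R\<^esub> b)
             = radical R (PIdl\<^bsub>R\<^esub> a <+>\<^bsub>R\<^esub> PIdl\<^bsub>R\<^esub> b))"


section \<open>Real closed * rings and Baer rings\<close>

text \<open>
  A ring containing \<open>A\<close> is given, up to isomorphism over \<open>A\<close>, by an injective ring
  homomorphism \<open>\<phi>\<close> from \<open>A\<close> to \<open>B\<close>.
\<close>

definition ring_extension ::
    "('a, 'm) ring_scheme \<Rightarrow> ('b, 'n) ring_scheme \<Rightarrow> ('a \<Rightarrow> 'b) \<Rightarrow> bool" where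
  "ring_extension A B \<phi> \<longleftrightarrow> cring A \<and> cring B \<and> \<phi> \<in> ring_hom A B \<and> inj_on \<phi> (carrier A)"

definition integral_extension ::
    "('a, 'm) ring_scheme \<Rightarrow> ('b, 'n) ring_scheme \<Rightarrow> ('a \<Rightarrow> 'b) \<Rightarrow> bool" where
  "integral_extension A B \<phi> \<longleftrightarrow> ring_extension A B \<phi>
     \<and> (\<forall>b\<in>carrier B. integral_over B (\<phi> ` carrier A) b)"

definition essential_extension ::
    "('a, 'm) ring_scheme \<Rightarrow> ('b, 'n) ring_scheme \<Rightarrow> ('a \<Rightarrow> 'b) \<Rightarrow> bool" where
  "essential_extension A B \<phi> \<longleftrightarrow> ring_extension A B \<phi>
     \<and> (\<forall>J. ideal J B \<and> J \<noteq> {\<zero>\<^bsub>B\<^esub>} \<longrightarrow> J \<inter> \<phi> ` carrier A \<noteq> {\<zero>\<^bsub>B\<^esub>})"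

text \<open>
  A HOL formula cannot quantify over all types, so the type \<open>'b\<close> in which the extensions have
  their carriers is a parameter. For a small \<open>'b\<close> the condition may hold only because no
  extension of \<open>A\<close> fits into \<open>'b\<close>, so \<open>'b\<close> should be at least as large as the type of \<open>A\<close>.
\<close>

definition real_closed_star :: "'b itself \<Rightarrow> ('a, 'm) ring_scheme \<Rightarrow> bool" where
  "real_closed_star (_ :: 'b itself) A \<longleftrightarrow> cring A \<and> formally_real A
     \<and> \<not> (\<exists>(B :: 'b ring) \<phi>. formally_real B \<and> \<phi> ` carrier A \<noteq> carrier B
            \<and> integral_extension A B \<phi> \<and> essential_extension A B \<phi>)"

definition annihilator :: "('a, 'm) ring_scheme \<Rightarrow> 'a set \<Rightarrow> 'a set" where
  "annihilator R S = {x \<in> carrier R. \<forall>s\<in>S. x \<otimes>\<^bsub>R\<^esub> s = \<zero>\<^bsub>R\<^esub>}"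

definition baer_ring :: "('a, 'm) ring_scheme \<Rightarrow> bool" where
  "baer_ring R \<longleftrightarrow> cring R
     \<and> (\<forall>S \<subseteq> carrier R. \<exists>e\<in>carrier R. e \<otimes>\<^bsub>R\<^esub> e = e \<and> annihilator R S = PIdl\<^bsub>R\<^esub> e)"

end

theory Submission
  imports Defs "HOL-Algebra.Algebraic_Closure_Type" "HOL-Computational_Algebra.Computational_Algebra"
begin

text \<open>
  Let \<open>A\<close> be real closed. Both directions compare idempotents of \<open>A\<close> with idempotents of an
  extension.

  Suppose that \<open>A\<close> is real closed \<open>*\<close>, and let \<open>I\<close> be the annihilator of a set and \<open>J\<close> the
  annihilator of \<open>I\<close>. Since \<open>A\<close> is reduced, \<open>A\<close> embeds into \<open>A/I \<times> A/J\<close>. This product is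
  generated over \<open>A\<close> by the idempotent \<open>(1, 0)\<close>, hence integral; it is essential because \<open>I\<close> and
  \<open>J\<close> annihilate each other; and it is formally real because annihilators in formally real rings
  are real ideals. So the embedding is onto, and the element that maps to \<open>(0, 1)\<close> is an
  idempotent that generates \<open>I\<close> (\<open>real_closed_star_imp_baer\<close>). A formally real ring that is not
  zero is infinite, so the product is no larger than \<open>A\<close> and its carrier can be placed in the
  type \<open>'b\<close>.

  Suppose conversely that \<open>A\<close> is Baer, and let \<open>B\<close> be a formally real, integral and essential
  extension. Essentiality transports annihilators: in \<open>B\<close>, too, the annihilator of an element is
  generated by an idempotent, and every idempotent of \<open>B\<close> lies in \<open>A\<close>. Let \<open>b\<close> be an element of
  \<open>B\<close> outside \<open>A\<close>. The idempotents \<open>e\<close> with \<open>e b \<in> A\<close> generate a proper ideal of \<open>B\<close>. Choose a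
  maximal ideal \<open>M\<close> above it and let \<open>Q\<close> be the ideal generated by the idempotents in \<open>M\<close>. It is
  prime, \<open>B/Q\<close> is formally real, and \<open>A/(A \<inter> Q)\<close> is a real closed integral domain over which
  \<open>B/Q\<close> is integral. A real closed integral domain has no proper formally real integral domain
  extension (\<open>real_closed_domain_integral_extension\<close>), so \<open>b\<close> agrees with an element of \<open>A\<close>
  modulo \<open>Q\<close>, that is, after multiplication by an idempotent outside \<open>M\<close>; this contradicts the
  choice of \<open>M\<close> (\<open>baer_imp_extension_surjective\<close>). The same primes show that \<open>A\<close> itself is
  formally real (\<open>baer_formally_real\<close>).

  The statement about domains rests on the classical fact that a field \<open>K\<close> in which every element
  is plus or minus a square and every polynomial of odd degree has a root becomes algebraically
  closed when a square root of \<open>-1\<close> is adjoined. It is proved below by Laplace's induction on the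
  power of two that divides the degree; Newton's identities take the place of the fundamental
  theorem on symmetric polynomials. This part is carried out in type classes, inside the algebraic
  closure of the field of fractions of the larger domain. A type cannot depend on a given ring, so
  the passage to types goes through a type whose elements form a counterexample, selected by
  Hilbert's choice operator, if there is any.
\<close>

section \<open>Newton's identities\<close>

text \<open>
  This is the logarithmic derivative of the polynomial with reciprocal roots \<open>y i\<close>, whose power
  series expansion has, up to sign, the power sums as coefficients.
\<close>

lemma fps_deriv_prod_linear:
  fixes y :: "'i \<Rightarrow> 'w :: field"
  assumes "finite I"
  shows "fps_deriv (\<Prod>i\<in>I. 1 - fps_const (y i) * fps_X) =
           - (\<Prod>i\<in>I. 1 - fps_const (y i) * fps_X) * Abs_fps (\<lambda>r. \<Sum>i\<in>I. y i ^ Suc r)"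
  using assms
proof (induction I rule: finite_induct)
  case empty
  have "Abs_fps (\<lambda>r. 0) = (0 :: 'w fps)" by (simp add: fps_eq_iff)
  then show ?case by simp
next
  case (insert i I)
  define G where "G = (\<Prod>i\<in>I. 1 - fps_const (y i) * fps_X)"
  define S where "S = Abs_fps (\<lambda>r. \<Sum>i\<in>I. y i ^ Suc r)"
  define T where "T = Abs_fps (\<lambda>r. y i ^ Suc r)"
  have T: "(1 - fps_const (y i) * fps_X) * T = fps_const (y i)"
  proof (rule fps_ext)
    fix n show "((1 - fps_const (y i) * fps_X) * T) $ n = fps_const (y i) $ n"
      by (cases n) (simp_all add: T_def algebra_simps fps_X_mult_nth)
  qed
  have ST: "Abs_fps (\<lambda>r. \<Sum>i\<in>insert i I. y i ^ Suc r) = T + S"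
    using insert by (simp add: fps_eq_iff T_def S_def)
  define u a where "u = 1 - fps_const (y i) * fps_X" and "a = fps_const (y i)"
  have u: "fps_deriv u = - a"
    by (simp add: u_def a_def)
  have uT: "u * T = a" using T by (simp add: u_def a_def)
  have "fps_deriv (u * G) = - (a * G) - u * G * S"
    using insert.IH unfolding G_def [symmetric] S_def [symmetric]
    by (simp add: u algebra_simps)
  also have "\<dots> = - (u * G) * (T + S)"
    unfolding uT [symmetric] by (simp add: algebra_simps)
  finally show ?case using insert.hyps unfolding ST G_def u_def by simp
qed

locale subfield_set =
  fixes K :: "'w :: field set"
  assumes zero [simp]: "0 \<in> K" and one [simp]: "1 \<in> K"
    and diff [intro]: "x \<in> K \<Longrightarrow> y \<in> K \<Longrightarrow> x - y \<in> K"
    and mult [intro]: "x \<in> K \<Longrightarrow> y \<in> K \<Longrightarrow> x * y \<in> K"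
    and inverse [intro]: "x \<in> K \<Longrightarrow> inverse x \<in> K"
begin

lemma uminus [intro]: "x \<in> K \<Longrightarrow> - x \<in> K"
  using diff [of 0 x] by simp

lemma add [intro]: "x \<in> K \<Longrightarrow> y \<in> K \<Longrightarrow> x + y \<in> K"
  using diff [of x "- y"] by auto

lemma divide [intro]: "x \<in> K \<Longrightarrow> y \<in> K \<Longrightarrow> x / y \<in> K"
  by (simp add: field_class.field_divide_inverse inverse mult)

lemma of_nat [simp]: "of_nat n \<in> K"
  by (induction n) auto

lemma numeral [simp]: "numeral n \<in> K"
  using of_nat [of "numeral n"] by simp

lemma power [intro]: "x \<in> K \<Longrightarrow> x ^ n \<in> K"
  by (induction n) auto

lemma sum [intro]: "(\<And>i. i \<in> I \<Longrightarrow> f i \<in> K) \<Longrightarrow> (\<Sum>i\<in>I. f i) \<in> K"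
  by (induction I rule: infinite_finite_induct) auto

definition polys_over :: "'w poly set" where
  "polys_over = {p. \<forall>i. Polynomial.coeff p i \<in> K}"

lemma polys_overD: "p \<in> polys_over \<Longrightarrow> Polynomial.coeff p i \<in> K"
  by (simp add: polys_over_def)

lemma polys_over_pCons [simp]: "pCons a p \<in> polys_over \<longleftrightarrow> a \<in> K \<and> p \<in> polys_over"
  by (auto simp: polys_over_def coeff_pCons split: nat.splits dest: spec [of _ "Suc _"] spec [of _ 0])

lemma polys_over_0 [simp]: "0 \<in> polys_over"
  by (simp add: polys_over_def)

lemma polys_over_diff [intro]: "p \<in> polys_over \<Longrightarrow> q \<in> polys_over \<Longrightarrow> p - q \<in> polys_over"
  by (auto simp: polys_over_def)

lemma polys_over_smult [intro]: "c \<in> K \<Longrightarrow> p \<in> polys_over \<Longrightarrow> smult c p \<in> polys_over"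
  by (auto simp: polys_over_def)

lemma polys_over_add [intro]: "p \<in> polys_over \<Longrightarrow> q \<in> polys_over \<Longrightarrow> p + q \<in> polys_over"
  by (auto simp: polys_over_def)

text \<open>
  Comparing coefficients in the logarithmic derivative expresses \<open>n\<close> times the \<open>n\<close>-th elementary
  symmetric function through the power sums and the lower elementary symmetric functions. In
  characteristic \<open>0\<close> the recursion can be solved in both directions, so a monic polynomial has
  coefficients in \<open>K\<close> precisely when the power sums of its roots lie in \<open>K\<close>.
\<close>

lemma prod_linear_polys_over_iff:
  fixes y :: "'i \<Rightarrow> 'w"
  assumes fin: "finite I" and char: "\<And>n. of_nat (Suc n) \<noteq> (0 :: 'w)"
  shows "(\<Prod>i\<in>I. [:- y i, 1:]) \<in> polys_over \<longleftrightarrow> (\<forall>r. (\<Sum>i\<in>I. y i ^ r) \<in> K)"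
proof -
  define f where "f = (\<Prod>i\<in>I. [:- y i, 1:])"
  define G where "G = (\<Prod>i\<in>I. 1 - fps_const (y i) * fps_X)"
  define p where "p r = (\<Sum>i\<in>I. y i ^ r)" for r
  have reflect: "reflect_poly [:- a, 1:] = [:1, - a:]" for a :: 'w
    by (cases "a = 0") (simp_all add: reflect_poly_pCons' monom_Suc monom_0)
  have fps: "fps_of_poly [:1, - a:] = 1 - fps_const a * fps_X" for a :: 'w
    by (simp add: fps_of_poly_pCons)
  have G: "G = fps_of_poly (reflect_poly f)"
    by (simp add: G_def f_def reflect_poly_prod fps_of_poly_prod reflect fps)
  have polys_over: "f \<in> polys_over \<longleftrightarrow> (\<forall>n. G $ n \<in> K)"
  proof
    assume "f \<in> polys_over"
    then show "\<forall>n. G $ n \<in> K"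
      by (auto simp: G coeff_reflect_poly polys_overD)
  next
    assume *: "\<forall>n. G $ n \<in> K"
    have "Polynomial.coeff f i \<in> K" for i
    proof (cases "i \<le> Polynomial.degree f")
      case True
      then show ?thesis
        using spec [OF *, of "Polynomial.degree f - i"]
        by (simp add: G coeff_reflect_poly) (metis diff_diff_cancel diff_le_self linorder_not_less)
    qed (simp add: coeff_eq_0)
    then show "f \<in> polys_over" by (simp add: polys_over_def)
  qed
  have G0: "G $ 0 = 1"
    using fin unfolding G_def by (induction I rule: finite_induct) simp_all
  have rec: "of_nat (Suc n) * G $ (Suc n) = - (\<Sum>i=0..n. G $ i * p (Suc (n - i)))" for n
  proof -
    have "fps_deriv G $ n = (- G * Abs_fps (\<lambda>r. p (Suc r))) $ n"
      unfolding G_def p_def using fps_deriv_prod_linear [OF fin] by metis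
    then show ?thesis
      by (simp add: fps_mult_nth sum_negf)
  qed
  have "(\<forall>n. G $ n \<in> K) \<longleftrightarrow> (\<forall>r. p r \<in> K)"
  proof (intro iffI allI)
    fix n
    assume p: "\<forall>r. p r \<in> K"
    show "G $ n \<in> K"
    proof (induction n rule: less_induct)
      case (less n)
      show ?case
      proof (cases n)
        case (Suc m)
        have "of_nat (Suc m) * G $ n \<in> K"
          unfolding Suc rec using less p Suc by (intro uminus sum mult) auto
        then have "of_nat (Suc m) * G $ n / of_nat (Suc m) \<in> K"
          by (intro divide of_nat)
        then show ?thesis using char [of m] by (simp del: of_nat_Suc)
      qed (simp add: G0)
    qed
  next
    fix r
    assume g: "\<forall>n. G $ n \<in> K"
    show "p r \<in> K"
    proof (induction r rule: less_induct)
      case (less r)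
      show ?case
      proof (cases r)
        case (Suc m)
        have "p r = - (\<Sum>i=1..m. G $ i * p (Suc (m - i))) - of_nat (Suc m) * G $ Suc m"
          unfolding rec Suc by (simp add: sum.atLeast_Suc_atMost [of 0] G0 del: sum.atLeast0_atMost_Suc)
        also have "\<dots> \<in> K"
          using less g Suc by (intro uminus sum mult diff of_nat) auto
        finally show ?thesis .
      qed (simp add: p_def)
    qed
  qed
  then show ?thesis using polys_over by (simp add: f_def p_def)
qed


text \<open>
  Division by a monic polynomial involves no inversion of coefficients, so it stays inside \<open>K\<close>.
\<close>

lemma division:
  assumes q: "q \<in> polys_over" "lead_coeff q = 1" "Polynomial.degree q > 0"
  shows "f \<in> polys_over \<Longrightarrow> \<exists>g\<in>polys_over. \<exists>r\<in>polys_over. f = q * g + r \<and> Polynomial.degree r < Polynomial.degree q"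
proof (induction f)
  case 0
  then show ?case using q by (intro bexI [of _ 0]) auto
next
  case (pCons a f)
  then obtain g r where gr: "g \<in> polys_over" "r \<in> polys_over" "f = q * g + r"
      "Polynomial.degree r < Polynomial.degree q"
    by auto
  let ?r = "pCons a r"
  define c where "c = Polynomial.coeff ?r (Polynomial.degree q)"
  have r: "?r \<in> polys_over" using gr pCons by simp
  then have c: "c \<in> K" by (simp add: c_def polys_overD)
  have le: "Polynomial.degree ?r \<le> Polynomial.degree q"
    using gr by (simp add: degree_pCons_eq_if)
  have "Polynomial.degree (?r - smult c q) \<le> Polynomial.degree q"
    using le by (intro degree_diff_le) auto
  moreover have "Polynomial.coeff (?r - smult c q) (Polynomial.degree q) = 0"
    using q(2) by (simp add: c_def)
  ultimately have "Polynomial.degree (?r - smult c q) < Polynomial.degree q"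
    using q(3) by (metis degree_0 le_neq_implies_less leading_coeff_0_iff)
  moreover have "pCons a f = q * (pCons 0 g + [:c:]) + (?r - smult c q)"
    using gr by (simp add: algebra_simps)
  moreover have "?r - smult c q \<in> polys_over" "pCons 0 g + [:c:] \<in> polys_over"
    using gr r c q by (auto intro!: polys_over_add polys_over_diff polys_over_smult)
  ultimately show ?case by blast
qed

end

lemma sum_symmetric:
  fixes F :: "nat \<Rightarrow> nat \<Rightarrow> 'b :: comm_semiring_1"
  assumes "\<And>i j. F i j = F j i"
  shows "(\<Sum>i<n. \<Sum>j<n. F i j) = 2 * (\<Sum>i<n. \<Sum>j<i. F i j) + (\<Sum>i<n. F i i)"
proof (induction n)
  case (Suc n)
  have "(\<Sum>i<n. F i n) = (\<Sum>i<n. F n i)" by (rule sum.cong) (auto intro: assms)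
  then show ?case using Suc by (simp add: sum.distrib algebra_simps mult_2)
qed simp

section \<open>The fundamental theorem of algebra over a real closed field\<close>

text \<open>
  The field \<open>K\<close> sits inside an algebraically closed field in which \<open>j\<close> is a square root of \<open>-1\<close>.
  The assumption on sums of three squares makes \<open>a\<^sup>2 + b\<^sup>2\<close> a square instead of minus a square.
\<close>

locale real_closed_subfield = subfield_set K for K :: "'w :: alg_closed_field set" +
  fixes j :: 'w
  assumes j: "j\<^sup>2 = -1"
    and char: "of_nat (Suc n) \<noteq> (0 :: 'w)"
    and real: "\<lbrakk>a \<in> K; b \<in> K; c \<in> K; a\<^sup>2 + b\<^sup>2 + c\<^sup>2 = 0\<rbrakk> \<Longrightarrow> a = 0 \<and> b = 0 \<and> c = 0"
    and square: "a \<in> K \<Longrightarrow> \<exists>b\<in>K. a = b\<^sup>2 \<or> a = - (b\<^sup>2)"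
    and odd_root: "\<lbrakk>p \<in> polys_over; lead_coeff p = 1; odd (Polynomial.degree p)\<rbrakk> \<Longrightarrow> \<exists>x\<in>K. poly p x = 0"
begin

lemma two: "(2 :: 'w) \<noteq> 0"
  using char [of 1] by simp

definition C :: "'w set" where
  "C = {a + b * j | a b. a \<in> K \<and> b \<in> K}"

lemma C_I: "\<lbrakk>a \<in> K; b \<in> K\<rbrakk> \<Longrightarrow> a + b * j \<in> C"
  by (auto simp: C_def)

lemma C_K: "a \<in> K \<Longrightarrow> a \<in> C"
  using C_I [of a 0] by simp

lemma C_add: "x \<in> C \<Longrightarrow> y \<in> C \<Longrightarrow> x + y \<in> C"
proof -
  assume "x \<in> C" "y \<in> C"
  then obtain a b c d where "x = a + b * j" "y = c + d * j" "a \<in> K" "b \<in> K" "c \<in> K" "d \<in> K"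
    by (auto simp: C_def)
  then have "x + y = (a + c) + (b + d) * j" "a + c \<in> K" "b + d \<in> K"
    by (auto simp: algebra_simps)
  then show ?thesis using C_I by metis
qed

lemma C_mult: "x \<in> C \<Longrightarrow> y \<in> C \<Longrightarrow> x * y \<in> C"
proof -
  assume "x \<in> C" "y \<in> C"
  then obtain a b c d where *: "x = a + b * j" "y = c + d * j" "a \<in> K" "b \<in> K" "c \<in> K" "d \<in> K"
    by (auto simp: C_def)
  then have "x * y = (a * c) + b * d * j\<^sup>2 + (a * d + b * c) * j"
    by (simp add: algebra_simps power2_eq_square)
  then have "x * y = (a * c - b * d) + (a * d + b * c) * j" by (simp add: j)
  moreover have "a * c - b * d \<in> K" "a * d + b * c \<in> K" using * by auto
  ultimately show ?thesis using C_I by metis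
qed

lemma C_uminus: "x \<in> C \<Longrightarrow> - x \<in> C"
  using C_mult [OF C_K [of "- 1"], of x] uminus [OF one] by simp

lemma C_diff: "x \<in> C \<Longrightarrow> y \<in> C \<Longrightarrow> x - y \<in> C"
  using C_add [OF _ C_uminus] by fastforce

lemma C_divide: "x \<in> C \<Longrightarrow> a \<in> K \<Longrightarrow> x / a \<in> C"
  using C_mult [OF _ C_K [of "inverse a"]] by (auto simp: field_class.field_divide_inverse)

text \<open>
  The usual formula for the square root of \<open>a + b j\<close> takes square roots of \<open>s = (r + a) / 2\<close> and
  \<open>t = (r - a) / 2\<close>, where \<open>r\<^sup>2 = a\<^sup>2 + b\<^sup>2\<close>. No sign has to be chosen for \<open>r\<close>: if \<open>s \<noteq> 0\<close> is minus
  a square, then so is \<open>t\<close>, since \<open>4 s t = b\<^sup>2\<close>, and the roles of the two parts are exchanged.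
\<close>

lemma C_square_root:
  assumes "w\<^sup>2 \<in> C"
  shows "w \<in> C"
proof -
  obtain a b where ab: "a \<in> K" "b \<in> K" "w\<^sup>2 = a + b * j"
    using assms by (auto simp: C_def)
  obtain r where r: "r \<in> K" "r\<^sup>2 = a\<^sup>2 + b\<^sup>2"
  proof -
    obtain r where *: "r \<in> K" "a\<^sup>2 + b\<^sup>2 = r\<^sup>2 \<or> a\<^sup>2 + b\<^sup>2 = - (r\<^sup>2)"
      using square [of "a\<^sup>2 + b\<^sup>2"] ab by auto
    have "a\<^sup>2 + b\<^sup>2 = r\<^sup>2" if "a\<^sup>2 + b\<^sup>2 = - (r\<^sup>2)"
      using real [of a b r] ab * that by auto
    then show thesis using that * by metis
  qed
  define s t where "s = (r + a) / 2" and "t = (r - a) / 2"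
  have st: "s \<in> K" "s - t = a"
    using r ab two by (auto simp: s_def t_def diff_divide_distrib [symmetric])
  have "4 * (s * t) = (2 * s) * (2 * t)" by simp
  also have "2 * s = r + a" using two by (simp add: s_def)
  also have "2 * t = r - a" using two by (simp add: t_def)
  also have "(r + a) * (r - a) = b\<^sup>2" using r by (simp add: power2_eq_square algebra_simps)
  finally have prod: "4 * (s * t) = b\<^sup>2" .
  have four: "(4 :: 'w) \<noteq> 0" using char [of 3] by simp
  obtain u where u: "u \<in> K" "s = u\<^sup>2 \<or> s = - (u\<^sup>2)"
    using square st by auto
  obtain z where z: "z \<in> C" "z\<^sup>2 = w\<^sup>2"
  proof (cases "u = 0")
    case True
    then have "s = 0" using u by auto
    then have "b = 0" using prod by simp
    moreover obtain v where "v \<in> K" "a = v\<^sup>2 \<or> a = - (v\<^sup>2)"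
      using square ab by auto
    ultimately show thesis
      using that [of v] that [of "0 + v * j"] ab C_K C_I [of 0 v]
      by (auto simp: power_mult_distrib j)
  next
    case False
    define v where "v = b / (2 * u)"
    have v: "v \<in> K" using divide [OF ab(2) mult [OF numeral u(1)]] by (simp add: v_def)
    have uv: "2 * u * v = b" using False two by (simp add: v_def)
    have uv2: "4 * (u\<^sup>2 * v\<^sup>2) = b\<^sup>2" unfolding uv [symmetric] by (simp add: power_mult_distrib)
    show thesis
    proof (cases "s = u\<^sup>2")
      case True
      have "4 * (u\<^sup>2 * v\<^sup>2) = 4 * (u\<^sup>2 * t)" using prod uv2 True by simp
      then have "v\<^sup>2 = t" using False four by simp
      have "(u + v * j)\<^sup>2 = u\<^sup>2 + v\<^sup>2 * j\<^sup>2 + (2 * u * v) * j"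
        by (simp add: power2_eq_square algebra_simps)
      also have "\<dots> = w\<^sup>2" using uv \<open>v\<^sup>2 = t\<close> True st ab by (simp add: j)
      finally show ?thesis using that C_I u v by blast
    next
      case s: False
      then have s: "s = - (u\<^sup>2)" using u by auto
      have "4 * (u\<^sup>2 * v\<^sup>2) = 4 * (u\<^sup>2 * (- t))" using prod uv2 s by simp
      then have "v\<^sup>2 = - t" using False four by (metis mult_left_cancel power_not_zero)
      have "(v + u * j)\<^sup>2 = v\<^sup>2 + u\<^sup>2 * j\<^sup>2 + (2 * u * v) * j"
        by (simp add: power2_eq_square algebra_simps)
      also have "\<dots> = w\<^sup>2" using uv \<open>v\<^sup>2 = - t\<close> s st(2) [symmetric] ab by (simp add: j)
      finally show ?thesis using that C_I u v by blast
    qed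
  qed
  then show ?thesis using C_uminus [of z] by (auto simp: power2_eq_iff)
qed

text \<open>
  The elements \<open>x\<close> and \<open>y\<close> are the roots of a quadratic polynomial over \<open>C\<close>, whose discriminant
  \<open>(x - y)\<^sup>2\<close> has a square root in \<open>C\<close>.
\<close>

lemma C_quadratic:
  assumes "x + y \<in> C" "x * y \<in> C"
  shows "x \<in> C"
proof -
  have "(x - y)\<^sup>2 = (x + y) * (x + y) - 4 * (x * y)"
    by (simp add: power2_eq_square algebra_simps)
  also have "\<dots> \<in> C" using C_diff [OF C_mult [OF assms(1,1)] C_mult [OF C_K assms(2)]] by simp
  finally have "x - y \<in> C" by (rule C_square_root)
  then have "((x + y) + (x - y)) / 2 \<in> C" using assms by (intro C_divide C_add [OF assms(1)]) auto
  then show ?thesis using two by simp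
qed

text \<open>
  Laplace's auxiliary polynomial. The power sums of the numbers \<open>h i k\<close> over all pairs \<open>(i, k)\<close>
  expand into products of two power sums of the \<open>y i\<close>. Removing the diagonal and halving gives the
  sum over the pairs with \<open>k < i\<close>, because \<open>h\<close> is symmetric.
\<close>

lemma pair_polynomial_polys_over:
  fixes y :: "nat \<Rightarrow> 'w" and c :: 'w
  assumes "(\<Prod>i<n. [:- y i, 1:]) \<in> polys_over" and c: "c \<in> K"
  shows "(\<Prod>(i, k)\<in>(SIGMA i:{..<n}. {..<i}). [:- (y i + y k + c * y i * y k), 1:]) \<in> polys_over"
proof -
  define h where "h i k = y i + y k + c * y i * y k" for i k
  have p: "(\<Sum>i<n. y i ^ r) \<in> K" for r
    using prod_linear_polys_over_iff [of "{..<n}" y] assms char by simp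
  have full: "(\<Sum>i<n. \<Sum>k<n. y i ^ a * y k ^ b * h i k ^ r) \<in> K" for a b r
  proof (induction r arbitrary: a b)
    case 0
    then show ?case using p by (auto simp: sum_product [symmetric])
  next
    case (Suc r)
    have "(\<Sum>i<n. \<Sum>k<n. y i ^ a * y k ^ b * h i k ^ Suc r)
        = (\<Sum>i<n. \<Sum>k<n. y i ^ Suc a * y k ^ b * h i k ^ r)
          + (\<Sum>i<n. \<Sum>k<n. y i ^ a * y k ^ Suc b * h i k ^ r)
          + c * (\<Sum>i<n. \<Sum>k<n. y i ^ Suc a * y k ^ Suc b * h i k ^ r)"
      unfolding sum_distrib_left sum.distrib [symmetric]
      by (intro sum.cong refl) (simp add: h_def algebra_simps)
    also have "\<dots> \<in> K" using Suc c by blast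
    finally show ?case .
  qed
  have diag: "(\<Sum>i<n. y i ^ a * h i i ^ r) \<in> K" for a r
  proof (induction r arbitrary: a)
    case 0
    then show ?case using p by simp
  next
    case (Suc r)
    have "(\<Sum>i<n. y i ^ a * h i i ^ Suc r)
        = 2 * (\<Sum>i<n. y i ^ Suc a * h i i ^ r) + c * (\<Sum>i<n. y i ^ Suc (Suc a) * h i i ^ r)"
      unfolding sum_distrib_left sum.distrib [symmetric]
      by (intro sum.cong refl) (simp add: h_def algebra_simps)
    also have "\<dots> \<in> K" using Suc c numeral by blast
    finally show ?case .
  qed
  have "(\<Sum>(i, k)\<in>(SIGMA i:{..<n}. {..<i}). h i k ^ r) \<in> K" for r
  proof -
    have "(\<Sum>i<n. \<Sum>k<n. h i k ^ r) = 2 * (\<Sum>i<n. \<Sum>k<i. h i k ^ r) + (\<Sum>i<n. h i i ^ r)"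
      by (rule sum_symmetric) (simp add: h_def algebra_simps)
    then have "(\<Sum>i<n. \<Sum>k<i. h i k ^ r)
        = ((\<Sum>i<n. \<Sum>k<n. h i k ^ r) - (\<Sum>i<n. h i i ^ r)) / 2"
      using two by simp
    also have "\<dots> \<in> K"
      using full [of 0 0 r] diag [of 0 r] by auto
    finally show ?thesis by (simp add: sum.Sigma)
  qed
  then have "(\<Prod>p\<in>(SIGMA i:{..<n}. {..<i}). [:- h (fst p) (snd p), 1:]) \<in> polys_over"
    using char by (subst prod_linear_polys_over_iff) (auto simp: case_prod_unfold)
  then show ?thesis by (simp add: h_def case_prod_unfold)
qed

text \<open>
  Induction on the exponent \<open>e\<close> of two in the degree \<open>n\<close>. If \<open>n\<close> is even, Laplace's auxiliary
  polynomial has degree \<open>n (n - 1) / 2\<close>, which is divisible by one factor two less. So for every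
  natural number \<open>c\<close> there is a pair of roots \<open>u\<close>, \<open>v\<close> with \<open>u + v + c u v \<in> C\<close>. There are more
  numbers \<open>c\<close> than pairs; two values of \<open>c\<close> with the same pair yield \<open>u v \<in> C\<close> and
  \<open>u + v \<in> C\<close>, and then \<open>u \<in> C\<close>.
\<close>

lemma root_in_C:
  assumes "f \<in> polys_over" "lead_coeff f = 1" "Polynomial.degree f = 2 ^ e * m" "odd m"
  shows "\<exists>z\<in>C. poly f z = 0"
  using assms
proof (induction e arbitrary: f m)
  case 0
  then show ?case using odd_root C_K by fastforce
next
  case (Suc e)
  define n where "n = Polynomial.degree f"
  have "f \<noteq> 0" using Suc.prems by auto
  then obtain A where A: "size A = n" "f = (\<Prod>x\<in>#A. [:- x, 1:])"
    using alg_closed_imp_factorization [of f] Suc.prems(2) unfolding n_def by (metis smult_1_left)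
  obtain xs where xs: "mset xs = A" using ex_mset by blast
  define y where "y i = xs ! i" for i
  have len: "length xs = n" using A xs by auto
  have "f = prod_list (map (\<lambda>x. [:- x, 1:]) xs)"
    using A xs by (metis mset_map prod_mset_prod_list)
  then have f: "f = (\<Prod>i<n. [:- y i, 1:])"
    using len by (simp add: prod.list_conv_set_nth y_def atLeast0LessThan)
  let ?S = "SIGMA i:{..<n}. {..<i}"
  have card: "2 * card ?S + n = n * n"
    using sum_symmetric [of "\<lambda>_ _. 1 :: nat" n] by simp
  have "odd ((n - 1) * m)" "card ?S = 2 ^ e * ((n - 1) * m)"
  proof -
    have n: "n = 2 * (2 ^ e * m)" using Suc.prems n_def by simp
    have "n > 0" using n Suc.prems by (auto intro!: Nat.gr0I)
    then show "odd ((n - 1) * m)" using n Suc.prems by auto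
    have "2 * card ?S = n * (n - 1)" using card by (simp add: diff_mult_distrib2)
    then show "card ?S = 2 ^ e * ((n - 1) * m)" using n by simp
  qed
  note card = this
  define h where "h c p = y (fst p) + y (snd p) + of_nat c * y (fst p) * y (snd p)" for c p
  have "\<exists>p\<in>?S. h c p \<in> C" for c
  proof -
    define g where "g = (\<Prod>p\<in>?S. [:- h c p, 1:])"
    have "g \<in> polys_over"
      using pair_polynomial_polys_over [of y n "of_nat c"] Suc.prems f
      by (simp add: g_def h_def case_prod_unfold)
    moreover have "lead_coeff g = 1" by (simp add: g_def lead_coeff_prod)
    moreover have "Polynomial.degree g = card ?S"
      by (simp add: g_def degree_prod_eq_sum_degree)
    ultimately obtain z where "z \<in> C" "poly g z = 0"
      using Suc.IH card by metis
    then show ?thesis by (auto simp: g_def poly_prod)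
  qed
  then obtain p where p: "p c \<in> ?S" "h c (p c) \<in> C" for c by metis
  have "\<not> inj p"
  proof
    assume "inj p"
    then have "finite (UNIV :: nat set)"
      using p(1) by (intro inj_on_finite [of p UNIV ?S] image_subsetI finite_SigmaI) auto
    then show False by simp
  qed
  then obtain c d where cd: "c < d" "p c = p d"
    by (metis injI linorder_neq_iff)
  define u v where "u = y (fst (p c))" and "v = y (snd (p c))"
  have C: "u + v + of_nat c * (u * v) \<in> C" "u + v + of_nat d * (u * v) \<in> C"
    using p(2) [of c] p(2) [of d] cd by (simp_all add: h_def u_def v_def mult.assoc)
  have "(u + v + of_nat d * (u * v)) - (u + v + of_nat c * (u * v)) = of_nat (d - c) * (u * v)"
    using cd by (simp add: of_nat_diff algebra_simps)
  then have "of_nat (d - c) * (u * v) \<in> C" using C_diff [OF C(2,1)] by simp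
  then have "of_nat (d - c) * (u * v) / of_nat (d - c) \<in> C" by (rule C_divide) simp
  moreover have "of_nat (d - c) \<noteq> (0 :: 'w)" using char [of "d - c - 1"] cd by (metis Suc_pred' diff_Suc_eq_diff_pred diff_diff_left One_nat_def plus_1_eq_Suc zero_less_diff)
  ultimately have uv: "u * v \<in> C" by simp
  then have "u + v + of_nat c * (u * v) - of_nat c * (u * v) \<in> C"
    using C_diff [OF C(1) C_mult [OF C_K [OF of_nat [of c]] uv]] by simp
  then have "u \<in> C" using uv by (intro C_quadratic [of u v]) simp_all
  moreover have "poly f u = 0"
    using p(1) [of c] by (auto simp: f poly_prod u_def)
  ultimately show ?case by blast
qed

text \<open>
  By the previous lemma \<open>f\<close> has some root \<open>z\<close> in \<open>C\<close>, not necessarily \<open>x\<close>. The minimal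
  polynomial \<open>q\<close> of \<open>z\<close> over \<open>K\<close> has degree at most two and all its roots lie in \<open>C\<close>. It divides
  \<open>f\<close>, so \<open>x\<close> is a root of \<open>q\<close> or of a polynomial of smaller degree.
\<close>

theorem algebraic_in_C:
  assumes "f \<in> polys_over" "lead_coeff f = 1" "poly f x = 0"
  shows "x \<in> C"
  using assms
proof (induction "Polynomial.degree f" arbitrary: f rule: less_induct)
  case less
  have "Polynomial.degree f \<noteq> 0"
  proof
    assume "Polynomial.degree f = 0"
    then obtain a where "f = [:a:]" by (metis degree_eq_zeroE)
    with less.prems show False by simp
  qed
  then obtain e m where em: "Polynomial.degree f = 2 ^ e * m" "odd m"
    by (metis (no_types, lifting) dvd_mult_div_cancel multiplicity_decompose multiplicity_dvd not_is_unit_0 odd_one)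
  then obtain z where z: "z \<in> C" "poly f z = 0"
    using root_in_C less.prems by metis
  then obtain a b where ab: "z = a + b * j" "a \<in> K" "b \<in> K" by (auto simp: C_def)
  obtain q where q: "q \<in> polys_over" "lead_coeff q = 1" "Polynomial.degree q > 0" "poly q z = 0"
    and min: "\<And>r. \<lbrakk>r \<in> polys_over; Polynomial.degree r < Polynomial.degree q; poly r z = 0\<rbrakk> \<Longrightarrow> r = 0"
    and q_root: "\<And>w. poly q w = 0 \<Longrightarrow> w \<in> C"
  proof (cases "b = 0")
    case True
    show thesis
    proof (rule that [of "[:- a, 1:]"])
      fix r assume "Polynomial.degree r < Polynomial.degree [:- a, 1:]" "poly r z = 0"
      then show "r = 0" by (auto elim!: degree_eq_zeroE)
    next
      fix w assume "poly [:- a, 1:] w = 0"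
      then show "w \<in> C" using ab C_K by simp
    qed (use True ab in auto)
  next
    case False
    show thesis
    proof (rule that [of "[:a\<^sup>2 + b\<^sup>2, - 2 * a, 1:]"])
      have "poly [:a\<^sup>2 + b\<^sup>2, - 2 * a, 1:] z = b\<^sup>2 * (1 + j\<^sup>2)"
        unfolding ab by (simp add: power2_eq_square algebra_simps)
      then show "poly [:a\<^sup>2 + b\<^sup>2, - 2 * a, 1:] z = 0" by (simp add: j)
    next
      show "[:a\<^sup>2 + b\<^sup>2, - 2 * a, 1:] \<in> polys_over"
        using ab uminus [OF mult [OF numeral, of a]] by (auto simp: power2_eq_square)
    next
      fix r assume r: "r \<in> polys_over" "Polynomial.degree r < Polynomial.degree [:a\<^sup>2 + b\<^sup>2, - 2 * a, 1:]" "poly r z = 0"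
      define s t where "s = Polynomial.coeff r 0" and "t = Polynomial.coeff r 1"
      have st: "s \<in> K" "t \<in> K" using r by (auto simp: s_def t_def polys_overD)
      have r_eq: "r = [:s, t:]"
        using r by (intro poly_eqI) (auto simp: s_def t_def coeff_pCons coeff_eq_0 split: nat.splits)
      then have eq: "s + t * a = - (t * b) * j" using r(3) ab
        by (simp add: algebra_simps eq_neg_iff_add_eq_0)
      then have "(s + t * a)\<^sup>2 = (t * b)\<^sup>2 * j\<^sup>2" by (simp add: power_mult_distrib)
      then have "(s + t * a)\<^sup>2 + (t * b)\<^sup>2 + 0\<^sup>2 = 0" by (simp add: j)
      then have "s + t * a = 0" "t * b = 0"
        using real [of "s + t * a" "t * b" 0] st ab by auto
      then show "r = 0" using r_eq False by simp
    next
      fix w assume "poly [:a\<^sup>2 + b\<^sup>2, - 2 * a, 1:] w = 0"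
      then have "(w - a)\<^sup>2 = - (b\<^sup>2)" by (simp add: power2_eq_square algebra_simps add_eq_0_iff)
      also have "\<dots> \<in> C" using ab by (intro C_K uminus power)
      finally have "w - a \<in> C" by (rule C_square_root)
      then show "w \<in> C" using C_add [OF _ C_K [OF ab(2)]] by fastforce
    qed auto
  qed
  obtain g r where gr: "g \<in> polys_over" "r \<in> polys_over" "f = q * g + r"
      "Polynomial.degree r < Polynomial.degree q"
    using division [OF q(1-3)] less.prems by metis
  have "r = 0" using gr z q min by simp
  then have f: "f = q * g" using gr by simp
  have "lead_coeff g = 1" using less.prems q f by (simp add: lead_coeff_mult)
  moreover from this have "g \<noteq> 0" "q \<noteq> 0" using q by auto
  then have "Polynomial.degree g < Polynomial.degree f" using f q by (simp add: degree_mult_eq)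
  moreover have "poly q x = 0 \<or> poly g x = 0" using less.prems f by simp
  ultimately show ?case using q_root less.hyps gr by blast
qed

end

section \<open>Integral elements in formally real domains\<close>

text \<open>
  Here \<open>\<iota>\<close> embeds the domain into an algebraically closed field, and \<open>K\<close> is the field of fractions
  of \<open>D\<close> inside that field. It inherits the properties of a real closed field from \<open>D\<close>: a fraction
  \<open>r / s\<close> is plus or minus a square because \<open>r s\<close> is, and a monic polynomial of odd degree becomes
  a polynomial over \<open>D\<close> once its roots are multiplied by a common denominator. So \<open>\<iota> x = a + b j\<close>
  with \<open>a, b \<in> K\<close>. If \<open>b \<noteq> 0\<close>, then \<open>j\<close> is a fraction of elements of the domain, and \<open>-1\<close> would
  be the square of that fraction.
\<close>

lemma algebraic_over_fractions:
  fixes \<iota> :: "'e :: idom \<Rightarrow> 'w :: alg_closed_field" and D :: "'e set"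
  assumes \<iota>: "\<And>x y. \<iota> (x + y) = \<iota> x + \<iota> y" "\<And>x y. \<iota> (x * y) = \<iota> x * \<iota> y" "\<iota> 1 = 1" "inj \<iota>"
    and D: "1 \<in> D" "\<And>x y. x \<in> D \<Longrightarrow> y \<in> D \<Longrightarrow> x - y \<in> D" "\<And>x y. x \<in> D \<Longrightarrow> y \<in> D \<Longrightarrow> x * y \<in> D"
    and formally_real: "\<And>(n :: nat) (f :: nat \<Rightarrow> 'e) i. (\<Sum>i<n. f i * f i) = 0 \<Longrightarrow> i < n \<Longrightarrow> f i = 0"
    and square: "\<And>a. a \<in> D \<Longrightarrow> \<exists>b\<in>D. a = b * b \<or> a = - (b * b)"
    and odd_root: "\<And>p. \<lbrakk>\<forall>i. Polynomial.coeff p i \<in> D; lead_coeff p = 1; odd (Polynomial.degree p)\<rbrakk>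
      \<Longrightarrow> \<exists>x\<in>D. poly p x = 0"
    and p: "\<forall>i. Polynomial.coeff p i \<in> D" "lead_coeff p = 1" "poly p x = 0"
  shows "\<exists>r\<in>D. \<exists>s\<in>D. s \<noteq> 0 \<and> s * x = r"
proof -
  have D0: "0 \<in> D" using D(2) [OF D(1) D(1)] by simp
  have \<iota>0 [simp]: "\<iota> 0 = 0" by (metis \<iota>(1) add_0 add_cancel_right_right)
  have \<iota>_eq [simp]: "\<iota> x = \<iota> y \<longleftrightarrow> x = y" for x y using \<iota>(4) by (simp add: inj_eq)
  have \<iota>_0 [simp]: "\<iota> x = 0 \<longleftrightarrow> x = 0" for x using \<iota>_eq [of x 0] by simp
  have \<iota>_minus: "\<iota> (- x) = - \<iota> x" for x using \<iota>(1) [of x "- x"] by (simp add: eq_neg_iff_add_eq_0 add.commute)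
  have \<iota>_diff: "\<iota> (x - y) = \<iota> x - \<iota> y" for x y using \<iota>(1) [of x "- y"] by (simp add: \<iota>_minus)
  have \<iota>_poly: "poly (map_poly \<iota> q) (\<iota> y) = \<iota> (poly q y)" for q y
    by (induction q) (simp_all add: map_poly_pCons \<iota>)
  define K where "K = {\<iota> r / \<iota> s | r s. r \<in> D \<and> s \<in> D \<and> s \<noteq> 0}"
  have KI: "\<iota> r / \<iota> s \<in> K" if "r \<in> D" "s \<in> D" "s \<noteq> 0" for r s
    using that by (auto simp: K_def)
  have \<iota>_K: "\<iota> r \<in> K" if "r \<in> D" for r
    using KI [OF that D(1)] by (simp add: \<iota>)
  interpret subfield_set K
  proof
    show "0 \<in> K" "1 \<in> K" using \<iota>_K [OF D0] \<iota>_K [OF D(1)] by (simp_all add: \<iota>)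
  next
    fix x y assume "x \<in> K" "y \<in> K"
    then obtain r s r' s' where *: "x = \<iota> r / \<iota> s" "y = \<iota> r' / \<iota> s'" "r \<in> D" "s \<in> D" "s \<noteq> 0"
        "r' \<in> D" "s' \<in> D" "s' \<noteq> 0"
      by (auto simp: K_def)
    have "x - y = \<iota> (r * s' - r' * s) / \<iota> (s * s')"
      using * by (simp add: \<iota>_diff \<iota> diff_frac_eq)
    moreover have "x * y = \<iota> (r * r') / \<iota> (s * s')" using * by (simp add: \<iota>)
    ultimately show "x - y \<in> K" "x * y \<in> K" using * KI D by auto
  next
    fix x assume "x \<in> K"
    then obtain r s where *: "x = \<iota> r / \<iota> s" "r \<in> D" "s \<in> D" "s \<noteq> 0" by (auto simp: K_def)
    show "inverse x \<in> K"
      using * KI [of s r] \<iota>_K [OF D0] by (cases "r = 0") auto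
  qed
  have denominator: "\<exists>d\<in>D. d \<noteq> 0 \<and> (\<forall>c\<in>F. \<iota> d * c \<in> \<iota> ` D)" if "finite F" "F \<subseteq> K" for F
    using that
  proof (induction F rule: finite_induct)
    case empty
    show ?case using D(1) zero_neq_one by (intro bexI [of _ 1]) auto
  next
    case (insert c F)
    then obtain d where d: "d \<in> D" "d \<noteq> 0" "\<forall>c\<in>F. \<iota> d * c \<in> \<iota> ` D" by auto
    obtain r s where rs: "c = \<iota> r / \<iota> s" "r \<in> D" "s \<in> D" "s \<noteq> 0" using insert by (auto simp: K_def)
    have "\<iota> (d * s) * c = \<iota> (d * r)" using rs by (simp add: \<iota>)
    moreover have "\<iota> (d * s) * c' \<in> \<iota> ` D" if "c' \<in> F" for c'
    proof -
      obtain e where e: "e \<in> D" "\<iota> d * c' = \<iota> e" using bspec [OF d(3) \<open>c' \<in> F\<close>] by (elim imageE)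
      have "\<iota> (d * s) * c' = \<iota> s * (\<iota> d * c')" by (simp add: \<iota>)
      also have "\<dots> = \<iota> (s * e)" by (simp add: e \<iota>)
      finally show ?thesis using D(3) [OF rs(3) e(1)] by (rule image_eqI)
    qed
    ultimately have "\<forall>c'\<in>insert c F. \<iota> (d * s) * c' \<in> \<iota> ` D"
      using D(3) [OF d(1) rs(2)] by (metis image_eqI insertE)
    then show ?case using d rs D(3) [OF d(1) rs(3)] by (intro bexI [of _ "d * s"]) simp_all
  qed
  have real3: "a = 0 \<and> b = 0 \<and> c = 0" if "a * a + b * b + c * c = 0" for a b c :: 'e
  proof -
    define f where "f i = (if i = 0 then a else if i = 1 then b else c)" for i :: nat
    have "{..<3} = {0, 1, 2 :: nat}" by auto
    then have "(\<Sum>i<3. f i * f i) = 0" using that by (simp add: f_def algebra_simps)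
    from formally_real [OF this, of 0] formally_real [OF this, of 1] formally_real [OF this, of 2]
    show ?thesis by (simp add: f_def)
  qed
  obtain j :: 'w where j: "j\<^sup>2 = -1"
    using nth_root_exists [of 2 "- 1 :: 'w"] by auto
  interpret real_closed_subfield K j
  proof
    show "j\<^sup>2 = -1" by (fact j)
  next
    fix n
    have "\<iota> (of_nat m) = of_nat m" for m by (induction m) (simp_all add: \<iota>)
    moreover have "of_nat (Suc n) \<noteq> (0 :: 'e)"
    proof
      assume "of_nat (Suc n) = (0 :: 'e)"
      then have "(\<Sum>i<Suc n. 1 * 1) = (0 :: 'e)" by simp
      then have "(1 :: 'e) = 0" by (rule formally_real [of "\<lambda>_. 1" _ 0]) simp
      then show False by simp
    qed
    ultimately show "of_nat (Suc n) \<noteq> (0 :: 'w)" by (metis \<iota>_0)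
  next
    fix a b c assume abc: "a \<in> K" "b \<in> K" "c \<in> K" "a\<^sup>2 + b\<^sup>2 + c\<^sup>2 = 0"
    then obtain d where d: "d \<in> D" "d \<noteq> 0" "\<forall>e\<in>{a, b, c}. \<iota> d * e \<in> \<iota> ` D"
      using denominator [of "{a, b, c}"] by auto
    then obtain a' b' c' where *: "\<iota> d * a = \<iota> a'" "\<iota> d * b = \<iota> b'" "\<iota> d * c = \<iota> c'" by auto
    have "\<iota> (a' * a' + b' * b' + c' * c') = (\<iota> d)\<^sup>2 * (a\<^sup>2 + b\<^sup>2 + c\<^sup>2)"
      unfolding \<iota> * [symmetric] by (simp add: power2_eq_square algebra_simps)
    then have "a' = 0 \<and> b' = 0 \<and> c' = 0" using abc by (intro real3) simp
    then show "a = 0 \<and> b = 0 \<and> c = 0" using * d by auto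
  next
    fix a assume "a \<in> K"
    then obtain r s where rs: "a = \<iota> r / \<iota> s" "r \<in> D" "s \<in> D" "s \<noteq> 0" by (auto simp: K_def)
    then obtain b where b: "b \<in> D" "r * s = b * b \<or> r * s = - (b * b)" using square [of "r * s"] D by auto
    have a: "a = \<iota> (r * s) / (\<iota> s)\<^sup>2" using rs by (simp add: \<iota> power2_eq_square)
    have "\<iota> (r * s) = \<iota> b * \<iota> b \<or> \<iota> (r * s) = - (\<iota> b * \<iota> b)"
      using b(2) by (metis \<iota>(2) \<iota>_minus)
    then have "a = (\<iota> b / \<iota> s)\<^sup>2 \<or> a = - ((\<iota> b / \<iota> s)\<^sup>2)"
      unfolding a by (auto simp: power_divide power2_eq_square)
    then show "\<exists>b\<in>K. a = b\<^sup>2 \<or> a = - (b\<^sup>2)" using KI b rs by blast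
  next
    fix p assume p: "p \<in> polys_over" "lead_coeff p = 1" "odd (Polynomial.degree p)"
    define n where "n = Polynomial.degree p"
    have "Polynomial.coeff p ` {..n} \<subseteq> K" using polys_overD [OF p(1)] by auto
    then obtain d where d: "d \<in> D" "d \<noteq> 0" "\<forall>c\<in>Polynomial.coeff p ` {..n}. \<iota> d * c \<in> \<iota> ` D"
      using denominator [of "Polynomial.coeff p ` {..n}"] by auto
    \<comment> \<open>The roots of \<open>q\<close> are those of \<open>p\<close>, multiplied by \<open>\<iota> d\<close>.\<close>
    define q where "q = smult (\<iota> d ^ n) (pcompose p [:0, 1 / \<iota> d:])"
    have coeff_q: "Polynomial.coeff q i = \<iota> d ^ n * Polynomial.coeff p i / \<iota> d ^ i" for i
      by (simp add: q_def coeff_pcompose_linear power_divide)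
    have deg_q: "Polynomial.degree q = n" using d by (simp add: q_def n_def degree_pcompose)
    have power_D: "\<iota> d ^ k \<in> \<iota> ` D" for k
    proof (induction k)
      case 0
      have "\<iota> 1 \<in> \<iota> ` D" using D by blast
      then show ?case by (simp add: \<iota>)
    next
      case (Suc k)
      then obtain e where "e \<in> D" "\<iota> d ^ k = \<iota> e" by blast
      then have "\<iota> d ^ Suc k = \<iota> (d * e)" "d * e \<in> D" using D d by (simp_all add: \<iota>)
      then show ?case by blast
    qed
    have q_D: "Polynomial.coeff q i \<in> \<iota> ` D" for i
    proof (cases i n rule: linorder_cases)
      case less
      have "\<iota> d * Polynomial.coeff p i \<in> \<iota> ` D" using d(3) less by simp
      then obtain e where e: "e \<in> D" "\<iota> d * Polynomial.coeff p i = \<iota> e" by (elim imageE)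
      obtain e' where e': "e' \<in> D" "\<iota> d ^ (n - i - 1) = \<iota> e'" using power_D by blast
      have "n = (n - i - 1) + Suc i" using less by simp
      then have "\<iota> d ^ n = \<iota> d ^ (n - i - 1) * \<iota> d * \<iota> d ^ i"
        by (metis power_add power_Suc mult.assoc)
      then have "Polynomial.coeff q i = \<iota> (e' * e)"
        using d by (simp add: coeff_q \<iota> e(2) [symmetric] e'(2) [symmetric])
      then show ?thesis using D(3) [OF e'(1) e(1)] by (rule image_eqI)
    next
      case equal
      then have "Polynomial.coeff q i = \<iota> 1" using p d by (simp add: coeff_q n_def \<iota>)
      then show ?thesis using D by blast
    next
      case greater
      then have "Polynomial.coeff q i = \<iota> 0" by (simp add: coeff_eq_0 deg_q)
      then show ?thesis using D0 by blast
    qed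
    define q' where "q' = map_poly (inv_into D \<iota>) q"
    have inj: "inj_on \<iota> D" using \<iota>(4) by (rule inj_on_subset) simp
    have inv0: "inv_into D \<iota> 0 = 0"
      using inv_into_f_f [OF inj D0] by simp
    have coeff_q': "Polynomial.coeff q' i \<in> D" "\<iota> (Polynomial.coeff q' i) = Polynomial.coeff q i" for i
      using q_D [of i] by (simp_all add: q'_def coeff_map_poly inv0 inv_into_into f_inv_into_f)
    have q: "q = map_poly \<iota> q'" by (rule poly_eqI) (simp add: coeff_map_poly coeff_q')
    have deg_q': "Polynomial.degree q' = n"
      using deg_q unfolding q by (subst (asm) degree_map_poly) auto
    have "Polynomial.coeff q n = 1" using p d by (simp add: coeff_q n_def)
    then have "lead_coeff q' = 1"
      using coeff_q'(2) [of n] \<iota>_eq [of "lead_coeff q'" 1] unfolding deg_q' by (simp add: \<iota>)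
    then obtain y where y: "y \<in> D" "poly q' y = 0"
      using odd_root [of q'] coeff_q' deg_q' p n_def by auto
    then have "poly q (\<iota> y) = 0" by (simp add: q \<iota>_poly)
    then have "poly p (\<iota> y / \<iota> d) = 0" using d by (simp add: q_def poly_pcompose)
    then show "\<exists>x\<in>K. poly p x = 0" using KI y d by blast
  qed
  have "map_poly \<iota> p \<in> polys_over"
    using p \<iota>_K by (auto simp: polys_over_def coeff_map_poly)
  moreover have "lead_coeff (map_poly \<iota> p) = 1"
    using p by (simp add: lead_coeff_map_poly_nz \<iota> coeff_map_poly degree_map_poly)
  moreover have "poly (map_poly \<iota> p) (\<iota> x) = 0" using p by (simp add: \<iota>_poly)
  ultimately have "\<iota> x \<in> C" by (rule algebraic_in_C)
  then obtain a b where ab: "\<iota> x = a + b * j" "a \<in> K" "b \<in> K" by (auto simp: C_def)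
  obtain r s where rs: "a = \<iota> r / \<iota> s" "r \<in> D" "s \<in> D" "s \<noteq> 0" using ab by (auto simp: K_def)
  obtain r' s' where rs': "b = \<iota> r' / \<iota> s'" "r' \<in> D" "s' \<in> D" "s' \<noteq> 0" using ab by (auto simp: K_def)
  \<comment> \<open>Clearing denominators in \<open>\<iota> x = a + b j\<close> gives two elements of the domain whose squares add up to zero.\<close>
  have r'j: "\<iota> (s * r') * j = \<iota> ((x * s - r) * s')"
    using ab rs rs' by (simp add: \<iota> \<iota>_diff field_simps)
  define A B where "A = (x * s - r) * s'" and "B = s * r'"
  have "\<iota> (A * A + B * B + 0 * 0) = (\<iota> B)\<^sup>2 * (1 + j\<^sup>2)"
    unfolding \<iota> using r'j [folded A_def B_def, symmetric] by (simp add: algebra_simps power2_eq_square)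
  then have "A * A + B * B + 0 * 0 = 0" unfolding j \<iota>_0 [symmetric] by simp
  then have "s * r' = 0" using real3 B_def by metis
  then have "b = 0" using rs rs' by simp
  then have "\<iota> (s * x) = \<iota> r" using ab rs by (simp add: \<iota>)
  then show ?thesis using rs by auto
qed

text \<open>
  The algebraic closure of the field of fractions of the domain provides the embedding.
\<close>

theorem integral_imp_fraction:
  fixes D :: "'e :: idom set"
  assumes D: "1 \<in> D" "\<And>x y. x \<in> D \<Longrightarrow> y \<in> D \<Longrightarrow> x - y \<in> D" "\<And>x y. x \<in> D \<Longrightarrow> y \<in> D \<Longrightarrow> x * y \<in> D"
    and formally_real: "\<And>(n :: nat) (f :: nat \<Rightarrow> 'e) i. (\<Sum>i<n. f i * f i) = 0 \<Longrightarrow> i < n \<Longrightarrow> f i = 0"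
    and square: "\<And>a. a \<in> D \<Longrightarrow> \<exists>b\<in>D. a = b * b \<or> a = - (b * b)"
    and odd_root: "\<And>p. \<lbrakk>\<forall>i. Polynomial.coeff p i \<in> D; lead_coeff p = 1; odd (Polynomial.degree p)\<rbrakk>
      \<Longrightarrow> \<exists>x\<in>D. poly p x = 0"
    and p: "\<forall>i. Polynomial.coeff p i \<in> D" "lead_coeff p = 1" "poly p x = 0"
  shows "\<exists>r\<in>D. \<exists>s\<in>D. s \<noteq> 0 \<and> s * x = r"
proof -
  define \<iota> :: "'e \<Rightarrow> 'e fract alg_closure" where "\<iota> x = to_ac (to_fract x)" for x
  have \<iota>: "\<And>x y. \<iota> (x + y) = \<iota> x + \<iota> y" "\<And>x y. \<iota> (x * y) = \<iota> x * \<iota> y" "\<iota> 1 = 1" "inj \<iota>"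
    by (auto simp: \<iota>_def intro!: injI)
  show ?thesis
    by (rule algebraic_over_fractions [OF \<iota> D(1)]; (fact assms)?)
qed

section \<open>From types to carrier sets\<close>

text \<open>
  A domain that lives in every type of sets. It only serves as the carrier of the type constructed
  below when there is no counterexample.
\<close>

definition two_element_field :: "'c set ring" where
  "two_element_field = \<lparr>carrier = {{}, UNIV}, monoid.mult = (\<inter>), monoid.one = UNIV, ring.zero = {},
     ring.add = (\<lambda>U V. (U - V) \<union> (V - U))\<rparr>"

lemma domain_two_element_field: "domain two_element_field"
proof (rule domain.intro)
  show "cring two_element_field"
  proof (rule cringI)
    show "abelian_group two_element_field"
    proof (rule abelian_groupI)
      fix U assume "U \<in> carrier two_element_field"
      then show "\<exists>V\<in>carrier two_element_field. V \<oplus>\<^bsub>two_element_field\<^esub> U = \<zero>\<^bsub>two_element_field\<^esub>"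
        by (auto simp: two_element_field_def)
    qed (auto simp: two_element_field_def)
    show "comm_monoid two_element_field"
      by unfold_locales (auto simp: two_element_field_def)
  qed (auto simp: two_element_field_def)
  show "domain_axioms two_element_field"
    by unfold_locales (auto simp: two_element_field_def)
qed

text \<open>
  A subring \<open>D\<close> of \<open>E\<close> with the two root properties of a real closed field, stated without
  fractions: they hold in a real closed integral domain because it is integrally closed. Coefficient
  lists begin with the leading coefficient.
\<close>

definition real_closed_in :: "('c, 'm) ring_scheme \<Rightarrow> 'c set \<Rightarrow> bool" where
  "real_closed_in E D \<longleftrightarrow> D \<subseteq> carrier E \<and> \<one>\<^bsub>E\<^esub> \<in> D
     \<and> (\<forall>a\<in>D. \<forall>b\<in>D. a \<ominus>\<^bsub>E\<^esub> b \<in> D \<and> a \<otimes>\<^bsub>E\<^esub> b \<in> D)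
     \<and> (\<forall>a\<in>D. \<exists>b\<in>D. a = b \<otimes>\<^bsub>E\<^esub> b \<or> a = \<ominus>\<^bsub>E\<^esub> (b \<otimes>\<^bsub>E\<^esub> b))
     \<and> (\<forall>p. set p \<subseteq> D \<and> odd (length p) \<longrightarrow> (\<exists>x\<in>D. ring.eval E (\<one>\<^bsub>E\<^esub> # p) x = \<zero>\<^bsub>E\<^esub>))"

text \<open>
  A domain \<open>E\<close> with a fraction defect is a counterexample to \<open>integral_imp_fraction\<close> for rings
  with a carrier set.
\<close>

definition fraction_defect :: "'c set ring \<Rightarrow> bool" where
  "fraction_defect E \<longleftrightarrow> domain E \<and> formally_real E
     \<and> (\<exists>D. real_closed_in E D \<and> (\<exists>x\<in>carrier E. integral_over E D x
          \<and> \<not> (\<exists>r\<in>D. \<exists>s\<in>D. s \<noteq> \<zero>\<^bsub>E\<^esub> \<and> s \<otimes>\<^bsub>E\<^esub> x = r)))"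

text \<open>
  If any counterexample exists on the type \<open>'c set\<close>, this domain is one. Being a constant, it can
  be the carrier of a type.
\<close>

definition chosen_domain :: "'c set ring" where
  "chosen_domain = (SOME E. domain E \<and> ((\<exists>E' :: 'c set ring. fraction_defect E') \<longrightarrow> fraction_defect E))"

lemma chosen_domain:
  "domain (chosen_domain :: 'c set ring)
     \<and> ((\<exists>E' :: 'c set ring. fraction_defect E') \<longrightarrow> fraction_defect (chosen_domain :: 'c set ring))"
  unfolding chosen_domain_def
  by (rule someI_ex) (use domain_two_element_field fraction_defect_def in blast)

interpretation CD: domain chosen_domain
  using chosen_domain by blast

typedef 'c chosen = "carrier (chosen_domain :: 'c set ring)"
  using CD.zero_closed by blast

instantiation chosen :: (type) idom
begin

definition zero_chosen_def: "0 = Abs_chosen \<zero>\<^bsub>chosen_domain\<^esub>"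
definition one_chosen_def: "1 = Abs_chosen \<one>\<^bsub>chosen_domain\<^esub>"
definition plus_chosen_def: "x + y = Abs_chosen (Rep_chosen x \<oplus>\<^bsub>chosen_domain\<^esub> Rep_chosen y)"
definition times_chosen_def: "x * y = Abs_chosen (Rep_chosen x \<otimes>\<^bsub>chosen_domain\<^esub> Rep_chosen y)"
definition uminus_chosen_def: "- x = Abs_chosen (\<ominus>\<^bsub>chosen_domain\<^esub> Rep_chosen x)"
definition minus_chosen_def: "x - y = Abs_chosen (Rep_chosen x \<ominus>\<^bsub>chosen_domain\<^esub> Rep_chosen y)"

lemma Rep_chosen_hom:
  "Rep_chosen 0 = \<zero>\<^bsub>chosen_domain\<^esub>" "Rep_chosen 1 = \<one>\<^bsub>chosen_domain\<^esub>"
  "Rep_chosen (x + y) = Rep_chosen x \<oplus>\<^bsub>chosen_domain\<^esub> Rep_chosen y"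
  "Rep_chosen (x * y) = Rep_chosen x \<otimes>\<^bsub>chosen_domain\<^esub> Rep_chosen y"
  "Rep_chosen (- x) = \<ominus>\<^bsub>chosen_domain\<^esub> Rep_chosen x"
  "Rep_chosen (x - y) = Rep_chosen x \<ominus>\<^bsub>chosen_domain\<^esub> Rep_chosen y"
  by (simp_all add: zero_chosen_def one_chosen_def plus_chosen_def times_chosen_def
      uminus_chosen_def minus_chosen_def Abs_chosen_inverse Rep_chosen)

instance
proof
  fix x y z :: "'a chosen"
  note hom = Rep_chosen_inject [symmetric] Rep_chosen_hom Rep_chosen
  show "x * y * z = x * (y * z)" "x * y = y * x" "1 * x = x" "x + y + z = x + (y + z)"
      "x + y = y + x" "0 + x = x"
    by (simp_all add: hom CD.m_ac CD.a_ac)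
  show "- x + x = 0" "x - y = x + - y" "(x + y) * z = x * z + y * z"
    by (simp_all add: hom CD.l_neg CD.minus_eq CD.l_distr)
  show "0 * x = 0" "x * 0 = 0" "x * (y + z) = x * y + x * z"
    by (simp_all add: hom CD.r_distr)
  show "(0 :: 'a chosen) \<noteq> 1"
    by (simp add: hom)
  show "x \<noteq> 0 \<Longrightarrow> y \<noteq> 0 \<Longrightarrow> x * y \<noteq> 0"
    by (simp add: hom CD.integral_iff)
qed

end

lemma Rep_chosen_sum:
  "Rep_chosen (\<Sum>i<n. f i) = (\<Oplus>\<^bsub>chosen_domain\<^esub>i\<in>{..<n}. Rep_chosen (f i))" for n :: nat
  by (induction n) (simp_all add: Rep_chosen_hom Rep_chosen lessThan_Suc CD.add.m_comm)

lemma Rep_chosen_power: "Rep_chosen (x ^ n) = Rep_chosen x [^]\<^bsub>chosen_domain\<^esub> n"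
  by (induction n) (simp_all add: Rep_chosen_hom Rep_chosen CD.m_comm)

text \<open>
  \<open>Poly\<close> takes the constant coefficient first, \<open>eval\<close> the leading one.
\<close>

lemma Rep_chosen_poly:
  "Rep_chosen (poly (Poly (rev p)) x) = CD.eval (map Rep_chosen p) (Rep_chosen x)"
  by (induction p) (simp_all add: Rep_chosen_hom Rep_chosen_power Poly_append Poly_snoc poly_monom CD.a_comm Rep_chosen CD.eval_in_carrier image_subset_iff)

text \<open>
  A counterexample would make the chosen domain one, and the type \<open>'c chosen\<close> would then contradict
  \<open>integral_imp_fraction\<close>.
\<close>

theorem no_fraction_defect: "\<not> fraction_defect (E :: 'c set ring)"
proof
  assume "fraction_defect E"
  then have "fraction_defect (chosen_domain :: 'c set ring)"
    using chosen_domain by blast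
  then obtain D x where fr: "formally_real (chosen_domain :: 'c set ring)"
    and D: "real_closed_in (chosen_domain :: 'c set ring) D"
    and x: "x \<in> carrier chosen_domain" "integral_over chosen_domain D x"
    and no: "\<not> (\<exists>r\<in>D. \<exists>s\<in>D. s \<noteq> \<zero>\<^bsub>chosen_domain\<^esub> \<and> s \<otimes>\<^bsub>chosen_domain\<^esub> x = r)"
    unfolding fraction_defect_def by (elim conjE exE bexE) (rule that)
  define D' where "D' = {z. Rep_chosen z \<in> D}"
  have D_sub: "D \<subseteq> carrier chosen_domain" using D by (simp add: real_closed_in_def)
  obtain p where p: "set p \<subseteq> D" "CD.eval (\<one>\<^bsub>chosen_domain\<^esub> # p) x = \<zero>\<^bsub>chosen_domain\<^esub>"
    using x by (auto simp: integral_over_def)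
  define P where "P = Poly (rev (1 # map Abs_chosen p))"
  have Rep_p: "map Rep_chosen (1 # map Abs_chosen p) = \<one>\<^bsub>chosen_domain\<^esub> # p"
    using p(1) D_sub by (simp add: Rep_chosen_hom map_idI Abs_chosen_inverse subset_iff)
  have coeffs_P: "coeffs P = rev (1 # map Abs_chosen p)"
    by (simp add: P_def coeffs_Poly strip_while_append)
  have zero_D: "\<zero>\<^bsub>chosen_domain\<^esub> \<in> D"
  proof -
    have "\<one>\<^bsub>chosen_domain\<^esub> \<ominus>\<^bsub>chosen_domain\<^esub> \<one>\<^bsub>chosen_domain\<^esub> \<in> D"
      using D unfolding real_closed_in_def by blast
    then show ?thesis by (simp add: CD.minus_eq CD.r_neg)
  qed
  have "\<exists>r\<in>D'. \<exists>s\<in>D'. s \<noteq> 0 \<and> s * Abs_chosen x = r"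
  proof (rule integral_imp_fraction)
    show "1 \<in> D'" "\<And>x y. x \<in> D' \<Longrightarrow> y \<in> D' \<Longrightarrow> x - y \<in> D'" "\<And>x y. x \<in> D' \<Longrightarrow> y \<in> D' \<Longrightarrow> x * y \<in> D'"
      using D by (auto simp: D'_def Rep_chosen_hom real_closed_in_def)
  next
    fix n :: nat and f :: "nat \<Rightarrow> 'c chosen" and i
    assume "(\<Sum>i<n. f i * f i) = 0" "i < n"
    then have "(\<Oplus>\<^bsub>chosen_domain\<^esub>i\<in>{..<n}. Rep_chosen (f i) \<otimes>\<^bsub>chosen_domain\<^esub> Rep_chosen (f i)) = \<zero>\<^bsub>chosen_domain\<^esub>"
      using Rep_chosen_sum [of "\<lambda>i. f i * f i" n] by (simp add: Rep_chosen_hom)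
    moreover have "(\<lambda>i. Rep_chosen (f i)) \<in> {..<n} \<rightarrow> carrier chosen_domain" by (simp add: Rep_chosen)
    ultimately have "Rep_chosen (f i) = \<zero>\<^bsub>chosen_domain\<^esub>"
      using fr \<open>i < n\<close> unfolding formally_real_def by blast
    then show "f i = 0" by (metis Rep_chosen_hom(1) Rep_chosen_inject)
  next
    fix a assume "a \<in> D'"
    then obtain b where b: "b \<in> D" "Rep_chosen a = b \<otimes>\<^bsub>chosen_domain\<^esub> b \<or> Rep_chosen a = \<ominus>\<^bsub>chosen_domain\<^esub> (b \<otimes>\<^bsub>chosen_domain\<^esub> b)"
      using D by (auto simp: D'_def real_closed_in_def)
    then have "Rep_chosen (Abs_chosen b) = b" using D_sub by (auto simp: Abs_chosen_inverse)
    then show "\<exists>b\<in>D'. a = b * b \<or> a = - (b * b)"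
      using b by (intro bexI [of _ "Abs_chosen b"]) (simp_all add: D'_def Rep_chosen_inject [symmetric] Rep_chosen_hom)
  next
    fix q :: "'c chosen poly"
    assume q: "\<forall>i. Polynomial.coeff q i \<in> D'" "lead_coeff q = 1" "odd (Polynomial.degree q)"
    have "q \<noteq> 0" using q by auto
    then have "rev (coeffs q) \<noteq> []" "hd (rev (coeffs q)) = 1"
      using q by (simp_all add: hd_rev last_coeffs_eq_coeff_degree)
    then obtain l where l: "rev (coeffs q) = 1 # l" by (metis list.collapse)
    have "length (rev (coeffs q)) = Suc (Polynomial.degree q)"
      using \<open>q \<noteq> 0\<close> by (simp add: length_coeffs_degree)
    then have "odd (length l)" using q l by simp
    moreover have "set l \<subseteq> set (coeffs q)" using l by (metis set_rev set_subset_Cons)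
    moreover have "set (coeffs q) \<subseteq> D'"
      unfolding coeffs_def using q(1) by (simp add: image_subset_iff)
    ultimately have "odd (length l)" "set (map Rep_chosen l) \<subseteq> D" by (auto simp: D'_def)
    then obtain y where y: "y \<in> D" "CD.eval (\<one>\<^bsub>chosen_domain\<^esub> # map Rep_chosen l) y = \<zero>\<^bsub>chosen_domain\<^esub>"
      using D unfolding real_closed_in_def by (metis length_map)
    have Rep_y: "Rep_chosen (Abs_chosen y) = y" using y D_sub by (auto simp: Abs_chosen_inverse)
    have "Rep_chosen (poly q (Abs_chosen y)) = CD.eval (map Rep_chosen (rev (coeffs q))) y"
      using Rep_chosen_poly [of "rev (coeffs q)" "Abs_chosen y"] Rep_y by simp
    also have "\<dots> = Rep_chosen 0" using y by (simp add: l Rep_chosen_hom)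
    finally have "poly q (Abs_chosen y) = 0" by (simp add: Rep_chosen_inject)
    then show "\<exists>x\<in>D'. poly q x = 0" using y Rep_y
      by (intro bexI [of _ "Abs_chosen y"]) (simp_all add: D'_def)
  next
    have "set (coeffs P) \<subseteq> D'"
      using p D D_sub by (auto simp: coeffs_P D'_def Rep_chosen_hom Abs_chosen_inverse subset_iff real_closed_in_def)
    moreover have "Polynomial.coeff P i \<in> insert 0 (set (coeffs P))" for i
      by (metis coeff_in_coeffs coeff_eq_0 insertCI insertI1 le_degree poly_0_coeff_0 coeff_0)
    moreover have "0 \<in> D'" using zero_D by (simp add: D'_def Rep_chosen_hom)
    ultimately show "\<forall>i. Polynomial.coeff P i \<in> D'" by (metis insertE subsetD)
    have "P \<noteq> 0" using coeffs_P by auto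
    then show "lead_coeff P = 1"
      using last_coeffs_eq_coeff_degree [of P] coeffs_P by simp
    show "poly P (Abs_chosen x) = 0"
      using Rep_chosen_poly [of "1 # map Abs_chosen p" "Abs_chosen x"] p x
      unfolding Rep_p P_def by (simp only: Abs_chosen_inverse) (simp flip: Rep_chosen_hom(1) add: Rep_chosen_inject)
  qed
  then obtain r s where rs: "r \<in> D'" "s \<in> D'" "s \<noteq> 0" "s * Abs_chosen x = r" by blast
  have "Rep_chosen (s * Abs_chosen x) = Rep_chosen r" using rs(4) by simp
  then have "Rep_chosen s \<otimes>\<^bsub>chosen_domain\<^esub> x = Rep_chosen r"
    using x(1) by (simp add: Rep_chosen_hom Abs_chosen_inverse)
  moreover have "Rep_chosen s \<noteq> \<zero>\<^bsub>chosen_domain\<^esub>"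
    using rs by (metis Rep_chosen_hom(1) Rep_chosen_inject)
  ultimately show False using no rs(1,2) unfolding D'_def by blast
qed

section \<open>Homogenized polynomials\<close>

lemma (in cring) ring_hom_eval:
  assumes "cring S" "h \<in> ring_hom R S" "set p \<subseteq> carrier R" "x \<in> carrier R"
  shows "h (eval p x) = ring.eval S (map h p) (h x)"
proof -
  interpret S: cring S by fact
  interpret h: ring_hom_cring R S h
    by (rule ring_hom_cring.intro, fact is_cring, fact, rule ring_hom_cring_axioms.intro, fact)
  show ?thesis
    using assms(3,4) by (induction p) (auto simp: eval_in_carrier)
qed

text \<open>
  For a list \<open>p\<close> with \<open>n + 1\<close> entries this is \<open>s ^ n\<close> times the value of \<open>p\<close> at \<open>r / s\<close>, computed
  without division. In contrast to the value at \<open>r / s\<close>, it is preserved by every homomorphism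
  defined on a ring that contains \<open>r\<close> and \<open>s\<close>.
\<close>

fun homogenized_eval :: "('a, 'm) ring_scheme \<Rightarrow> 'a list \<Rightarrow> 'a \<Rightarrow> 'a \<Rightarrow> 'a" where
  "homogenized_eval R [] r s = \<zero>\<^bsub>R\<^esub>"
| "homogenized_eval R (a # p) r s =
     a \<otimes>\<^bsub>R\<^esub> (r [^]\<^bsub>R\<^esub> length p) \<oplus>\<^bsub>R\<^esub> s \<otimes>\<^bsub>R\<^esub> homogenized_eval R p r s"

lemma (in cring) homogenized_eval_closed [simp]:
  "\<lbrakk>set p \<subseteq> carrier R; r \<in> carrier R; s \<in> carrier R\<rbrakk> \<Longrightarrow> homogenized_eval R p r s \<in> carrier R"
  by (induction p) auto

lemma (in cring) ring_hom_homogenized_eval: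
  assumes "cring S" "h \<in> ring_hom R S" "set p \<subseteq> carrier R" "r \<in> carrier R" "s \<in> carrier R"
  shows "h (homogenized_eval R p r s) = homogenized_eval S (map h p) (h r) (h s)"
proof -
  interpret S: cring S by fact
  interpret h: ring_hom_cring R S h
    by (rule ring_hom_cring.intro, fact is_cring, fact, rule ring_hom_cring_axioms.intro, fact)
  show ?thesis
    using assms(3-5) by (induction p) auto
qed

lemma (in cring) homogenized_eval:
  assumes "x \<in> carrier R" "s \<in> carrier R" "set p \<subseteq> carrier R"
  shows "s [^] length p \<otimes> eval p x = s \<otimes> homogenized_eval R p (s \<otimes> x) s"
  using assms(3)
proof (induction p)
  case (Cons a p)
  let ?n = "length p"
  have in_R: "a \<in> carrier R" "eval p x \<in> carrier R" "homogenized_eval R p (s \<otimes> x) s \<in> carrier R"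
    using assms Cons by (auto intro: eval_in_carrier)
  have "s [^] Suc ?n \<otimes> eval (a # p) x
      = s \<otimes> (a \<otimes> (s [^] ?n \<otimes> x [^] ?n)) \<oplus> s \<otimes> (s [^] ?n \<otimes> eval p x)"
    using in_R assms by (simp add: r_distr m_ac)
  also have "s [^] ?n \<otimes> eval p x = s \<otimes> homogenized_eval R p (s \<otimes> x) s"
    using Cons by simp
  also have "s [^] ?n \<otimes> x [^] ?n = (s \<otimes> x) [^] ?n"
    using assms by (simp add: nat_pow_distrib)
  finally show ?case using in_R assms by (simp add: r_distr)
qed (use assms in simp)

section \<open>Real closed integral domains\<close>

lemma UN_pairs_const:
  assumes "\<And>r s r' s'. \<lbrakk>(r, s) \<in> M; (r', s') \<in> N\<rbrakk> \<Longrightarrow> f r s r' s' = c" "M \<noteq> {}" "N \<noteq> {}"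
  shows "(\<Union>(r, s)\<in>M. \<Union>(r', s')\<in>N. f r s r' s') = c"
proof -
  have "(\<Union>(r, s)\<in>M. \<Union>(r', s')\<in>N. f r s r' s') = (\<Union>_\<in>M. \<Union>_\<in>N. c)"
    using assms(1) by (intro SUP_cong refl) (auto simp: case_prod_unfold intro!: SUP_cong)
  then show ?thesis using assms(2,3) by simp
qed

context "domain"
begin

lemma loc_frac_nonzeros:
  "\<lbrakk>r \<in> carrier R; s \<in> nonzeros R\<rbrakk> \<Longrightarrow>
     loc_frac R (nonzeros R) r s = {(x, y). x \<in> carrier R \<and> y \<in> nonzeros R \<and> r \<otimes> y = x \<otimes> s}"
  unfolding loc_frac_def using one_closed one_not_zero
  by (auto simp: m_lcancel intro!: bexI [of _ \<one>])

lemma loc_frac_eqI: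
  assumes "r \<in> carrier R" "s \<in> nonzeros R" "(x, y) \<in> loc_frac R (nonzeros R) r s"
  shows "loc_frac R (nonzeros R) x y = loc_frac R (nonzeros R) r s"
proof -
  have *: "x \<in> carrier R" "y \<in> nonzeros R" "r \<otimes> y = x \<otimes> s"
    using assms by (simp_all add: loc_frac_nonzeros)
  have "x \<otimes> v = u \<otimes> y \<longleftrightarrow> r \<otimes> v = u \<otimes> s" if "u \<in> carrier R" "v \<in> nonzeros R" for u v
  proof -
    have "x \<otimes> v = u \<otimes> y \<longleftrightarrow> s \<otimes> (x \<otimes> v) = s \<otimes> (u \<otimes> y)"
      using that * assms by (auto simp: m_lcancel)
    also have "s \<otimes> (x \<otimes> v) = y \<otimes> (r \<otimes> v)"
      using that * assms by (metis DiffD1 m_assoc m_comm)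
    also have "s \<otimes> (u \<otimes> y) = y \<otimes> (u \<otimes> s)"
      using that * assms by (simp add: m_ac)
    finally show ?thesis using that * assms by (auto simp: m_lcancel)
  qed
  then show ?thesis using * assms by (auto simp: loc_frac_nonzeros)
qed

lemma loc_frac_self: "\<lbrakk>r \<in> carrier R; s \<in> nonzeros R\<rbrakk> \<Longrightarrow> (r, s) \<in> loc_frac R (nonzeros R) r s"
  by (simp add: loc_frac_nonzeros)

text \<open>
  The sum and the product in a localization are unions over all representatives. They are well
  defined because equivalent representatives give the same fraction.
\<close>

lemma loc_frac_combine:
  fixes F :: "'a \<Rightarrow> 'a \<Rightarrow> 'a \<Rightarrow> 'a \<Rightarrow> 'a" and G :: "'a \<Rightarrow> 'a \<Rightarrow> 'a"
  defines "S \<equiv> nonzeros R"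
  assumes ab: "a \<in> carrier R" "b \<in> S" "c \<in> carrier R" "d \<in> S"
    and FG: "\<And>r s r' s'. \<lbrakk>r \<in> carrier R; s \<in> S; r' \<in> carrier R; s' \<in> S\<rbrakk>
      \<Longrightarrow> F r s r' s' \<in> carrier R \<and> G s s' \<in> S"
    and eq: "\<And>r s r' s'. \<lbrakk>r \<in> carrier R; s \<in> S; r' \<in> carrier R; s' \<in> S; a \<otimes> s = r \<otimes> b; c \<otimes> s' = r' \<otimes> d\<rbrakk>
      \<Longrightarrow> F a b c d \<otimes> G s s' = F r s r' s' \<otimes> G b d"
  shows "(\<Union>(r, s)\<in>loc_frac R S a b. \<Union>(r', s')\<in>loc_frac R S c d. loc_frac R S (F r s r' s') (G s s'))
    = loc_frac R S (F a b c d) (G b d)"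
proof (rule UN_pairs_const)
  show "loc_frac R S a b \<noteq> {}" "loc_frac R S c d \<noteq> {}"
    using loc_frac_self ab unfolding S_def by fast+
next
  fix r s r' s'
  assume "(r, s) \<in> loc_frac R S a b" "(r', s') \<in> loc_frac R S c d"
  then have *: "r \<in> carrier R" "s \<in> S" "r' \<in> carrier R" "s' \<in> S" "a \<otimes> s = r \<otimes> b" "c \<otimes> s' = r' \<otimes> d"
    using ab unfolding S_def by (simp_all add: loc_frac_nonzeros)
  show "loc_frac R S (F r s r' s') (G s s') = loc_frac R S (F a b c d) (G b d)"
    using FG [OF ab] FG [OF *(1-4)] eq [OF *] unfolding S_def
    by (intro loc_frac_eqI) (simp_all add: loc_frac_nonzeros)
qed

lemma loc_map_ring_hom: "loc_map R (nonzeros R) \<in> ring_hom R (localization R (nonzeros R))"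
proof -
  let ?S = "nonzeros R"
  have one: "\<one> \<in> ?S" by simp
  show ?thesis
  proof (rule ring_hom_memI)
    fix x y assume xy: "x \<in> carrier R" "y \<in> carrier R"
    show "loc_map R ?S (x \<otimes> y) = loc_map R ?S x \<otimes>\<^bsub>localization R ?S\<^esub> loc_map R ?S y"
    proof -
      have "loc_map R ?S x \<otimes>\<^bsub>localization R ?S\<^esub> loc_map R ?S y = loc_frac R ?S (x \<otimes> y) (\<one> \<otimes> \<one>)"
        unfolding localization_def loc_map_def monoid.simps
      proof (rule loc_frac_combine [where F = "\<lambda>r s r' s'. r \<otimes> r'" and G = "\<lambda>s s'. s \<otimes> s'"])
        fix r s r' s' assume *: "r \<in> carrier R" "s \<in> ?S" "r' \<in> carrier R" "s' \<in> ?S" "x \<otimes> s = r \<otimes> \<one>" "y \<otimes> s' = r' \<otimes> \<one>"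
        have "(x \<otimes> y) \<otimes> (s \<otimes> s') = (x \<otimes> s) \<otimes> (y \<otimes> s')" using xy *(1-4) by (simp add: m_ac)
        then show "(x \<otimes> y) \<otimes> (s \<otimes> s') = (r \<otimes> r') \<otimes> (\<one> \<otimes> \<one>)" using * by simp
      qed (use xy one integral in auto)
      then show ?thesis by (simp add: loc_map_def)
    qed
    show "loc_map R ?S (x \<oplus> y) = loc_map R ?S x \<oplus>\<^bsub>localization R ?S\<^esub> loc_map R ?S y"
    proof -
      have "loc_map R ?S x \<oplus>\<^bsub>localization R ?S\<^esub> loc_map R ?S y = loc_frac R ?S (x \<otimes> \<one> \<oplus> y \<otimes> \<one>) (\<one> \<otimes> \<one>)"
        unfolding localization_def loc_map_def ring_record_simps
      proof (rule loc_frac_combine [where F = "\<lambda>r s r' s'. r \<otimes> s' \<oplus> r' \<otimes> s" and G = "\<lambda>s s'. s \<otimes> s'"])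
        fix r s r' s' assume *: "r \<in> carrier R" "s \<in> ?S" "r' \<in> carrier R" "s' \<in> ?S" "x \<otimes> s = r \<otimes> \<one>" "y \<otimes> s' = r' \<otimes> \<one>"
        have "(x \<oplus> y) \<otimes> (s \<otimes> s') = (x \<otimes> s) \<otimes> s' \<oplus> (y \<otimes> s') \<otimes> s"
          using xy *(1-4) by (simp add: m_ac l_distr r_distr)
        then show "(x \<otimes> \<one> \<oplus> y \<otimes> \<one>) \<otimes> (s \<otimes> s') = (r \<otimes> s' \<oplus> r' \<otimes> s) \<otimes> (\<one> \<otimes> \<one>)" using xy * by simp
      qed (use xy one integral in auto)
      then show ?thesis using xy by (simp add: loc_map_def)
    qed
  next
    fix x assume "x \<in> carrier R"
    then show "loc_map R ?S x \<in> carrier (localization R ?S)"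
      unfolding loc_map_def localization_def partial_object.simps using one by blast
  qed (simp add: loc_map_def localization_def)
qed

lemma inj_on_loc_map: "inj_on (loc_map R (nonzeros R)) (carrier R)"
proof (rule inj_onI)
  fix x y assume *: "x \<in> carrier R" "y \<in> carrier R" "loc_map R (nonzeros R) x = loc_map R (nonzeros R) y"
  then have "(x, \<one>) \<in> loc_frac R (nonzeros R) y \<one>"
    using loc_frac_self [of x \<one>] by (simp add: loc_map_def)
  then show "x = y" using * by (simp add: loc_frac_nonzeros)
qed

end


text \<open>
  Square roots in the field of fractions \<open>K\<close> of \<open>D\<close>, and roots of monic polynomials over \<open>D\<close>, are
  integral over \<open>D\<close>, and \<open>D\<close> is integrally closed in \<open>K\<close>; so the axioms of a real closed field
  produce elements of \<open>D\<close> itself. In the second part, an element \<open>x\<close> of \<open>E\<close> that is a fraction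
  \<open>r / s\<close> of elements of \<open>D\<close> satisfies the same monic equation as the fraction \<open>r / s\<close> in \<open>K\<close>: the
  homogenized equation holds in \<open>D\<close>, and \<open>D\<close> is contained in both \<open>E\<close> and \<open>K\<close>.
\<close>

lemma real_closed_domain_inside:
  fixes D :: "('a, 'm) ring_scheme" and E :: "('c, 'n) ring_scheme"
  assumes rcd: "real_closed_domain D P" and E: "domain E"
    and \<psi>: "\<psi> \<in> ring_hom D E" "inj_on \<psi> (carrier D)"
  shows "real_closed_in E (\<psi> ` carrier D)"
    and "\<lbrakk>x \<in> carrier E; integral_over E (\<psi> ` carrier D) x; r \<in> \<psi> ` carrier D; s \<in> \<psi> ` carrier D;
           s \<noteq> \<zero>\<^bsub>E\<^esub>; s \<otimes>\<^bsub>E\<^esub> x = r\<rbrakk> \<Longrightarrow> x \<in> \<psi> ` carrier D"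
proof -
  interpret D: domain D using rcd by (simp add: real_closed_domain_def)
  interpret E: domain E by fact
  define K where "K = localization D (nonzeros D)"
  define \<iota> where "\<iota> = loc_map D (nonzeros D)"
  have rcf: "real_closed_field K"
    and closed: "\<And>x. \<lbrakk>x \<in> carrier K; integral_over K (\<iota> ` carrier D) x\<rbrakk> \<Longrightarrow> x \<in> \<iota> ` carrier D"
    using rcd unfolding real_closed_domain_def K_def \<iota>_def by blast+
  interpret K: field K using rcf by (simp add: real_closed_field_def)
  have \<iota>: "\<iota> \<in> ring_hom D K" "inj_on \<iota> (carrier D)"
    unfolding \<iota>_def K_def by (fact D.loc_map_ring_hom D.inj_on_loc_map)+
  interpret \<iota>: ring_hom_cring D K \<iota>
    by unfold_locales (fact \<iota>)
  interpret \<psi>: ring_hom_cring D E \<psi>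
    by unfold_locales (fact \<psi>)
  have square: "\<exists>e\<in>carrier D. d = e \<otimes>\<^bsub>D\<^esub> e \<or> d = \<ominus>\<^bsub>D\<^esub> (e \<otimes>\<^bsub>D\<^esub> e)" if d: "d \<in> carrier D" for d
  proof -
    obtain y where y: "y \<in> carrier K" "\<iota> d = y \<otimes>\<^bsub>K\<^esub> y \<or> \<iota> d = \<ominus>\<^bsub>K\<^esub> (y \<otimes>\<^bsub>K\<^esub> y)"
      using rcf d \<iota>.hom_closed unfolding real_closed_field_def by blast
    have y_int: "y \<in> \<iota> ` carrier D" if c: "c \<in> carrier D" "\<iota> c = y \<otimes>\<^bsub>K\<^esub> y" for c
    proof (rule closed)
      have "K.eval [\<one>\<^bsub>K\<^esub>, \<iota> \<zero>\<^bsub>D\<^esub>, \<iota> (\<ominus>\<^bsub>D\<^esub> c)] y = \<zero>\<^bsub>K\<^esub>"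
        using y c by (simp add: K.nat_pow_Suc numeral_2_eq_2 K.r_neg)
      moreover have "\<iota> \<zero>\<^bsub>D\<^esub> \<in> \<iota> ` carrier D" "\<iota> (\<ominus>\<^bsub>D\<^esub> c) \<in> \<iota> ` carrier D"
        by (rule imageI, simp add: c(1))+
      then have "set [\<iota> \<zero>\<^bsub>D\<^esub>, \<iota> (\<ominus>\<^bsub>D\<^esub> c)] \<subseteq> \<iota> ` carrier D"
        by (simp only: list.set insert_subset empty_subsetI simp_thms)
      ultimately show "integral_over K (\<iota> ` carrier D) y"
        unfolding integral_over_def by blast
    qed (fact y)
    from y(2) show ?thesis
    proof
      assume eq: "\<iota> d = y \<otimes>\<^bsub>K\<^esub> y"
      then obtain e where e: "e \<in> carrier D" "y = \<iota> e" using y_int d by blast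
      then have "\<iota> d = \<iota> (e \<otimes>\<^bsub>D\<^esub> e)" using eq by simp
      then show ?thesis using e d \<iota>(2) by (metis D.m_closed inj_onD)
    next
      assume eq: "\<iota> d = \<ominus>\<^bsub>K\<^esub> (y \<otimes>\<^bsub>K\<^esub> y)"
      then have "\<iota> (\<ominus>\<^bsub>D\<^esub> d) = y \<otimes>\<^bsub>K\<^esub> y" using y d by simp
      then obtain e where e: "e \<in> carrier D" "y = \<iota> e" using y_int d by (metis D.a_inv_closed imageE)
      then have "\<iota> d = \<iota> (\<ominus>\<^bsub>D\<^esub> (e \<otimes>\<^bsub>D\<^esub> e))" using eq by simp
      then show ?thesis using e d \<iota>(2) by (metis D.m_closed D.a_inv_closed inj_onD)
    qed
  qed
  have lift: "\<exists>q. set q \<subseteq> carrier D \<and> p = map \<psi> q" if "set p \<subseteq> \<psi> ` carrier D" for p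
    using that by (induction p) (auto, metis list.simps(9) insert_subset list.simps(15))
  have map_sub: "set (map \<iota> q) \<subseteq> \<iota> ` carrier D" if "set q \<subseteq> carrier D" for q
    using that by auto
  show "real_closed_in E (\<psi> ` carrier D)"
    unfolding real_closed_in_def
  proof (intro conjI ballI allI impI)
    show "\<psi> ` carrier D \<subseteq> carrier E" by auto
    show "\<one>\<^bsub>E\<^esub> \<in> \<psi> ` carrier D" by (metis D.one_closed \<psi>.hom_one image_eqI)
  next
    fix a b assume "a \<in> \<psi> ` carrier D" "b \<in> \<psi> ` carrier D"
    then obtain a' b' where "a' \<in> carrier D" "b' \<in> carrier D" "a = \<psi> a'" "b = \<psi> b'" by auto
    then have "a \<ominus>\<^bsub>E\<^esub> b = \<psi> (a' \<ominus>\<^bsub>D\<^esub> b')" "a \<otimes>\<^bsub>E\<^esub> b = \<psi> (a' \<otimes>\<^bsub>D\<^esub> b')"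
        "a' \<ominus>\<^bsub>D\<^esub> b' \<in> carrier D" "a' \<otimes>\<^bsub>D\<^esub> b' \<in> carrier D"
      by (simp_all add: D.minus_eq E.minus_eq)
    then show "a \<ominus>\<^bsub>E\<^esub> b \<in> \<psi> ` carrier D" "a \<otimes>\<^bsub>E\<^esub> b \<in> \<psi> ` carrier D" by blast+
  next
    fix a assume "a \<in> \<psi> ` carrier D"
    then obtain d where d: "d \<in> carrier D" "a = \<psi> d" by auto
    then obtain e where e: "e \<in> carrier D" "d = e \<otimes>\<^bsub>D\<^esub> e \<or> d = \<ominus>\<^bsub>D\<^esub> (e \<otimes>\<^bsub>D\<^esub> e)" using square by blast
    then have "a = \<psi> e \<otimes>\<^bsub>E\<^esub> \<psi> e \<or> a = \<ominus>\<^bsub>E\<^esub> (\<psi> e \<otimes>\<^bsub>E\<^esub> \<psi> e)" using d by auto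
    then show "\<exists>b\<in>\<psi> ` carrier D. a = b \<otimes>\<^bsub>E\<^esub> b \<or> a = \<ominus>\<^bsub>E\<^esub> (b \<otimes>\<^bsub>E\<^esub> b)" using e by blast
  next
    fix p assume p: "set p \<subseteq> \<psi> ` carrier D \<and> odd (length p)"
    then obtain q where q: "set q \<subseteq> carrier D" "p = map \<psi> q" using lift by blast
    let ?q = "\<one>\<^bsub>K\<^esub> # map \<iota> q"
    have "polynomial\<^bsub>K\<^esub> (carrier K) ?q" using q by (auto simp: polynomial_def)
    moreover have "odd (length ?q - 1)" using p q by simp
    ultimately obtain y where y: "y \<in> carrier K" "K.eval ?q y = \<zero>\<^bsub>K\<^esub>"
      using rcf unfolding real_closed_field_def by blast
    then have "integral_over K (\<iota> ` carrier D) y"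
      unfolding integral_over_def using map_sub [OF q(1)] by blast
    then obtain u where u: "u \<in> carrier D" "y = \<iota> u" using closed y by blast
    have "\<iota> (D.eval (\<one>\<^bsub>D\<^esub> # q) u) = \<iota> \<zero>\<^bsub>D\<^esub>"
      using D.ring_hom_eval [OF K.is_cring \<iota>(1), of "\<one>\<^bsub>D\<^esub> # q" u] u y q by simp
    then have 0: "D.eval (\<one>\<^bsub>D\<^esub> # q) u = \<zero>\<^bsub>D\<^esub>"
      using \<iota>(2) q u by (intro inj_onD [OF \<iota>(2)]) (auto intro!: D.eval_in_carrier simp del: D.eval.simps)
    have "E.eval (\<one>\<^bsub>E\<^esub> # p) (\<psi> u) = \<zero>\<^bsub>E\<^esub>"
      using D.ring_hom_eval [OF E.is_cring \<psi>(1), of "\<one>\<^bsub>D\<^esub> # q" u] u q 0 by simp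
    then show "\<exists>x\<in>\<psi> ` carrier D. E.eval (\<one>\<^bsub>E\<^esub> # p) x = \<zero>\<^bsub>E\<^esub>" using u by blast
  qed
  show "x \<in> \<psi> ` carrier D"
    if x: "x \<in> carrier E" and int: "integral_over E (\<psi> ` carrier D) x"
      and rs: "r \<in> \<psi> ` carrier D" "s \<in> \<psi> ` carrier D" "s \<noteq> \<zero>\<^bsub>E\<^esub>" "s \<otimes>\<^bsub>E\<^esub> x = r"
  proof -
    obtain q where q: "set q \<subseteq> carrier D" "E.eval (\<one>\<^bsub>E\<^esub> # map \<psi> q) x = \<zero>\<^bsub>E\<^esub>"
      using int lift unfolding integral_over_def by metis
    define q' where "q' = \<one>\<^bsub>D\<^esub> # q"
    have q': "set q' \<subseteq> carrier D" using q by (simp add: q'_def)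
    obtain r' s' where rs': "r' \<in> carrier D" "s' \<in> carrier D" "r = \<psi> r'" "s = \<psi> s'" using rs by auto
    have s'0: "s' \<noteq> \<zero>\<^bsub>D\<^esub>" using rs rs' by auto
    have map_in: "set (map \<psi> q') \<subseteq> carrier E" "set (map \<iota> q') \<subseteq> carrier K" using q' by auto
    have "s \<otimes>\<^bsub>E\<^esub> homogenized_eval E (map \<psi> q') r s = \<zero>\<^bsub>E\<^esub>"
      using E.homogenized_eval [OF x, of s "map \<psi> q'"] map_in rs rs' q by (simp add: q'_def)
    then have "homogenized_eval E (map \<psi> q') r s = \<zero>\<^bsub>E\<^esub>"
      using E.integral [of s] map_in rs rs' by (simp del: set_map)
    then have "\<psi> (homogenized_eval D q' r' s') = \<psi> \<zero>\<^bsub>D\<^esub>"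
      using D.ring_hom_homogenized_eval [OF E.is_cring \<psi>(1) q' rs'(1,2)] rs' by simp
    then have "homogenized_eval D q' r' s' = \<zero>\<^bsub>D\<^esub>"
      using q' rs' by (intro inj_onD [OF \<psi>(2)]) auto
    then have hK: "homogenized_eval K (map \<iota> q') (\<iota> r') (\<iota> s') = \<zero>\<^bsub>K\<^esub>"
      using D.ring_hom_homogenized_eval [OF K.is_cring \<iota>(1) q' rs'(1,2)] by simp
    have \<iota>s: "\<iota> s' \<in> carrier K" "\<iota> s' \<noteq> \<zero>\<^bsub>K\<^esub>"
      using rs' s'0 inj_onD [OF \<iota>(2), of s' "\<zero>\<^bsub>D\<^esub>"] by auto
    then have unit: "\<iota> s' \<in> Units K" using K.field_Units by simp
    \<comment> \<open>The fraction \<open>r / s\<close>, formed in \<open>K\<close>.\<close>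
    define y where "y = \<iota> r' \<otimes>\<^bsub>K\<^esub> inv\<^bsub>K\<^esub> \<iota> s'"
    have y: "y \<in> carrier K" "\<iota> s' \<otimes>\<^bsub>K\<^esub> y = \<iota> r'"
      using unit rs' \<iota>s by (simp_all add: y_def K.m_lcomm)
    have "\<iota> s' [^]\<^bsub>K\<^esub> length q' \<otimes>\<^bsub>K\<^esub> K.eval (map \<iota> q') y = \<zero>\<^bsub>K\<^esub>"
      using K.homogenized_eval [OF y(1) \<iota>s(1) map_in(2)] hK y \<iota>s by simp
    moreover have "\<iota> s' [^]\<^bsub>K\<^esub> length q' \<in> Units K" using unit by (rule K.Units_pow_closed)
    then have "\<iota> s' [^]\<^bsub>K\<^esub> length q' \<in> carrier K" "\<iota> s' [^]\<^bsub>K\<^esub> length q' \<noteq> \<zero>\<^bsub>K\<^esub>"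
      unfolding K.field_Units by simp_all
    ultimately have "K.eval (map \<iota> q') y = \<zero>\<^bsub>K\<^esub>"
      using K.integral_iff K.eval_in_carrier [OF map_in(2) y(1)] by simp
    then have "integral_over K (\<iota> ` carrier D) y"
      unfolding integral_over_def q'_def using map_sub [OF q(1)] by (metis \<iota>.hom_one list.simps(9))
    then obtain d where d: "d \<in> carrier D" "y = \<iota> d" using closed y by blast
    then have "\<iota> (s' \<otimes>\<^bsub>D\<^esub> d) = \<iota> r'" using y rs' by simp
    then have "s' \<otimes>\<^bsub>D\<^esub> d = r'" using rs' d by (intro inj_onD [OF \<iota>(2)]) auto
    then have "s \<otimes>\<^bsub>E\<^esub> \<psi> d = s \<otimes>\<^bsub>E\<^esub> x" using rs rs' d by (metis \<psi>.hom_mult)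
    then have "x = \<psi> d" using rs(3) rs' x d E.m_lcancel [of s "\<psi> d" x] by simp
    then show ?thesis using d by blast
  qed
qed

text \<open>
  An integral element is a fraction of elements of \<open>D\<close>, and these fractions lie in \<open>D\<close> as soon as
  they are integral.
\<close>

theorem real_closed_domain_integral_extension:
  fixes D :: "('a, 'm) ring_scheme" and E :: "'c set ring"
  assumes rcd: "real_closed_domain D P" and E: "domain E" "formally_real E"
    and \<psi>: "\<psi> \<in> ring_hom D E" "inj_on \<psi> (carrier D)"
    and x: "x \<in> carrier E" "integral_over E (\<psi> ` carrier D) x"
  shows "x \<in> \<psi> ` carrier D"
  using no_fraction_defect [of E] real_closed_domain_inside [OF rcd E(1) \<psi>] E x
  unfolding fraction_defect_def by blast

section \<open>Primes generated by idempotents\<close>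

text \<open>
  Zorn's lemma, applied to the ideals above \<open>I\<close> that avoid \<open>\<one>\<close>.
\<close>

lemma (in cring) proper_ideal_in_maximalideal:
  assumes I: "ideal I R" "\<one> \<notin> I"
  obtains M where "maximalideal M R" "I \<subseteq> M"
proof -
  define S where "S = {J. ideal J R \<and> I \<subseteq> J \<and> \<one> \<notin> J}"
  have "\<exists>M\<in>S. \<forall>J\<in>S. M \<subseteq> J \<longrightarrow> J = M"
  proof (rule subset_Zorn)
    fix C assume C: "subset.chain S C"
    show "\<exists>U\<in>S. \<forall>J\<in>C. J \<subseteq> U"
    proof (cases "C = {}")
      case True
      then show ?thesis using I by (auto simp: S_def)
    next
      case False
      have CS: "C \<subseteq> S" using C by (simp add: pred_on.chain_def)
      have "subset.chain {J. ideal J R} C"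
        using C CS unfolding pred_on.chain_def S_def by blast
      from chain_Union_is_ideal [OF this] have "ideal (\<Union>C) R" using False by simp
      then have "\<Union>C \<in> S" using CS False unfolding S_def by blast
      then show ?thesis by blast
    qed
  qed
  then obtain M where "M \<in> S" and max: "\<And>J. \<lbrakk>J \<in> S; M \<subseteq> J\<rbrakk> \<Longrightarrow> J = M" by blast
  then have M: "ideal M R" "I \<subseteq> M" "\<one> \<notin> M" by (simp_all add: S_def)
  have "maximalideal M R"
  proof (rule maximalidealI)
    show "carrier R \<noteq> M" using M(3) by auto
    fix J assume J: "ideal J R" "M \<subseteq> J" "J \<subseteq> carrier R"
    show "J = M \<or> J = carrier R"
    proof (cases "\<one> \<in> J")
      case True
      then show ?thesis using J ideal.one_imp_carrier by blast
    next
      case False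
      then have "J \<in> S" using J M(2) by (auto simp: S_def)
      then show ?thesis using max J(2) by blast
    qed
  qed (fact M(1))
  then show thesis using that M(2) by blast
qed

lemma FactRing_zero: "\<zero>\<^bsub>R Quot I\<^esub> = I"
  by (simp add: FactRing_def)

text \<open>
  The kernel of the localization at a multiplicative set \<open>F\<close>. If \<open>F\<close> consists of idempotents, it
  is the ideal generated by the idempotents \<open>1 - f\<close> with \<open>f \<in> F\<close>.
\<close>

definition torsion :: "('a, 'm) ring_scheme \<Rightarrow> 'a set \<Rightarrow> 'a set" where
  "torsion R F = {x \<in> carrier R. \<exists>f\<in>F. f \<otimes>\<^bsub>R\<^esub> x = \<zero>\<^bsub>R\<^esub>}"

lemma (in cring) torsion_ideal:
  assumes F: "F \<subseteq> carrier R" "\<one> \<in> F" "\<And>f g. \<lbrakk>f \<in> F; g \<in> F\<rbrakk> \<Longrightarrow> f \<otimes> g \<in> F"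
  shows "ideal (torsion R F) R"
proof (rule idealI)
  show "subgroup (torsion R F) (add_monoid R)"
  proof (rule add.subgroupI)
    show "torsion R F \<subseteq> carrier R" by (auto simp: torsion_def)
    have "\<zero> \<in> torsion R F" unfolding torsion_def using F(2) l_one [OF zero_closed] by blast
    then show "torsion R F \<noteq> {}" by blast
  next
    fix x assume "x \<in> torsion R F"
    then obtain f where *: "x \<in> carrier R" "f \<in> F" "f \<otimes> x = \<zero>" by (auto simp: torsion_def)
    then have "f \<otimes> \<ominus> x = \<zero>" using F(1) r_minus [of f x] by (simp add: subset_iff)
    then show "\<ominus> x \<in> torsion R F" using * by (auto simp: torsion_def)
  next
    fix x y assume "x \<in> torsion R F" "y \<in> torsion R F"
    then obtain f g where *: "x \<in> carrier R" "f \<in> F" "f \<otimes> x = \<zero>" "y \<in> carrier R" "g \<in> F" "g \<otimes> y = \<zero>"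
      by (auto simp: torsion_def)
    then have in_R: "f \<in> carrier R" "g \<in> carrier R" using F by auto
    have "(f \<otimes> g) \<otimes> (x \<oplus> y) = g \<otimes> (f \<otimes> x) \<oplus> f \<otimes> (g \<otimes> y)"
      using *(1,4) in_R by (simp add: r_distr m_ac)
    then have "(f \<otimes> g) \<otimes> (x \<oplus> y) = \<zero>" using * in_R by simp
    then show "x \<oplus> y \<in> torsion R F" using * F(3) by (auto simp: torsion_def)
  qed
next
  fix a x assume "a \<in> torsion R F" "x \<in> carrier R"
  then obtain f where *: "a \<in> carrier R" "f \<in> F" "f \<otimes> a = \<zero>" "x \<in> carrier R"
    by (auto simp: torsion_def)
  then have "f \<otimes> (a \<otimes> x) = \<zero>" using F by (metis l_null m_assoc subsetD)
  then show "a \<otimes> x \<in> torsion R F" "x \<otimes> a \<in> torsion R F"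
    using * by (auto simp: torsion_def m_comm)
qed (fact ring_axioms)

lemma (in cring) one_minus_idempotent:
  assumes "e \<in> carrier R" "e \<otimes> e = e"
  shows "(\<one> \<ominus> e) \<otimes> (\<one> \<ominus> e) = \<one> \<ominus> e" "e \<otimes> (\<one> \<ominus> e) = \<zero>" "(\<one> \<ominus> e) \<otimes> e = \<zero>"
proof -
  show *: "e \<otimes> (\<one> \<ominus> e) = \<zero>"
    using assms by (simp add: minus_eq r_distr r_minus r_neg)
  then show "(\<one> \<ominus> e) \<otimes> e = \<zero>" using assms by (simp add: m_comm)
  show "(\<one> \<ominus> e) \<otimes> (\<one> \<ominus> e) = \<one> \<ominus> e"
  proof -
    have "(\<one> \<ominus> e) \<otimes> (\<one> \<ominus> e) = (\<one> \<ominus> e) \<ominus> e \<otimes> (\<one> \<ominus> e)"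
      using assms by (simp add: minus_eq l_distr l_minus)
    then show ?thesis using * assms by (simp add: minus_eq)
  qed
qed

lemma (in cring) one_minus_mult_eq_zero_iff:
  assumes "e \<in> carrier R" "x \<in> carrier R"
  shows "(\<one> \<ominus> e) \<otimes> x = \<zero> \<longleftrightarrow> e \<otimes> x = x"
proof -
  have "(\<one> \<ominus> e) \<otimes> x = x \<ominus> e \<otimes> x" using assms by (simp add: minus_eq l_distr l_minus)
  then show ?thesis using assms by (metis m_closed r_right_minus_eq)
qed

text \<open>
  Rickart rings are also known as p.p. rings: the idempotent \<open>g\<close> exists precisely when the principal
  ideal of \<open>c\<close> is a projective module.
\<close>

definition rickart :: "('a, 'm) ring_scheme \<Rightarrow> bool" where
  "rickart R \<longleftrightarrow> (\<forall>c\<in>carrier R. \<exists>g\<in>carrier R. g \<otimes>\<^bsub>R\<^esub> g = g \<and> g \<otimes>\<^bsub>R\<^esub> c = \<zero>\<^bsub>R\<^esub>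
     \<and> (\<forall>x\<in>carrier R. x \<otimes>\<^bsub>R\<^esub> c = \<zero>\<^bsub>R\<^esub> \<longrightarrow> g \<otimes>\<^bsub>R\<^esub> x = x))"

definition idempotents_outside :: "('a, 'm) ring_scheme \<Rightarrow> 'a set \<Rightarrow> 'a set" where
  "idempotents_outside R M = {f \<in> carrier R. f \<otimes>\<^bsub>R\<^esub> f = f \<and> f \<notin> M}"

lemma (in cring) idempotents_outside_mult:
  assumes "primeideal M R" "f \<in> idempotents_outside R M" "g \<in> idempotents_outside R M"
  shows "f \<otimes> g \<in> idempotents_outside R M"
proof -
  have *: "f \<in> carrier R" "g \<in> carrier R" "f \<otimes> f = f" "g \<otimes> g = g" "f \<notin> M" "g \<notin> M"
    using assms by (auto simp: idempotents_outside_def)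
  have "(f \<otimes> g) \<otimes> (f \<otimes> g) = (f \<otimes> f) \<otimes> (g \<otimes> g)" using *(1,2) by (simp add: m_ac)
  then show ?thesis
    using * primeideal.I_prime [OF assms(1) *(1,2)] by (auto simp: idempotents_outside_def)
qed

text \<open>
  Suppose that \<open>f x y = 0\<close> with an idempotent \<open>f \<notin> M\<close>, and let the idempotent \<open>g\<close> generate the
  annihilator of \<open>f x\<close>. One of \<open>g\<close> and \<open>1 - g\<close> lies outside \<open>M\<close>; the first one kills \<open>f x\<close>, the
  second one kills \<open>y\<close>.
\<close>

lemma (in cring) torsion_primeideal:
  assumes rickart: "rickart R" and M: "primeideal M R"
  shows "primeideal (torsion R (idempotents_outside R M)) R" (is "primeideal ?Q R")
proof (rule primeidealI)
  interpret M: primeideal M R by fact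
  let ?F = "idempotents_outside R M"
  have one: "\<one> \<in> ?F" using M.I_notcarr M.one_imp_carrier by (auto simp: idempotents_outside_def)
  have F: "?F \<subseteq> carrier R" by (auto simp: idempotents_outside_def)
  show "ideal ?Q R"
    using F one idempotents_outside_mult [OF M] by (rule torsion_ideal)
  have "\<one> \<notin> ?Q"
    by (auto simp: torsion_def idempotents_outside_def)
  then show "carrier R \<noteq> ?Q" by auto
  fix x y assume xy: "x \<in> carrier R" "y \<in> carrier R" "x \<otimes> y \<in> ?Q"
  then obtain f where f: "f \<in> ?F" "f \<otimes> (x \<otimes> y) = \<zero>" by (auto simp: torsion_def)
  then have f_in: "f \<in> carrier R" using F by auto
  obtain g where g: "g \<in> carrier R" "g \<otimes> g = g" "g \<otimes> (f \<otimes> x) = \<zero>"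
    and g_ann: "\<And>z. \<lbrakk>z \<in> carrier R; z \<otimes> (f \<otimes> x) = \<zero>\<rbrakk> \<Longrightarrow> g \<otimes> z = z"
    using rickart xy f_in unfolding rickart_def by (metis m_closed)
  show "x \<in> ?Q \<or> y \<in> ?Q"
  proof (cases "g \<in> M")
    case False
    then have "g \<otimes> f \<in> ?F"
      using f g by (intro idempotents_outside_mult [OF M]) (auto simp: idempotents_outside_def)
    moreover have "(g \<otimes> f) \<otimes> x = \<zero>" using g f_in xy by (simp add: m_assoc)
    ultimately show ?thesis using xy by (auto simp: torsion_def)
  next
    case True
    have "\<one> \<ominus> g \<notin> M"
    proof
      assume "\<one> \<ominus> g \<in> M"
      then have "(\<one> \<ominus> g) \<oplus> g \<in> M" using True by (rule M.a_closed)
      then have "\<one> \<in> M" using g by (simp add: minus_eq a_assoc l_neg)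
      then show False using one by (simp add: idempotents_outside_def)
    qed
    then have "\<one> \<ominus> g \<in> ?F"
      using g one_minus_idempotent [of g] by (auto simp: idempotents_outside_def)
    moreover have "y \<otimes> (f \<otimes> x) = \<zero>" using f xy f_in by (metis m_comm m_lcomm)
    then have "(\<one> \<ominus> g) \<otimes> y = \<zero>"
      using g_ann xy g one_minus_mult_eq_zero_iff by blast
    ultimately show ?thesis using xy by (auto simp: torsion_def)
  qed
qed (fact is_cring)

text \<open>
  If \<open>f\<close> kills a sum of squares, then the squares of the elements \<open>f x\<close> add up to zero.
\<close>

lemma (in cring) quotient_torsion_formally_real:
  assumes fr: "formally_real R" and I: "ideal (torsion R F) R" and F: "F \<subseteq> carrier R"
  shows "formally_real (R Quot torsion R F)"
  unfolding formally_real_def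
proof (intro allI impI)
  let ?Q = "torsion R F"
  interpret I: ideal ?Q R by fact
  interpret h: ring_hom_cring R "R Quot ?Q" "(+>) ?Q" by (rule I.rcos_ring_hom_cring) (fact is_cring)
  fix n :: nat and y i
  assume y: "y \<in> {..<n} \<rightarrow> carrier (R Quot ?Q)"
    and sum: "(\<Oplus>\<^bsub>R Quot ?Q\<^esub>i\<in>{..<n}. y i \<otimes>\<^bsub>R Quot ?Q\<^esub> y i) = \<zero>\<^bsub>R Quot ?Q\<^esub>" and i: "i < n"
  have "\<exists>x\<in>carrier R. ?Q +> x = y k" if "k < n" for k
  proof -
    have "y k \<in> carrier (R Quot ?Q)" using y that by auto
    then show ?thesis unfolding FactRing_def A_RCOSETS_def' partial_object.simps by blast
  qed
  then obtain x where x: "\<And>k. k < n \<Longrightarrow> x k \<in> carrier R" "\<And>k. k < n \<Longrightarrow> ?Q +> x k = y k"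
    by metis
  let ?s = "\<Oplus>k\<in>{..<n}. x k \<otimes> x k"
  have s: "?s \<in> carrier R" using x by (intro finsum_closed) auto
  have "?Q +> ?s = (\<Oplus>\<^bsub>R Quot ?Q\<^esub>k\<in>{..<n}. ?Q +> (x k \<otimes> x k))"
    using x by (subst h.hom_finsum) (auto simp: comp_def)
  also have "\<dots> = (\<Oplus>\<^bsub>R Quot ?Q\<^esub>k\<in>{..<n}. y k \<otimes>\<^bsub>R Quot ?Q\<^esub> y k)"
    using x(1) x(2) [symmetric] y by (intro h.S.finsum_cong' refl) (auto simp: Pi_iff)
  finally have "?Q +> ?s = \<zero>\<^bsub>R Quot ?Q\<^esub>" using sum by simp
  then have "?Q +> ?s = ?Q" by (simp only: FactRing_zero)
  then have "?s \<in> ?Q" using s I.a_rcos_self [of ?s] by simp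
  then obtain f where f: "f \<in> F" "f \<otimes> ?s = \<zero>" unfolding torsion_def by blast
  then have f_in: "f \<in> carrier R" using F by auto
  have "(\<Oplus>k\<in>{..<n}. (f \<otimes> x k) \<otimes> (f \<otimes> x k)) = (\<Oplus>k\<in>{..<n}. f \<otimes> (f \<otimes> (x k \<otimes> x k)))"
    using x f_in by (intro finsum_cong') (auto simp: m_ac)
  also have "\<dots> = f \<otimes> (f \<otimes> ?s)"
    using x f_in by (simp add: finsum_rdistr Pi_iff)
  also have "\<dots> = \<zero>" using f f_in by simp
  finally have "f \<otimes> x i = \<zero>"
    using fr [unfolded formally_real_def, rule_format, of "\<lambda>k. f \<otimes> x k" n i] x f_in i by (simp add: Pi_iff)
  then have "x i \<in> ?Q" unfolding torsion_def using f(1) x(1) [OF i] by blast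
  then show "y i = \<zero>\<^bsub>R Quot ?Q\<^esub>"
    using x(2) [OF i] I.a_rcos_const by (simp only: FactRing_zero)
qed

section \<open>Essential extensions of Baer rings\<close>

lemma formally_real_subring:
  assumes R: "cring R" and S: "cring S" "formally_real S"
    and h: "h \<in> ring_hom R S" "inj_on h (carrier R)"
  shows "formally_real R"
  unfolding formally_real_def
proof (intro allI impI)
  interpret R: cring R by fact
  interpret S: cring S by fact
  interpret h: ring_hom_cring R S h by unfold_locales (fact h)
  fix n :: nat and f i
  assume f: "f \<in> {..<n} \<rightarrow> carrier R" and sum: "(\<Oplus>\<^bsub>R\<^esub>k\<in>{..<n}. f k \<otimes>\<^bsub>R\<^esub> f k) = \<zero>\<^bsub>R\<^esub>" and i: "i < n"
  have "(\<Oplus>\<^bsub>S\<^esub>k\<in>{..<n}. h (f k) \<otimes>\<^bsub>S\<^esub> h (f k)) = (\<Oplus>\<^bsub>S\<^esub>k\<in>{..<n}. h (f k \<otimes>\<^bsub>R\<^esub> f k))"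
    using f by (intro S.finsum_cong' refl) (auto simp: Pi_iff)
  also have "\<dots> = h (\<Oplus>\<^bsub>R\<^esub>k\<in>{..<n}. f k \<otimes>\<^bsub>R\<^esub> f k)"
    using f by (subst h.hom_finsum) (auto simp: comp_def Pi_iff)
  also have "\<dots> = \<zero>\<^bsub>S\<^esub>" using sum by simp
  finally have "h (f i) = \<zero>\<^bsub>S\<^esub>"
    using S(2) [unfolded formally_real_def, rule_format, of "\<lambda>k. h (f k)" n i] f i by (simp add: Pi_iff)
  then have "h (f i) = h \<zero>\<^bsub>R\<^esub>" by simp
  then show "f i = \<zero>\<^bsub>R\<^esub>" using f i by (intro inj_onD [OF h(2)]) auto
qed

lemma real_closed_domain_formally_real:
  assumes "real_closed_domain D P"
  shows "formally_real D"
proof -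
  interpret D: domain D using assms by (simp add: real_closed_domain_def)
  let ?K = "localization D (nonzeros D)"
  have K: "real_closed_field ?K" using assms by (simp add: real_closed_domain_def)
  then interpret K: field ?K by (simp add: real_closed_field_def)
  show ?thesis
    using D.is_cring K.is_cring _ D.loc_map_ring_hom D.inj_on_loc_map
    by (rule formally_real_subring) (use K in \<open>simp add: real_closed_field_def\<close>)
qed

lemma ring_extension_hom:
  assumes "ring_extension A B \<phi>"
  shows "ring_hom_cring A B \<phi>"
  using assms unfolding ring_extension_def ring_hom_cring_def ring_hom_cring_axioms_def by blast

lemma essential_extension_meets:
  assumes ess: "essential_extension A B \<phi>" and J: "ideal J B" "x \<in> J" "x \<noteq> \<zero>\<^bsub>B\<^esub>"
  obtains a where "a \<in> carrier A" "\<phi> a \<in> J" "\<phi> a \<noteq> \<zero>\<^bsub>B\<^esub>"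
proof -
  have "J \<inter> \<phi> ` carrier A \<noteq> {\<zero>\<^bsub>B\<^esub>}" using ess J unfolding essential_extension_def by blast
  moreover have "\<zero>\<^bsub>B\<^esub> \<in> J \<inter> \<phi> ` carrier A"
  proof -
    interpret \<phi>: ring_hom_cring A B \<phi>
      using ess ring_extension_hom by (auto simp: essential_extension_def)
    have "\<phi> \<zero>\<^bsub>A\<^esub> = \<zero>\<^bsub>B\<^esub>" by simp
    then show ?thesis using additive_subgroup.zero_closed [OF ideal.axioms(1) [OF J(1)]]
      by (metis IntI \<phi>.R.zero_closed image_eqI)
  qed
  ultimately show thesis using that by blast
qed

text \<open>
  Let \<open>I\<close> be the contraction of the ideal \<open>c B\<close> to \<open>A\<close>, and let the idempotent \<open>e\<close> generate its
  annihilator in \<open>A\<close>. Then \<open>e\<close> also generates the annihilator of \<open>c\<close> in \<open>B\<close>: otherwise \<open>e c\<close>, or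
  \<open>(1 - e) x\<close> for some \<open>x\<close> with \<open>x c = 0\<close>, generates an ideal of \<open>B\<close> that is not zero and hence
  contains an element of \<open>A\<close> other than zero, but both kinds of elements of \<open>A\<close> vanish.
\<close>

lemma baer_imp_rickart_extension:
  assumes baer: "baer_ring A" and ess: "essential_extension A B \<phi>" and c: "c \<in> carrier B"
  obtains g where "g \<in> \<phi> ` carrier A" "g \<otimes>\<^bsub>B\<^esub> g = g" "g \<otimes>\<^bsub>B\<^esub> c = \<zero>\<^bsub>B\<^esub>"
    "\<And>x. \<lbrakk>x \<in> carrier B; x \<otimes>\<^bsub>B\<^esub> c = \<zero>\<^bsub>B\<^esub>\<rbrakk> \<Longrightarrow> g \<otimes>\<^bsub>B\<^esub> x = x"
proof -
  have ext: "cring A" "cring B" "\<phi> \<in> ring_hom A B" "inj_on \<phi> (carrier A)"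
    using ess by (auto simp: essential_extension_def ring_extension_def)
  interpret A: cring A by fact
  interpret B: cring B by fact
  interpret \<phi>: ring_hom_cring A B \<phi> by unfold_locales (fact ext)
  have \<phi>_zero: "a = \<zero>\<^bsub>A\<^esub>" if "a \<in> carrier A" "\<phi> a = \<zero>\<^bsub>B\<^esub>" for a
    using that by (intro inj_onD [OF ext(4)]) auto
  define I where "I = {a \<in> carrier A. \<phi> a \<in> PIdl\<^bsub>B\<^esub> c}"
  obtain e where e: "e \<in> carrier A" "e \<otimes>\<^bsub>A\<^esub> e = e" "annihilator A I = PIdl\<^bsub>A\<^esub> e"
  proof -
    have "I \<subseteq> carrier A" by (auto simp: I_def)
    then show thesis using baer that unfolding baer_ring_def by blast
  qed
  have e_ann: "e \<in> annihilator A I" using e A.cgenideal_self by simp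
  have ann_e: "e \<otimes>\<^bsub>A\<^esub> a = a" if "a \<in> annihilator A I" for a
  proof -
    have "a \<in> PIdl\<^bsub>A\<^esub> e" using that e(3) by simp
    then obtain t where t: "t \<in> carrier A" "a = t \<otimes>\<^bsub>A\<^esub> e" by (auto simp: cgenideal_def)
    then show ?thesis using e by (metis A.m_assoc A.m_comm)
  qed
  define g where "g = \<phi> e"
  have g: "g \<in> carrier B" "g \<otimes>\<^bsub>B\<^esub> g = g"
    using e by (simp_all add: g_def flip: \<phi>.hom_mult)
  have "g \<otimes>\<^bsub>B\<^esub> c = \<zero>\<^bsub>B\<^esub>"
  proof (rule ccontr)
    assume nz: "g \<otimes>\<^bsub>B\<^esub> c \<noteq> \<zero>\<^bsub>B\<^esub>"
    have gc: "g \<otimes>\<^bsub>B\<^esub> c \<in> carrier B" using g c by simp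
    obtain a where a: "a \<in> carrier A" "\<phi> a \<in> PIdl\<^bsub>B\<^esub> (g \<otimes>\<^bsub>B\<^esub> c)" "\<phi> a \<noteq> \<zero>\<^bsub>B\<^esub>"
      using essential_extension_meets [OF ess B.cgenideal_ideal [OF gc] B.cgenideal_self [OF gc] nz] by blast
    then obtain t where t: "t \<in> carrier B" "\<phi> a = t \<otimes>\<^bsub>B\<^esub> (g \<otimes>\<^bsub>B\<^esub> c)" by (auto simp: cgenideal_def)
    have "\<phi> a = (t \<otimes>\<^bsub>B\<^esub> g) \<otimes>\<^bsub>B\<^esub> c" using t g c by (simp add: B.m_assoc)
    then have "a \<in> I" using a t g by (auto simp: I_def cgenideal_def)
    then have "e \<otimes>\<^bsub>A\<^esub> a = \<zero>\<^bsub>A\<^esub>" using e_ann by (simp add: annihilator_def)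
    then have "g \<otimes>\<^bsub>B\<^esub> \<phi> a = \<zero>\<^bsub>B\<^esub>" using a e by (simp add: g_def flip: \<phi>.hom_mult)
    moreover have "g \<otimes>\<^bsub>B\<^esub> \<phi> a = \<phi> a"
    proof -
      have "g \<otimes>\<^bsub>B\<^esub> \<phi> a = t \<otimes>\<^bsub>B\<^esub> ((g \<otimes>\<^bsub>B\<^esub> g) \<otimes>\<^bsub>B\<^esub> c)"
        unfolding t(2) using t(1) g(1) c by (simp add: B.m_ac)
      then show ?thesis using g t(2) by simp
    qed
    ultimately show False using a by simp
  qed
  moreover have "g \<otimes>\<^bsub>B\<^esub> x = x" if x: "x \<in> carrier B" "x \<otimes>\<^bsub>B\<^esub> c = \<zero>\<^bsub>B\<^esub>" for x
  proof (rule ccontr)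
    let ?y = "(\<one>\<^bsub>B\<^esub> \<ominus>\<^bsub>B\<^esub> g) \<otimes>\<^bsub>B\<^esub> x"
    assume "g \<otimes>\<^bsub>B\<^esub> x \<noteq> x"
    then have nz: "?y \<noteq> \<zero>\<^bsub>B\<^esub>" using B.one_minus_mult_eq_zero_iff g x by blast
    have y: "?y \<in> carrier B" using g x by simp
    obtain a where a: "a \<in> carrier A" "\<phi> a \<in> PIdl\<^bsub>B\<^esub> ?y" "\<phi> a \<noteq> \<zero>\<^bsub>B\<^esub>"
      using essential_extension_meets [OF ess B.cgenideal_ideal [OF y] B.cgenideal_self [OF y] nz] by blast
    then obtain t where t: "t \<in> carrier B" "\<phi> a = t \<otimes>\<^bsub>B\<^esub> ?y" by (auto simp: cgenideal_def)
    have "a \<in> annihilator A I"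
      unfolding annihilator_def
    proof (intro CollectI conjI ballI)
      fix i assume "i \<in> I"
      then obtain u where i: "i \<in> carrier A" "u \<in> carrier B" "\<phi> i = u \<otimes>\<^bsub>B\<^esub> c" by (auto simp: I_def cgenideal_def)
      define w where "w = \<one>\<^bsub>B\<^esub> \<ominus>\<^bsub>B\<^esub> g"
      have w: "w \<in> carrier B" using g by (simp add: w_def)
      have "\<phi> (a \<otimes>\<^bsub>A\<^esub> i) = (t \<otimes>\<^bsub>B\<^esub> w \<otimes>\<^bsub>B\<^esub> u) \<otimes>\<^bsub>B\<^esub> (x \<otimes>\<^bsub>B\<^esub> c)"
        using a(1) t i w x(1) c by (simp add: B.m_ac flip: w_def)
      then show "a \<otimes>\<^bsub>A\<^esub> i = \<zero>\<^bsub>A\<^esub>" using \<phi>_zero a i x t w by simp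
    qed (fact a)
    then have "g \<otimes>\<^bsub>B\<^esub> \<phi> a = \<phi> a" using ann_e a e by (simp add: g_def flip: \<phi>.hom_mult)
    moreover have "g \<otimes>\<^bsub>B\<^esub> \<phi> a = t \<otimes>\<^bsub>B\<^esub> ((g \<otimes>\<^bsub>B\<^esub> (\<one>\<^bsub>B\<^esub> \<ominus>\<^bsub>B\<^esub> g)) \<otimes>\<^bsub>B\<^esub> x)"
      unfolding t(2) using t(1) g(1) x B.minus_closed [OF B.one_closed g(1)]
      by (metis B.m_assoc B.m_lcomm B.m_closed)
    ultimately show False
      using a(3) B.one_minus_idempotent(2) [OF g] x t g by simp
  qed
  moreover have "g \<in> \<phi> ` carrier A" using e by (simp add: g_def)
  ultimately show thesis using that g by blast
qed

text \<open>
  The annihilator of \<open>1 - e\<close> is generated by \<open>e\<close> and by an idempotent of \<open>A\<close>, and an ideal is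
  generated by at most one idempotent.
\<close>

lemma essential_extension_idempotents:
  assumes baer: "baer_ring A" and ess: "essential_extension A B \<phi>"
    and e: "e \<in> carrier B" "e \<otimes>\<^bsub>B\<^esub> e = e"
  shows "e \<in> \<phi> ` carrier A"
proof -
  interpret A: cring A using ess by (simp add: essential_extension_def ring_extension_def)
  interpret B: cring B using ess by (simp add: essential_extension_def ring_extension_def)
  have \<phi>: "\<phi> \<in> ring_hom A B" using ess by (simp add: essential_extension_def ring_extension_def)
  have "\<one>\<^bsub>B\<^esub> \<ominus>\<^bsub>B\<^esub> e \<in> carrier B" using e by simp
  then obtain g where g: "g \<in> \<phi> ` carrier A" "g \<otimes>\<^bsub>B\<^esub> (\<one>\<^bsub>B\<^esub> \<ominus>\<^bsub>B\<^esub> e) = \<zero>\<^bsub>B\<^esub>"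
    "\<And>x. \<lbrakk>x \<in> carrier B; x \<otimes>\<^bsub>B\<^esub> (\<one>\<^bsub>B\<^esub> \<ominus>\<^bsub>B\<^esub> e) = \<zero>\<^bsub>B\<^esub>\<rbrakk> \<Longrightarrow> g \<otimes>\<^bsub>B\<^esub> x = x"
    using baer_imp_rickart_extension [OF baer ess] by metis
  have g_in: "g \<in> carrier B" using g(1) ring_hom_memE(1) [OF \<phi>] by auto
  have "g \<otimes>\<^bsub>B\<^esub> e = e" using g(3) e B.one_minus_idempotent by blast
  moreover have "(\<one>\<^bsub>B\<^esub> \<ominus>\<^bsub>B\<^esub> e) \<otimes>\<^bsub>B\<^esub> g = \<zero>\<^bsub>B\<^esub>" using g(2) g_in e by (simp add: B.m_comm)
  then have "e \<otimes>\<^bsub>B\<^esub> g = g" using B.one_minus_mult_eq_zero_iff e g_in by blast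
  ultimately show ?thesis using g(1) g_in e by (metis B.m_comm)
qed

lemma baer_imp_rickart:
  assumes baer: "baer_ring A" and ess: "essential_extension A B \<phi>"
  shows "rickart B"
  unfolding rickart_def
proof
  fix c assume c: "c \<in> carrier B"
  have \<phi>: "\<phi> \<in> ring_hom A B" using ess by (simp add: essential_extension_def ring_extension_def)
  from baer_imp_rickart_extension [OF baer ess c] obtain g where
    "g \<in> \<phi> ` carrier A" "g \<otimes>\<^bsub>B\<^esub> g = g" "g \<otimes>\<^bsub>B\<^esub> c = \<zero>\<^bsub>B\<^esub>"
    "\<And>x. \<lbrakk>x \<in> carrier B; x \<otimes>\<^bsub>B\<^esub> c = \<zero>\<^bsub>B\<^esub>\<rbrakk> \<Longrightarrow> g \<otimes>\<^bsub>B\<^esub> x = x" by metis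
  moreover from this have "g \<in> carrier B" using ring_hom_memE(1) [OF \<phi>] by auto
  ultimately show "\<exists>g\<in>carrier B. g \<otimes>\<^bsub>B\<^esub> g = g \<and> g \<otimes>\<^bsub>B\<^esub> c = \<zero>\<^bsub>B\<^esub>
      \<and> (\<forall>x\<in>carrier B. x \<otimes>\<^bsub>B\<^esub> c = \<zero>\<^bsub>B\<^esub> \<longrightarrow> g \<otimes>\<^bsub>B\<^esub> x = x)" by blast
qed

text \<open>
  This makes the results on extensions available for \<open>A\<close> itself.
\<close>

lemma essential_extension_id:
  assumes "cring A"
  shows "essential_extension A A id"
proof -
  interpret cring A by fact
  have "J \<inter> carrier A = J" if "ideal J A" for J
    using additive_subgroup.a_subset [OF ideal.axioms(1) [OF that]] by blast
  then show ?thesis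
    using assms by (auto simp: essential_extension_def ring_extension_def ring_hom_def)
qed

text \<open>
  If \<open>f i \<noteq> 0\<close> occurs in a vanishing sum of squares, let the idempotent \<open>g\<close> generate the annihilator
  of \<open>f i\<close> and choose a maximal ideal \<open>M\<close> that contains \<open>g\<close>. The prime ideal generated by the
  idempotents in \<open>M\<close> does not contain \<open>f i\<close>, since no idempotent outside \<open>M\<close> kills \<open>f i\<close>. This
  contradicts the formal reality of the quotient.
\<close>

lemma baer_formally_real:
  assumes baer: "baer_ring A"
    and rcd: "\<And>P. primeideal P A \<Longrightarrow> \<exists>T. real_closed_domain (A Quot P) T"
  shows "formally_real A"
  unfolding formally_real_def
proof (intro allI impI)
  interpret A: cring A using baer by (simp add: baer_ring_def)
  have rick: "rickart A" by (rule baer_imp_rickart [OF baer essential_extension_id [OF A.is_cring]])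
  fix n :: nat and f i
  assume f: "f \<in> {..<n} \<rightarrow> carrier A" and sum: "(\<Oplus>\<^bsub>A\<^esub>k\<in>{..<n}. f k \<otimes>\<^bsub>A\<^esub> f k) = \<zero>\<^bsub>A\<^esub>" and i: "i < n"
  have fi: "f i \<in> carrier A" using f i by auto
  show "f i = \<zero>\<^bsub>A\<^esub>"
  proof (rule ccontr)
    assume nz: "f i \<noteq> \<zero>\<^bsub>A\<^esub>"
    obtain g where g: "g \<in> carrier A" "g \<otimes>\<^bsub>A\<^esub> g = g" "g \<otimes>\<^bsub>A\<^esub> f i = \<zero>\<^bsub>A\<^esub>"
      and g_ann: "\<And>x. \<lbrakk>x \<in> carrier A; x \<otimes>\<^bsub>A\<^esub> f i = \<zero>\<^bsub>A\<^esub>\<rbrakk> \<Longrightarrow> g \<otimes>\<^bsub>A\<^esub> x = x"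
      using rick fi unfolding rickart_def by metis
    have "\<one>\<^bsub>A\<^esub> \<notin> PIdl\<^bsub>A\<^esub> g"
    proof
      assume "\<one>\<^bsub>A\<^esub> \<in> PIdl\<^bsub>A\<^esub> g"
      then obtain t where t: "t \<in> carrier A" "\<one>\<^bsub>A\<^esub> = t \<otimes>\<^bsub>A\<^esub> g" by (auto simp: cgenideal_def)
      have "f i = t \<otimes>\<^bsub>A\<^esub> g \<otimes>\<^bsub>A\<^esub> f i" using t(2) fi by (metis A.l_one)
      also have "\<dots> = \<zero>\<^bsub>A\<^esub>" using t(1) g fi by (simp add: A.m_assoc)
      finally show False using nz by simp
    qed
    then obtain M where M: "maximalideal M A" "PIdl\<^bsub>A\<^esub> g \<subseteq> M"
      using A.proper_ideal_in_maximalideal [OF A.cgenideal_ideal [OF g(1)]] by metis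
    have M_prime: "primeideal M A" by (rule A.maximalideal_prime) (fact M)
    let ?Q = "torsion A (idempotents_outside A M)"
    have Q: "primeideal ?Q A" by (rule A.torsion_primeideal [OF rick M_prime])
    then interpret Q: primeideal ?Q A .
    interpret h: ring_hom_cring A "A Quot ?Q" "(+>\<^bsub>A\<^esub>) ?Q"
      by (rule Q.rcos_ring_hom_cring)
    have fr: "formally_real (A Quot ?Q)" using rcd [OF Q] real_closed_domain_formally_real by blast
    have "(\<Oplus>\<^bsub>A Quot ?Q\<^esub>k\<in>{..<n}. (?Q +>\<^bsub>A\<^esub> f k) \<otimes>\<^bsub>A Quot ?Q\<^esub> (?Q +>\<^bsub>A\<^esub> f k))
        = (\<Oplus>\<^bsub>A Quot ?Q\<^esub>k\<in>{..<n}. ?Q +>\<^bsub>A\<^esub> (f k \<otimes>\<^bsub>A\<^esub> f k))"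
      using f by (intro h.S.finsum_cong' refl) (auto simp: Pi_iff)
    also have "\<dots> = ?Q +>\<^bsub>A\<^esub> (\<Oplus>\<^bsub>A\<^esub>k\<in>{..<n}. f k \<otimes>\<^bsub>A\<^esub> f k)"
      using f by (subst h.hom_finsum) (auto simp: comp_def Pi_iff)
    also have "\<dots> = \<zero>\<^bsub>A Quot ?Q\<^esub>" using sum by simp
    finally have "?Q +>\<^bsub>A\<^esub> f i = \<zero>\<^bsub>A Quot ?Q\<^esub>"
      using fr [unfolded formally_real_def, rule_format, of "\<lambda>k. ?Q +>\<^bsub>A\<^esub> f k" n i] f i by (simp add: Pi_iff)
    then have "f i \<in> ?Q" using Q.a_rcos_self [OF fi] by (simp add: FactRing_zero)
    then obtain u where u: "u \<in> carrier A" "u \<notin> M" "u \<otimes>\<^bsub>A\<^esub> f i = \<zero>\<^bsub>A\<^esub>"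
      unfolding torsion_def idempotents_outside_def by blast
    then have "u = u \<otimes>\<^bsub>A\<^esub> g" using g_ann g by (metis A.m_comm)
    then have "u \<in> PIdl\<^bsub>A\<^esub> g" using u by (auto simp: cgenideal_def)
    then show False using u M by blast
  qed
qed

text \<open>
  For an element \<open>b\<close> outside \<open>A\<close>, the set \<open>F\<close> collects the complements \<open>1 - e\<close> of the idempotents
  with \<open>e b \<in> A\<close>; in terms of complements the set is closed under products. The ideals of the
  outline are then \<open>torsion B F\<close> and \<open>Q\<close>.
\<close>

theorem baer_imp_extension_surjective:
  fixes A :: "('a, 'm) ring_scheme" and B :: "'b ring"
  assumes baer: "baer_ring A"
    and rcd: "\<And>P. primeideal P A \<Longrightarrow> \<exists>T. real_closed_domain (A Quot P) T"
    and fr: "formally_real B" and int: "integral_extension A B \<phi>" and ess: "essential_extension A B \<phi>"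
  shows "\<phi> ` carrier A = carrier B"
proof (rule ccontr)
  assume not_surj: "\<phi> ` carrier A \<noteq> carrier B"
  have ext: "cring A" "cring B" "\<phi> \<in> ring_hom A B"
    using ess by (auto simp: essential_extension_def ring_extension_def)
  interpret A: cring A by fact
  interpret B: cring B by fact
  interpret \<phi>: ring_hom_cring A B \<phi> by unfold_locales (fact ext)
  have rick: "rickart B" by (rule baer_imp_rickart [OF baer ess])
  have idem: "f \<in> \<phi> ` carrier A" if "f \<in> carrier B" "f \<otimes>\<^bsub>B\<^esub> f = f" for f
    using essential_extension_idempotents [OF baer ess] that by blast
  have im_diff: "x \<ominus>\<^bsub>B\<^esub> y \<in> \<phi> ` carrier A" "x \<oplus>\<^bsub>B\<^esub> y \<in> \<phi> ` carrier A" "x \<otimes>\<^bsub>B\<^esub> y \<in> \<phi> ` carrier A"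
    if xy: "x \<in> \<phi> ` carrier A" "y \<in> \<phi> ` carrier A" for x y
  proof -
    obtain a b where ab: "a \<in> carrier A" "b \<in> carrier A" "x = \<phi> a" "y = \<phi> b" using xy by auto
    have "x \<ominus>\<^bsub>B\<^esub> y = \<phi> (a \<ominus>\<^bsub>A\<^esub> b)" "x \<oplus>\<^bsub>B\<^esub> y = \<phi> (a \<oplus>\<^bsub>A\<^esub> b)" "x \<otimes>\<^bsub>B\<^esub> y = \<phi> (a \<otimes>\<^bsub>A\<^esub> b)"
      using ab by (simp_all add: A.minus_eq B.minus_eq)
    then show "x \<ominus>\<^bsub>B\<^esub> y \<in> \<phi> ` carrier A" "x \<oplus>\<^bsub>B\<^esub> y \<in> \<phi> ` carrier A" "x \<otimes>\<^bsub>B\<^esub> y \<in> \<phi> ` carrier A"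
      using ab(1,2) by (metis A.minus_closed imageI, metis A.a_closed imageI, metis A.m_closed imageI)
  qed
  obtain b where b: "b \<in> carrier B" "b \<notin> \<phi> ` carrier A" using not_surj by auto
  define F where "F = {f \<in> carrier B. f \<otimes>\<^bsub>B\<^esub> f = f \<and> b \<ominus>\<^bsub>B\<^esub> f \<otimes>\<^bsub>B\<^esub> b \<in> \<phi> ` carrier A}"
  have N: "ideal (torsion B F) B"
  proof (rule B.torsion_ideal)
    show "F \<subseteq> carrier B" by (auto simp: F_def)
    have "\<zero>\<^bsub>B\<^esub> = \<phi> \<zero>\<^bsub>A\<^esub>" by simp
    then have "\<zero>\<^bsub>B\<^esub> \<in> \<phi> ` carrier A" using A.zero_closed by blast
    then show "\<one>\<^bsub>B\<^esub> \<in> F" using b by (simp add: F_def B.minus_eq B.r_neg)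
    fix f g assume "f \<in> F" "g \<in> F"
    then have fg: "f \<in> carrier B" "f \<otimes>\<^bsub>B\<^esub> f = f" "b \<ominus>\<^bsub>B\<^esub> f \<otimes>\<^bsub>B\<^esub> b \<in> \<phi> ` carrier A"
        "g \<in> carrier B" "g \<otimes>\<^bsub>B\<^esub> g = g" "b \<ominus>\<^bsub>B\<^esub> g \<otimes>\<^bsub>B\<^esub> b \<in> \<phi> ` carrier A"
      by (auto simp: F_def)
    have "(f \<otimes>\<^bsub>B\<^esub> g) \<otimes>\<^bsub>B\<^esub> (f \<otimes>\<^bsub>B\<^esub> g) = (f \<otimes>\<^bsub>B\<^esub> f) \<otimes>\<^bsub>B\<^esub> (g \<otimes>\<^bsub>B\<^esub> g)"
      using fg(1,4) by (simp add: B.m_ac)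
    then have "(f \<otimes>\<^bsub>B\<^esub> g) \<otimes>\<^bsub>B\<^esub> (f \<otimes>\<^bsub>B\<^esub> g) = f \<otimes>\<^bsub>B\<^esub> g" using fg by simp
    moreover have "b \<ominus>\<^bsub>B\<^esub> (f \<otimes>\<^bsub>B\<^esub> g) \<otimes>\<^bsub>B\<^esub> b
        = (b \<ominus>\<^bsub>B\<^esub> f \<otimes>\<^bsub>B\<^esub> b) \<oplus>\<^bsub>B\<^esub> f \<otimes>\<^bsub>B\<^esub> (b \<ominus>\<^bsub>B\<^esub> g \<otimes>\<^bsub>B\<^esub> b)"
      using fg(1,4) b(1) by (simp add: B.minus_eq B.r_distr B.r_minus B.m_assoc B.a_assoc B.r_neg1)
    then have "b \<ominus>\<^bsub>B\<^esub> (f \<otimes>\<^bsub>B\<^esub> g) \<otimes>\<^bsub>B\<^esub> b \<in> \<phi> ` carrier A"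
      using im_diff(2) [OF fg(3) im_diff(3) [OF idem [OF fg(1,2)] fg(6)]] by simp
    ultimately show "f \<otimes>\<^bsub>B\<^esub> g \<in> F" using fg by (simp add: F_def)
  qed
  \<comment> \<open>Otherwise the idempotent \<open>1\<close> carries \<open>b\<close> into \<open>A\<close>.\<close>
  have "\<one>\<^bsub>B\<^esub> \<notin> torsion B F"
  proof
    assume "\<one>\<^bsub>B\<^esub> \<in> torsion B F"
    then have "\<zero>\<^bsub>B\<^esub> \<in> F" by (auto simp: torsion_def F_def)
    then show False using b by (simp add: F_def B.minus_eq)
  qed
  then obtain M where M: "maximalideal M B" "torsion B F \<subseteq> M"
    using B.proper_ideal_in_maximalideal [OF N] by metis
  have M_prime: "primeideal M B" by (rule B.maximalideal_prime) (fact M)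
  define Q where "Q = torsion B (idempotents_outside B M)"
  have Q: "primeideal Q B" unfolding Q_def by (rule B.torsion_primeideal [OF rick M_prime])
  interpret Q: primeideal Q B by fact
  define E where "E = B Quot Q"
  define q where "q = (+>\<^bsub>B\<^esub>) Q"
  interpret E: domain E unfolding E_def by (rule Q.quotient_is_domain)
  interpret q: ring_hom_cring B E q
    unfolding E_def q_def by (rule Q.rcos_ring_hom_cring)
  have fr_E: "formally_real E"
    unfolding E_def Q_def
    by (rule B.quotient_torsion_formally_real [OF fr])
      (use Q.is_ideal Q_def in \<open>auto simp: idempotents_outside_def\<close>)
  \<comment> \<open>The kernel \<open>P\<close> of \<open>h\<close> is the contraction of \<open>Q\<close>, and \<open>\<psi>\<close> is the inclusion of \<open>A/P\<close> in \<open>B/Q\<close>.\<close>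
  define h where "h = q \<circ> \<phi>"
  have h_hom: "h \<in> ring_hom A E"
    unfolding h_def using \<phi>.homh q.homh by (rule ring_hom_trans)
  interpret h: ring_hom_cring A E h by unfold_locales (fact h_hom)
  define P where "P = a_kernel A E h"
  have "primeideal {r \<in> carrier A. h r \<in> {\<zero>\<^bsub>E\<^esub>}} A"
    by (rule h.ring.primeideal_vimage [OF A.is_cring E.zeroprimeideal])
  moreover have "{r \<in> carrier A. h r \<in> {\<zero>\<^bsub>E\<^esub>}} = P"
    unfolding P_def a_kernel_def' by (simp only: singleton_iff)
  ultimately have P: "primeideal P A" by simp
  then obtain T where T: "real_closed_domain (A Quot P) T" using rcd by blast
  define \<psi> where "\<psi> = (\<lambda>U. the_elem (h ` U))"
  have \<psi>: "\<psi> \<in> ring_hom (A Quot P) E" "\<psi> ` carrier (A Quot P) = h ` carrier A"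
    unfolding \<psi>_def P_def by (fact h.ring.the_elem_hom h.ring.the_elem_surj)+
  have \<psi>_inj: "inj_on \<psi> (carrier (A Quot P))"
    unfolding \<psi>_def P_def by (intro inj_onI) (rule h.ring.the_elem_inj)
  have "integral_over E (\<psi> ` carrier (A Quot P)) (q b)"
  proof -
    obtain p where p: "set p \<subseteq> \<phi> ` carrier A" "B.eval (\<one>\<^bsub>B\<^esub> # p) b = \<zero>\<^bsub>B\<^esub>"
      using int b unfolding integral_extension_def integral_over_def by blast
    have "set (\<one>\<^bsub>B\<^esub> # p) \<subseteq> carrier B" using p(1) by auto
    from B.ring_hom_eval [OF E.is_cring q.homh this b(1)]
    have "E.eval (\<one>\<^bsub>E\<^esub> # map q p) (q b) = \<zero>\<^bsub>E\<^esub>"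
      unfolding p(2) by (simp only: list.map q.hom_one q.hom_zero)
    moreover have "set (map q p) \<subseteq> h ` carrier A"
      unfolding h_def image_comp [symmetric] set_map using p(1) by (rule image_mono)
    ultimately show ?thesis unfolding integral_over_def \<psi>(2) by blast
  qed
  then have "q b \<in> \<psi> ` carrier (A Quot P)"
    using real_closed_domain_integral_extension [OF T E.domain_axioms fr_E \<psi>(1) \<psi>_inj q.hom_closed [OF b(1)]]
    by blast
  then obtain a where a: "a \<in> carrier A" "q b = q (\<phi> a)" unfolding \<psi>(2) h_def comp_def by (elim imageE)
  have "b \<ominus>\<^bsub>B\<^esub> \<phi> a \<in> Q"
    using a b(1) B.quotient_eq_iff_same_a_r_cos [OF Q.is_ideal, of b "\<phi> a"] by (simp add: q_def)
  then obtain f where f: "f \<in> carrier B" "f \<otimes>\<^bsub>B\<^esub> f = f" "f \<notin> M" "f \<otimes>\<^bsub>B\<^esub> (b \<ominus>\<^bsub>B\<^esub> \<phi> a) = \<zero>\<^bsub>B\<^esub>"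
    unfolding Q_def torsion_def idempotents_outside_def by blast
  \<comment> \<open>The idempotent \<open>f\<close> carries \<open>b\<close> into \<open>A\<close>, so it belongs to \<open>M\<close> after all.\<close>
  define g where "g = \<one>\<^bsub>B\<^esub> \<ominus>\<^bsub>B\<^esub> f"
  have g: "g \<in> carrier B" "g \<otimes>\<^bsub>B\<^esub> g = g" "g \<otimes>\<^bsub>B\<^esub> f = \<zero>\<^bsub>B\<^esub>"
    using f B.one_minus_idempotent by (simp_all add: g_def)
  have "f \<otimes>\<^bsub>B\<^esub> b \<ominus>\<^bsub>B\<^esub> f \<otimes>\<^bsub>B\<^esub> \<phi> a = \<zero>\<^bsub>B\<^esub>"
    using f(1,4) b(1) a(1) by (simp add: B.minus_eq B.r_distr B.r_minus)
  then have fb: "f \<otimes>\<^bsub>B\<^esub> b = f \<otimes>\<^bsub>B\<^esub> \<phi> a" using f(1) b(1) a(1) by simp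
  have "b \<ominus>\<^bsub>B\<^esub> g \<otimes>\<^bsub>B\<^esub> b = f \<otimes>\<^bsub>B\<^esub> b"
    using f(1) b(1) unfolding g_def
    by (simp add: B.minus_eq B.l_distr B.l_minus B.minus_add B.r_neg1 B.r_neg2)
  also have "\<dots> \<in> \<phi> ` carrier A"
    unfolding fb using im_diff(3) idem f(1,2) a(1) by blast
  finally have "g \<in> F" using g by (simp add: F_def)
  then have "f \<in> torsion B F" using g f(1) by (auto simp: torsion_def)
  then show False using M(2) f(3) by blast
qed

section \<open>Splitting a ring along an annihilator\<close>

text \<open>
  The multiples of \<open>1\<close> are sums of squares, so they are pairwise different.
\<close>

lemma formally_real_infinite:
  assumes "cring A" "formally_real A" "\<one>\<^bsub>A\<^esub> \<noteq> \<zero>\<^bsub>A\<^esub>"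
  shows "infinite (carrier A)"
proof
  interpret cring A by fact
  assume fin: "finite (carrier A)"
  define s where "s n = (\<Oplus>\<^bsub>A\<^esub>i\<in>{..<n}. \<one>\<^bsub>A\<^esub> \<otimes>\<^bsub>A\<^esub> \<one>\<^bsub>A\<^esub>)" for n :: nat
  have s_Suc: "s (Suc n) = \<one>\<^bsub>A\<^esub> \<oplus>\<^bsub>A\<^esub> s n" for n
    by (simp add: s_def lessThan_Suc)
  have s_in: "s n \<in> carrier A" for n by (simp add: s_def)
  have s_0: "s 0 = \<zero>\<^bsub>A\<^esub>" by (simp add: s_def)
  have s_add: "s (k + n) = s k \<oplus>\<^bsub>A\<^esub> s n" for k n
    by (induction k) (use s_in in \<open>simp_all add: s_0 s_Suc a_assoc\<close>)
  have s_nz: "s (Suc k) \<noteq> \<zero>\<^bsub>A\<^esub>" for k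
    using assms(2) [unfolded formally_real_def, rule_format, of "\<lambda>_. \<one>\<^bsub>A\<^esub>" "Suc k" 0] assms(3)
    unfolding s_def by auto
  have "inj s"
  proof (rule linorder_injI)
    fix m n :: nat assume "m < n"
    then obtain k where n: "n = Suc k + m" by (metis add.commute less_imp_Suc_add add_Suc_right)
    have "s n = s (Suc k) \<oplus>\<^bsub>A\<^esub> s m" by (simp only: n s_add)
    then show "s m \<noteq> s n" using s_nz [of k] s_in add.r_cancel_one' by metis
  qed
  then have "finite (UNIV :: nat set)" using fin s_in by (metis finite_imageD finite_subset image_subsetI)
  then show False by simp
qed

lemma annihilator_ideal:
  assumes "cring A" "S \<subseteq> carrier A"
  shows "ideal (annihilator A S) A"
proof -
  interpret cring A by fact
  show ?thesis
  proof (rule idealI)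
    show "subgroup (annihilator A S) (add_monoid A)"
      by (rule add.subgroupI) (use assms(2) in \<open>auto simp: annihilator_def l_distr l_minus subset_iff\<close>)
  next
    fix a x assume a: "a \<in> annihilator A S" and x: "x \<in> carrier A"
    have "(x \<otimes>\<^bsub>A\<^esub> a) \<otimes>\<^bsub>A\<^esub> s = x \<otimes>\<^bsub>A\<^esub> (a \<otimes>\<^bsub>A\<^esub> s)" if "s \<in> S" for s
      using that a x assms(2) by (auto simp: annihilator_def m_assoc)
    then show "x \<otimes>\<^bsub>A\<^esub> a \<in> annihilator A S"
      using a x by (simp add: annihilator_def)
    then show "a \<otimes>\<^bsub>A\<^esub> x \<in> annihilator A S"
      using a x by (simp add: annihilator_def m_comm)
  qed (fact ring_axioms)
qed

text \<open>
  An abstract description of \<open>B = A/I \<times> A/J\<close>, where \<open>I\<close> is the annihilator of \<open>S\<close> and \<open>J\<close> the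
  annihilator of \<open>I\<close>, with \<open>\<epsilon> = (1, 0)\<close>. Only the kernels of the two projections and the fact that
  \<open>\<epsilon>\<close> generates \<open>B\<close> over \<open>A\<close> matter, so \<open>B\<close> may be replaced by an isomorphic copy in another
  type.
\<close>

locale split_extension =
  fixes A :: "('a, 'm) ring_scheme" and B :: "('b, 'n) ring_scheme" and \<phi> S \<epsilon>
  assumes A: "cring A" "formally_real A" and B: "cring B" and \<phi>: "\<phi> \<in> ring_hom A B"
    and S: "S \<subseteq> carrier A"
    and \<epsilon>: "\<epsilon> \<in> carrier B" "\<epsilon> \<otimes>\<^bsub>B\<^esub> \<epsilon> = \<epsilon>"
    and span: "\<And>b. b \<in> carrier B \<Longrightarrow> \<exists>x\<in>carrier A. \<exists>y\<in>carrier A.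
          b = \<phi> x \<otimes>\<^bsub>B\<^esub> \<epsilon> \<oplus>\<^bsub>B\<^esub> \<phi> y \<otimes>\<^bsub>B\<^esub> (\<one>\<^bsub>B\<^esub> \<ominus>\<^bsub>B\<^esub> \<epsilon>)"
    and ker1: "\<And>a. a \<in> carrier A \<Longrightarrow> \<phi> a \<otimes>\<^bsub>B\<^esub> \<epsilon> = \<zero>\<^bsub>B\<^esub> \<longleftrightarrow> a \<in> annihilator A S"
    and ker2: "\<And>a. a \<in> carrier A \<Longrightarrow>
          \<phi> a \<otimes>\<^bsub>B\<^esub> (\<one>\<^bsub>B\<^esub> \<ominus>\<^bsub>B\<^esub> \<epsilon>) = \<zero>\<^bsub>B\<^esub> \<longleftrightarrow> a \<in> annihilator A (annihilator A S)"
begin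

sublocale A: cring A by (fact A)
sublocale B: cring B by (fact B)
sublocale \<phi>: ring_hom_cring A B \<phi> by unfold_locales (fact \<phi>)

abbreviation "\<delta> \<equiv> \<one>\<^bsub>B\<^esub> \<ominus>\<^bsub>B\<^esub> \<epsilon>"

lemma \<delta>: "\<delta> \<in> carrier B" "\<delta> \<otimes>\<^bsub>B\<^esub> \<delta> = \<delta>" "\<epsilon> \<otimes>\<^bsub>B\<^esub> \<delta> = \<zero>\<^bsub>B\<^esub>" "\<delta> \<otimes>\<^bsub>B\<^esub> \<epsilon> = \<zero>\<^bsub>B\<^esub>"
  by (rule B.minus_closed [OF B.one_closed \<epsilon>(1)] B.one_minus_idempotent [OF \<epsilon>])+

lemma decompose: "b \<in> carrier B \<Longrightarrow> b = b \<otimes>\<^bsub>B\<^esub> \<epsilon> \<oplus>\<^bsub>B\<^esub> b \<otimes>\<^bsub>B\<^esub> \<delta>"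
proof -
  assume b: "b \<in> carrier B"
  have "\<epsilon> \<oplus>\<^bsub>B\<^esub> \<delta> = \<one>\<^bsub>B\<^esub>" using \<epsilon>(1) by (simp add: B.minus_eq B.a_lcomm [of \<epsilon>] B.r_neg)
  then have "b = b \<otimes>\<^bsub>B\<^esub> (\<epsilon> \<oplus>\<^bsub>B\<^esub> \<delta>)" using b by simp
  then show ?thesis using b \<epsilon>(1) \<delta>(1) by (metis B.r_distr)
qed

lemma components:
  assumes "b \<in> carrier B"
  obtains x y where "x \<in> carrier A" "y \<in> carrier A"
    "b \<otimes>\<^bsub>B\<^esub> \<epsilon> = \<phi> x \<otimes>\<^bsub>B\<^esub> \<epsilon>" "b \<otimes>\<^bsub>B\<^esub> \<delta> = \<phi> y \<otimes>\<^bsub>B\<^esub> \<delta>"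
proof -
  obtain x y where xy: "x \<in> carrier A" "y \<in> carrier A" "b = \<phi> x \<otimes>\<^bsub>B\<^esub> \<epsilon> \<oplus>\<^bsub>B\<^esub> \<phi> y \<otimes>\<^bsub>B\<^esub> \<delta>"
    using span [OF assms] by blast
  have "b \<otimes>\<^bsub>B\<^esub> \<epsilon> = \<phi> x \<otimes>\<^bsub>B\<^esub> (\<epsilon> \<otimes>\<^bsub>B\<^esub> \<epsilon>) \<oplus>\<^bsub>B\<^esub> \<phi> y \<otimes>\<^bsub>B\<^esub> (\<delta> \<otimes>\<^bsub>B\<^esub> \<epsilon>)"
    using xy \<epsilon>(1) \<delta>(1) by (simp add: B.l_distr B.m_assoc)
  moreover have "b \<otimes>\<^bsub>B\<^esub> \<delta> = \<phi> x \<otimes>\<^bsub>B\<^esub> (\<epsilon> \<otimes>\<^bsub>B\<^esub> \<delta>) \<oplus>\<^bsub>B\<^esub> \<phi> y \<otimes>\<^bsub>B\<^esub> (\<delta> \<otimes>\<^bsub>B\<^esub> \<delta>)"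
    using xy \<epsilon>(1) \<delta>(1) by (simp add: B.l_distr B.m_assoc)
  ultimately show thesis using that xy \<epsilon> \<delta> by simp
qed

text \<open>
  An element of \<open>I \<inter> J\<close> annihilates itself, hence is zero.
\<close>

lemma ring_ext: "ring_extension A B \<phi>"
proof -
  have "a = \<zero>\<^bsub>A\<^esub>" if a: "a \<in> carrier A" "\<phi> a = \<zero>\<^bsub>B\<^esub>" for a
  proof -
    have "a \<in> annihilator A S" "a \<in> annihilator A (annihilator A S)"
      using ker1 [OF a(1)] ker2 [OF a(1)] a(2) \<epsilon>(1) \<delta>(1) by simp_all
    then have "a \<otimes>\<^bsub>A\<^esub> a = \<zero>\<^bsub>A\<^esub>" by (simp add: annihilator_def)
    then show ?thesis
      using A(2) [unfolded formally_real_def, rule_format, of "\<lambda>_. a" 1 0] a(1) by (simp add: lessThan_Suc)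
  qed
  note kernel = this
  have "inj_on \<phi> (carrier A)"
  proof (rule inj_onI)
    fix x y assume xy: "x \<in> carrier A" "y \<in> carrier A" "\<phi> x = \<phi> y"
    then have "\<phi> (x \<ominus>\<^bsub>A\<^esub> y) = \<zero>\<^bsub>B\<^esub>" by (simp add: A.minus_eq B.r_neg)
    then show "x = y" using kernel [of "x \<ominus>\<^bsub>A\<^esub> y"] xy by simp
  qed
  then show ?thesis using A B \<phi> by (simp add: ring_extension_def)
qed

text \<open>
  The two components are treated alike: \<open>e\<close> is the idempotent of a component whose kernel in \<open>A\<close> is
  the annihilator of \<open>T\<close>. If a sum of squares of elements \<open>x k\<close> annihilates \<open>T\<close>, then so does every
  \<open>x k\<close>, because the squares of the elements \<open>x k t\<close> add up to zero for all \<open>t \<in> T\<close>.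
\<close>

lemma formally_real: "formally_real B"
  unfolding formally_real_def
proof (intro allI impI)
  fix n :: nat and b i
  assume b: "b \<in> {..<n} \<rightarrow> carrier B" and sum: "(\<Oplus>\<^bsub>B\<^esub>k\<in>{..<n}. b k \<otimes>\<^bsub>B\<^esub> b k) = \<zero>\<^bsub>B\<^esub>" and i: "i < n"
  have component: "b i \<otimes>\<^bsub>B\<^esub> e = \<zero>\<^bsub>B\<^esub>"
    if e: "e \<in> carrier B" "e \<otimes>\<^bsub>B\<^esub> e = e" and T: "T \<subseteq> carrier A"
      and ker: "\<And>a. a \<in> carrier A \<Longrightarrow> \<phi> a \<otimes>\<^bsub>B\<^esub> e = \<zero>\<^bsub>B\<^esub> \<longleftrightarrow> a \<in> annihilator A T"
      and x: "\<And>k. k < n \<Longrightarrow> x k \<in> carrier A \<and> b k \<otimes>\<^bsub>B\<^esub> e = \<phi> (x k) \<otimes>\<^bsub>B\<^esub> e" for e T x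
  proof -
    let ?s = "\<Oplus>\<^bsub>A\<^esub>k\<in>{..<n}. x k \<otimes>\<^bsub>A\<^esub> x k"
    have sq: "(u \<otimes>\<^bsub>B\<^esub> e) \<otimes>\<^bsub>B\<^esub> (u \<otimes>\<^bsub>B\<^esub> e) = (u \<otimes>\<^bsub>B\<^esub> u) \<otimes>\<^bsub>B\<^esub> e" if u: "u \<in> carrier B" for u
    proof -
      have "(u \<otimes>\<^bsub>B\<^esub> e) \<otimes>\<^bsub>B\<^esub> (u \<otimes>\<^bsub>B\<^esub> e) = (u \<otimes>\<^bsub>B\<^esub> u) \<otimes>\<^bsub>B\<^esub> (e \<otimes>\<^bsub>B\<^esub> e)"
        using u e(1) by (simp add: B.m_ac)
      then show ?thesis by (simp only: e(2))
    qed
    have "\<phi> ?s \<otimes>\<^bsub>B\<^esub> e = (\<Oplus>\<^bsub>B\<^esub>k\<in>{..<n}. \<phi> (x k \<otimes>\<^bsub>A\<^esub> x k)) \<otimes>\<^bsub>B\<^esub> e"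
      using x by (subst \<phi>.hom_finsum) (auto simp: comp_def)
    also have "\<dots> = (\<Oplus>\<^bsub>B\<^esub>k\<in>{..<n}. \<phi> (x k \<otimes>\<^bsub>A\<^esub> x k) \<otimes>\<^bsub>B\<^esub> e)"
      using x e by (subst B.finsum_ldistr) auto
    also have "\<dots> = (\<Oplus>\<^bsub>B\<^esub>k\<in>{..<n}. (b k \<otimes>\<^bsub>B\<^esub> b k) \<otimes>\<^bsub>B\<^esub> e)"
    proof (intro B.finsum_cong' refl)
      fix k assume "k \<in> {..<n}"
      then have k: "k < n" by simp
      have bk: "b k \<in> carrier B" using b k by auto
      show "\<phi> (x k \<otimes>\<^bsub>A\<^esub> x k) \<otimes>\<^bsub>B\<^esub> e = (b k \<otimes>\<^bsub>B\<^esub> b k) \<otimes>\<^bsub>B\<^esub> e"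
        using sq [OF bk] sq [of "\<phi> (x k)"] x [OF k] by simp
    qed (use b e in \<open>auto simp: Pi_iff\<close>)
    also have "\<dots> = (\<Oplus>\<^bsub>B\<^esub>k\<in>{..<n}. b k \<otimes>\<^bsub>B\<^esub> b k) \<otimes>\<^bsub>B\<^esub> e"
      using b e by (subst B.finsum_ldistr) (auto simp: Pi_iff)
    also have "\<dots> = \<zero>\<^bsub>B\<^esub>" using sum e by simp
    finally have "\<phi> ?s \<otimes>\<^bsub>B\<^esub> e = \<zero>\<^bsub>B\<^esub>" .
    moreover have "?s \<in> carrier A" using x by (intro A.finsum_closed) auto
    ultimately have s: "?s \<in> annihilator A T" using ker by blast
    have "x i \<otimes>\<^bsub>A\<^esub> t = \<zero>\<^bsub>A\<^esub>" if t: "t \<in> T" for t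
    proof -
      have t_in: "t \<in> carrier A" using t T by auto
      have "(\<Oplus>\<^bsub>A\<^esub>k\<in>{..<n}. (x k \<otimes>\<^bsub>A\<^esub> t) \<otimes>\<^bsub>A\<^esub> (x k \<otimes>\<^bsub>A\<^esub> t)) = (\<Oplus>\<^bsub>A\<^esub>k\<in>{..<n}. (x k \<otimes>\<^bsub>A\<^esub> x k) \<otimes>\<^bsub>A\<^esub> (t \<otimes>\<^bsub>A\<^esub> t))"
        using x t_in by (intro A.finsum_cong' refl) (auto simp: A.m_ac)
      also have "\<dots> = ?s \<otimes>\<^bsub>A\<^esub> (t \<otimes>\<^bsub>A\<^esub> t)"
        using x t_in by (subst A.finsum_ldistr) auto
      also have "\<dots> = (?s \<otimes>\<^bsub>A\<^esub> t) \<otimes>\<^bsub>A\<^esub> t"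
        using x t_in by (subst A.m_assoc) (auto intro!: A.finsum_closed)
      also have "\<dots> = \<zero>\<^bsub>A\<^esub>" using s t t_in by (simp add: annihilator_def)
      finally show ?thesis
        using A(2) [unfolded formally_real_def, rule_format, of "\<lambda>k. x k \<otimes>\<^bsub>A\<^esub> t" n i] x t_in i by (simp add: Pi_iff)
    qed
    then have "x i \<in> annihilator A T" using x i by (auto simp: annihilator_def)
    then show ?thesis using ker x i by simp
  qed
  have "\<exists>x y. x \<in> carrier A \<and> y \<in> carrier A \<and> b k \<otimes>\<^bsub>B\<^esub> \<epsilon> = \<phi> x \<otimes>\<^bsub>B\<^esub> \<epsilon> \<and> b k \<otimes>\<^bsub>B\<^esub> \<delta> = \<phi> y \<otimes>\<^bsub>B\<^esub> \<delta>" if "k < n" for k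
    using b that components [of "b k"] by (metis Pi_iff lessThan_iff)
  then obtain x y where xy: "\<And>k. k < n \<Longrightarrow> x k \<in> carrier A \<and> y k \<in> carrier A
      \<and> b k \<otimes>\<^bsub>B\<^esub> \<epsilon> = \<phi> (x k) \<otimes>\<^bsub>B\<^esub> \<epsilon> \<and> b k \<otimes>\<^bsub>B\<^esub> \<delta> = \<phi> (y k) \<otimes>\<^bsub>B\<^esub> \<delta>"
    by metis
  have "annihilator A S \<subseteq> carrier A" by (auto simp: annihilator_def)
  then have "b i \<otimes>\<^bsub>B\<^esub> \<epsilon> = \<zero>\<^bsub>B\<^esub>" "b i \<otimes>\<^bsub>B\<^esub> \<delta> = \<zero>\<^bsub>B\<^esub>"
    using component [OF \<epsilon> S ker1, of x] component [OF \<delta>(1,2) _ ker2, of y] xy by blast+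
  then show "b i = \<zero>\<^bsub>B\<^esub>" using decompose [of "b i"] b i by auto
qed

text \<open>
  If \<open>b\<close> has the components \<open>x\<close> and \<open>y\<close>, then \<open>(b - x) (b - y) = 0\<close>.
\<close>

lemma integral: "integral_extension A B \<phi>"
  unfolding integral_extension_def
proof (intro conjI ballI ring_ext)
  fix b assume b: "b \<in> carrier B"
  obtain x y where xy: "x \<in> carrier A" "y \<in> carrier A" "b \<otimes>\<^bsub>B\<^esub> \<epsilon> = \<phi> x \<otimes>\<^bsub>B\<^esub> \<epsilon>" "b \<otimes>\<^bsub>B\<^esub> \<delta> = \<phi> y \<otimes>\<^bsub>B\<^esub> \<delta>"
    using components [OF b] by blast
  define u v where "u = b \<ominus>\<^bsub>B\<^esub> \<phi> x" and "v = b \<ominus>\<^bsub>B\<^esub> \<phi> y"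
  have uv: "u \<in> carrier B" "v \<in> carrier B" using b xy by (simp_all add: u_def v_def)
  have "u \<otimes>\<^bsub>B\<^esub> \<epsilon> = \<zero>\<^bsub>B\<^esub>" "v \<otimes>\<^bsub>B\<^esub> \<delta> = \<zero>\<^bsub>B\<^esub>"
    using xy b \<epsilon>(1) \<delta>(1) unfolding u_def v_def
    by (simp_all add: B.minus_eq [of b] B.l_distr B.l_minus B.r_neg)
  then have "(u \<otimes>\<^bsub>B\<^esub> v) \<otimes>\<^bsub>B\<^esub> \<epsilon> = \<zero>\<^bsub>B\<^esub>" "(u \<otimes>\<^bsub>B\<^esub> v) \<otimes>\<^bsub>B\<^esub> \<delta> = \<zero>\<^bsub>B\<^esub>"
    using uv \<epsilon>(1) \<delta>(1) by (metis B.m_assoc B.m_comm B.r_null, metis B.m_assoc B.r_null)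
  then have "u \<otimes>\<^bsub>B\<^esub> v = \<zero>\<^bsub>B\<^esub>" using decompose [of "u \<otimes>\<^bsub>B\<^esub> v"] uv by simp
  moreover have "u \<otimes>\<^bsub>B\<^esub> v = B.eval [\<one>\<^bsub>B\<^esub>, \<phi> (\<ominus>\<^bsub>A\<^esub> (x \<oplus>\<^bsub>A\<^esub> y)), \<phi> (x \<otimes>\<^bsub>A\<^esub> y)] b"
    using b xy(1,2) unfolding u_def v_def
    by (simp add: numeral_2_eq_2 B.minus_eq B.l_distr B.r_distr B.l_minus B.r_minus B.minus_add B.m_comm B.a_ac)
  moreover have "set [\<phi> (\<ominus>\<^bsub>A\<^esub> (x \<oplus>\<^bsub>A\<^esub> y)), \<phi> (x \<otimes>\<^bsub>A\<^esub> y)] \<subseteq> \<phi> ` carrier A"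
  proof -
    have "\<phi> (\<ominus>\<^bsub>A\<^esub> (x \<oplus>\<^bsub>A\<^esub> y)) \<in> \<phi> ` carrier A" "\<phi> (x \<otimes>\<^bsub>A\<^esub> y) \<in> \<phi> ` carrier A"
      by (rule imageI, simp add: xy(1,2))+
    then show ?thesis by (simp only: list.set insert_subset empty_subsetI simp_thms)
  qed
  ultimately show "integral_over B (\<phi> ` carrier A) b"
    unfolding integral_over_def by metis
qed

text \<open>
  An ideal that is not zero contains an element \<open>b\<close> with a component other than zero, say the one
  at \<open>e\<close>, represented by \<open>x \<in> A\<close>. As \<open>x\<close> does not annihilate the kernel of the projection to the
  other component, some \<open>t\<close> in that kernel satisfies \<open>x t \<noteq> 0\<close>; and \<open>x t\<close> is a multiple of \<open>b\<close>,
  because its other component vanishes.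
\<close>

lemma essential: "essential_extension A B \<phi>"
  unfolding essential_extension_def
proof (intro conjI allI impI ring_ext)
  fix J assume J: "ideal J B \<and> J \<noteq> {\<zero>\<^bsub>B\<^esub>}"
  interpret J: ideal J B using J by blast
  have component: "\<exists>a\<in>carrier A. \<phi> a \<in> J \<and> \<phi> a \<noteq> \<zero>\<^bsub>B\<^esub>"
    if b: "b \<in> J" "b \<otimes>\<^bsub>B\<^esub> e \<noteq> \<zero>\<^bsub>B\<^esub>" and x: "x \<in> carrier A" "b \<otimes>\<^bsub>B\<^esub> e = \<phi> x \<otimes>\<^bsub>B\<^esub> e"
      and e: "e \<in> carrier B" and d: "d \<in> carrier B" "\<And>u. u \<in> carrier B \<Longrightarrow> u = u \<otimes>\<^bsub>B\<^esub> e \<oplus>\<^bsub>B\<^esub> u \<otimes>\<^bsub>B\<^esub> d"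
      and ker_e: "\<And>a. a \<in> carrier A \<Longrightarrow> (\<And>t. t \<in> carrier A \<Longrightarrow> \<phi> t \<otimes>\<^bsub>B\<^esub> d = \<zero>\<^bsub>B\<^esub> \<Longrightarrow> a \<otimes>\<^bsub>A\<^esub> t = \<zero>\<^bsub>A\<^esub>) \<Longrightarrow> \<phi> a \<otimes>\<^bsub>B\<^esub> e = \<zero>\<^bsub>B\<^esub>"
    for b e d x
  proof -
    obtain t where t: "t \<in> carrier A" "\<phi> t \<otimes>\<^bsub>B\<^esub> d = \<zero>\<^bsub>B\<^esub>" "x \<otimes>\<^bsub>A\<^esub> t \<noteq> \<zero>\<^bsub>A\<^esub>"
      using ker_e [OF x(1)] b(2) x(2) by auto
    have b_in: "b \<in> carrier B" using b(1) J.a_subset by auto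
    have d0: "\<phi> (x \<otimes>\<^bsub>A\<^esub> t) \<otimes>\<^bsub>B\<^esub> d = \<zero>\<^bsub>B\<^esub>"
      using t x d(1) by (simp add: B.m_assoc)
    have "\<phi> (x \<otimes>\<^bsub>A\<^esub> t) = \<phi> (x \<otimes>\<^bsub>A\<^esub> t) \<otimes>\<^bsub>B\<^esub> e"
      using d(2) [of "\<phi> (x \<otimes>\<^bsub>A\<^esub> t)"] x(1) t(1) e unfolding d0 by simp
    also have "\<dots> = \<phi> t \<otimes>\<^bsub>B\<^esub> (\<phi> x \<otimes>\<^bsub>B\<^esub> e)" using x(1) t(1) e by (simp add: B.m_ac)
    also have "\<dots> = (\<phi> t \<otimes>\<^bsub>B\<^esub> e) \<otimes>\<^bsub>B\<^esub> b" using t(1) e b_in by (simp add: B.m_ac flip: x(2))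
    also have "\<dots> \<in> J" using J.I_l_closed b(1) t(1) e by simp
    finally have "\<phi> (x \<otimes>\<^bsub>A\<^esub> t) \<in> J" .
    moreover have "\<phi> (x \<otimes>\<^bsub>A\<^esub> t) \<noteq> \<zero>\<^bsub>B\<^esub>"
    proof
      assume "\<phi> (x \<otimes>\<^bsub>A\<^esub> t) = \<zero>\<^bsub>B\<^esub>"
      then have "\<phi> (x \<otimes>\<^bsub>A\<^esub> t) = \<phi> \<zero>\<^bsub>A\<^esub>" by (simp only: \<phi>.hom_zero)
      moreover have "inj_on \<phi> (carrier A)" using ring_ext by (simp add: ring_extension_def)
      ultimately show False using t x(1) by (metis A.m_closed A.zero_closed inj_onD)
    qed
    ultimately show ?thesis using x(1) t(1) by blast
  qed
  obtain b where b: "b \<in> J" "b \<noteq> \<zero>\<^bsub>B\<^esub>" using J J.zero_closed by blast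
  then have b_in: "b \<in> carrier B" using J.a_subset by auto
  obtain x y where xy: "x \<in> carrier A" "y \<in> carrier A" "b \<otimes>\<^bsub>B\<^esub> \<epsilon> = \<phi> x \<otimes>\<^bsub>B\<^esub> \<epsilon>" "b \<otimes>\<^bsub>B\<^esub> \<delta> = \<phi> y \<otimes>\<^bsub>B\<^esub> \<delta>"
    using components [OF b_in] by blast
  have "\<exists>a\<in>carrier A. \<phi> a \<in> J \<and> \<phi> a \<noteq> \<zero>\<^bsub>B\<^esub>"
  proof (cases "b \<otimes>\<^bsub>B\<^esub> \<epsilon> = \<zero>\<^bsub>B\<^esub>")
    case False
    show ?thesis
    proof (rule component [OF b(1) False xy(1,3) \<epsilon>(1) \<delta>(1) decompose])
      fix a assume a: "a \<in> carrier A" and *: "\<And>t. \<lbrakk>t \<in> carrier A; \<phi> t \<otimes>\<^bsub>B\<^esub> \<delta> = \<zero>\<^bsub>B\<^esub>\<rbrakk> \<Longrightarrow> a \<otimes>\<^bsub>A\<^esub> t = \<zero>\<^bsub>A\<^esub>"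
      have "s \<in> annihilator A (annihilator A S)" if "s \<in> S" for s
        using that S by (auto simp: annihilator_def A.m_comm subset_iff)
      then have "a \<in> annihilator A S" using a * ker2 S by (auto simp: annihilator_def)
      then show "\<phi> a \<otimes>\<^bsub>B\<^esub> \<epsilon> = \<zero>\<^bsub>B\<^esub>" using ker1 a by simp
    qed
  next
    case True
    then have "b \<otimes>\<^bsub>B\<^esub> \<delta> \<noteq> \<zero>\<^bsub>B\<^esub>" using decompose [OF b_in] b(2) \<delta>(1) b_in by auto
    then show ?thesis
    proof (rule component [OF b(1) _ xy(2,4) \<delta>(1) \<epsilon>(1)])
      fix u assume "u \<in> carrier B"
      then show "u = u \<otimes>\<^bsub>B\<^esub> \<delta> \<oplus>\<^bsub>B\<^esub> u \<otimes>\<^bsub>B\<^esub> \<epsilon>"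
        using decompose [of u] \<epsilon>(1) \<delta>(1) by (metis B.a_comm B.m_closed)
    next
      fix a assume a: "a \<in> carrier A" and *: "\<And>t. \<lbrakk>t \<in> carrier A; \<phi> t \<otimes>\<^bsub>B\<^esub> \<epsilon> = \<zero>\<^bsub>B\<^esub>\<rbrakk> \<Longrightarrow> a \<otimes>\<^bsub>A\<^esub> t = \<zero>\<^bsub>A\<^esub>"
      have "annihilator A S \<subseteq> carrier A" by (auto simp: annihilator_def)
      then have "a \<in> annihilator A (annihilator A S)" unfolding annihilator_def [of A "annihilator A S"] using a * ker1 by blast
      then show "\<phi> a \<otimes>\<^bsub>B\<^esub> \<delta> = \<zero>\<^bsub>B\<^esub>" using ker2 a by simp
    qed
  qed
  then show "J \<inter> \<phi> ` carrier A \<noteq> {\<zero>\<^bsub>B\<^esub>}" by blast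
qed

text \<open>
  The element of \<open>A\<close> that corresponds to \<open>(0, 1)\<close> generates \<open>I\<close>.
\<close>

lemma surjective_imp_annihilator_principal:
  assumes "\<phi> ` carrier A = carrier B"
  shows "\<exists>e\<in>carrier A. e \<otimes>\<^bsub>A\<^esub> e = e \<and> annihilator A S = PIdl\<^bsub>A\<^esub> e"
proof -
  have inj: "inj_on \<phi> (carrier A)" using ring_ext by (simp add: ring_extension_def)
  obtain e where e: "e \<in> carrier A" "\<phi> e = \<delta>" using assms \<delta>(1) by (metis imageE)
  have "\<phi> (e \<otimes>\<^bsub>A\<^esub> e) = \<phi> e" using e \<delta>(2) by simp
  then have idem: "e \<otimes>\<^bsub>A\<^esub> e = e" using e inj by (metis A.m_closed inj_onD)
  have "annihilator A S = PIdl\<^bsub>A\<^esub> e"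
  proof (intro equalityI subsetI)
    fix a assume a: "a \<in> annihilator A S"
    then have a_in: "a \<in> carrier A" by (simp add: annihilator_def)
    have "\<phi> a \<otimes>\<^bsub>B\<^esub> \<epsilon> = \<zero>\<^bsub>B\<^esub>" using ker1 a a_in by blast
    then have "\<phi> a = \<phi> a \<otimes>\<^bsub>B\<^esub> \<delta>" using decompose [of "\<phi> a"] a_in \<delta>(1) by simp
    then have "\<phi> a = \<phi> (a \<otimes>\<^bsub>A\<^esub> e)" using e a_in by simp
    then have "a = a \<otimes>\<^bsub>A\<^esub> e" using inj a_in e by (metis A.m_closed inj_onD)
    then show "a \<in> PIdl\<^bsub>A\<^esub> e" using a_in by (auto simp: cgenideal_def)
  next
    fix a assume "a \<in> PIdl\<^bsub>A\<^esub> e"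
    then obtain t where t: "t \<in> carrier A" "a = t \<otimes>\<^bsub>A\<^esub> e" by (auto simp: cgenideal_def)
    have "\<phi> a \<otimes>\<^bsub>B\<^esub> \<epsilon> = \<phi> t \<otimes>\<^bsub>B\<^esub> (\<delta> \<otimes>\<^bsub>B\<^esub> \<epsilon>)" using t e \<epsilon>(1) \<delta>(1) by (simp add: B.m_assoc)
    then have "\<phi> a \<otimes>\<^bsub>B\<^esub> \<epsilon> = \<zero>\<^bsub>B\<^esub>" using t \<delta>(4) by simp
    moreover have "a \<in> carrier A" using t e by simp
    ultimately show "a \<in> annihilator A S" using ker1 by blast
  qed
  then show ?thesis using e idem by blast
qed

end

text \<open>
  The product \<open>P\<close> of the quotients is carried over to the type \<open>'b\<close>. Choosing representatives embeds
  \<open>P\<close> into pairs of elements of \<open>A\<close>, and \<open>A\<close> has as many pairs as elements, since it is infinite.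
\<close>

lemma split_extension_exists:
  fixes A :: "('a, 'm) ring_scheme" and f :: "'a \<Rightarrow> 'b"
  assumes A: "cring A" "formally_real A" "\<one>\<^bsub>A\<^esub> \<noteq> \<zero>\<^bsub>A\<^esub>" and f: "inj f" and S: "S \<subseteq> carrier A"
  shows "\<exists>(B :: 'b ring) \<phi> \<epsilon>. split_extension A B \<phi> S \<epsilon>"
proof -
  interpret A: cring A by fact
  define I where "I = annihilator A S"
  define J where "J = annihilator A I"
  have IJ: "ideal I A" "ideal J A"
    unfolding I_def J_def by (rule annihilator_ideal [OF A(1)]; use S in \<open>auto simp: annihilator_def\<close>)+
  interpret I: ideal I A by (fact IJ)
  interpret J: ideal J A by (fact IJ)
  interpret qI: ring_hom_cring A "A Quot I" "(+>\<^bsub>A\<^esub>) I" by (rule I.rcos_ring_hom_cring [OF A(1)])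
  interpret qJ: ring_hom_cring A "A Quot J" "(+>\<^bsub>A\<^esub>) J" by (rule J.rcos_ring_hom_cring [OF A(1)])
  define P where "P = RDirProd (A Quot I) (A Quot J)"
  note P_simps = P_def RDirProd_def DirProd_def monoid.defs
  have P_ops: "carrier P = carrier (A Quot I) \<times> carrier (A Quot J)"
      "\<one>\<^bsub>P\<^esub> = (\<one>\<^bsub>A Quot I\<^esub>, \<one>\<^bsub>A Quot J\<^esub>)" "\<zero>\<^bsub>P\<^esub> = (\<zero>\<^bsub>A Quot I\<^esub>, \<zero>\<^bsub>A Quot J\<^esub>)"
      "(x, y) \<otimes>\<^bsub>P\<^esub> (x', y') = (x \<otimes>\<^bsub>A Quot I\<^esub> x', y \<otimes>\<^bsub>A Quot J\<^esub> y')"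
      "(x, y) \<oplus>\<^bsub>P\<^esub> (x', y') = (x \<oplus>\<^bsub>A Quot I\<^esub> x', y \<oplus>\<^bsub>A Quot J\<^esub> y')" for x x' y y'
    by (simp_all add: P_simps)
  have "ring P"
    unfolding P_def using I.quotient_is_ring J.quotient_is_ring by (rule RDirProd_ring)
  then interpret P: ring P .
  interpret P: cring P
  proof
    fix p p' assume "p \<in> carrier P" "p' \<in> carrier P"
    then show "p \<otimes>\<^bsub>P\<^esub> p' = p' \<otimes>\<^bsub>P\<^esub> p"
      using qI.S.m_comm qJ.S.m_comm by (cases p; cases p') (simp add: P_ops)
  qed
  define \<phi>0 where "\<phi>0 a = (I +>\<^bsub>A\<^esub> a, J +>\<^bsub>A\<^esub> a)" for a
  define \<epsilon>0 where "\<epsilon>0 = (\<one>\<^bsub>A Quot I\<^esub>, \<zero>\<^bsub>A Quot J\<^esub>)"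
  define \<delta>0 where "\<delta>0 = (\<zero>\<^bsub>A Quot I\<^esub>, \<one>\<^bsub>A Quot J\<^esub>)"
  have \<phi>0: "\<phi>0 \<in> ring_hom A P"
    by (rule ring_hom_memI) (simp_all add: \<phi>0_def P_ops)
  have \<epsilon>0: "\<epsilon>0 \<in> carrier P" "\<delta>0 \<in> carrier P" "\<epsilon>0 \<otimes>\<^bsub>P\<^esub> \<epsilon>0 = \<epsilon>0"
    by (simp_all add: \<epsilon>0_def \<delta>0_def P_ops)
  have "\<delta>0 \<oplus>\<^bsub>P\<^esub> \<epsilon>0 = \<one>\<^bsub>P\<^esub>" by (simp add: \<epsilon>0_def \<delta>0_def P_ops)
  then have \<delta>0: "\<one>\<^bsub>P\<^esub> \<ominus>\<^bsub>P\<^esub> \<epsilon>0 = \<delta>0" using \<epsilon>0 by (metis P.minus_eq P.a_assoc P.r_neg P.r_zero P.a_inv_closed)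
  have ker0: "\<phi>0 a \<otimes>\<^bsub>P\<^esub> \<epsilon>0 = \<zero>\<^bsub>P\<^esub> \<longleftrightarrow> a \<in> I" "\<phi>0 a \<otimes>\<^bsub>P\<^esub> \<delta>0 = \<zero>\<^bsub>P\<^esub> \<longleftrightarrow> a \<in> J" if a: "a \<in> carrier A" for a
  proof -
    have "I +>\<^bsub>A\<^esub> a = \<zero>\<^bsub>A Quot I\<^esub> \<longleftrightarrow> a \<in> I" "J +>\<^bsub>A\<^esub> a = \<zero>\<^bsub>A Quot J\<^esub> \<longleftrightarrow> a \<in> J"
      using I.a_rcos_const I.a_rcos_self [OF a] J.a_rcos_const J.a_rcos_self [OF a]
      unfolding FactRing_zero by blast+
    then show "\<phi>0 a \<otimes>\<^bsub>P\<^esub> \<epsilon>0 = \<zero>\<^bsub>P\<^esub> \<longleftrightarrow> a \<in> I" "\<phi>0 a \<otimes>\<^bsub>P\<^esub> \<delta>0 = \<zero>\<^bsub>P\<^esub> \<longleftrightarrow> a \<in> J"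
      using a by (simp_all add: \<phi>0_def \<epsilon>0_def \<delta>0_def P_ops)
  qed
  have surj: "carrier (A Quot I) = (+>\<^bsub>A\<^esub>) I ` carrier A" "carrier (A Quot J) = (+>\<^bsub>A\<^esub>) J ` carrier A"
    unfolding FactRing_def A_RCOSETS_def' partial_object.simps by blast+
  have span0: "\<exists>x\<in>carrier A. \<exists>y\<in>carrier A. p = \<phi>0 x \<otimes>\<^bsub>P\<^esub> \<epsilon>0 \<oplus>\<^bsub>P\<^esub> \<phi>0 y \<otimes>\<^bsub>P\<^esub> \<delta>0" if p: "p \<in> carrier P" for p
  proof -
    obtain x y where "x \<in> carrier A" "y \<in> carrier A" "p = (I +>\<^bsub>A\<^esub> x, J +>\<^bsub>A\<^esub> y)"
      using p unfolding P_ops(1) surj by blast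
    moreover from this have "p = \<phi>0 x \<otimes>\<^bsub>P\<^esub> \<epsilon>0 \<oplus>\<^bsub>P\<^esub> \<phi>0 y \<otimes>\<^bsub>P\<^esub> \<delta>0"
      by (simp add: \<phi>0_def \<epsilon>0_def \<delta>0_def P_ops)
    ultimately show ?thesis by blast
  qed
  obtain k :: "'a \<times> 'a \<Rightarrow> 'a" where k: "inj_on k (carrier A \<times> carrier A)"
    using card_of_Times_same_infinite [OF formally_real_infinite [OF A]]
    unfolding card_of_ordIso [symmetric] bij_betw_def by blast
  define r where "r I' = inv_into (carrier A) ((+>\<^bsub>A\<^esub>) I')" for I'
  define g where "g = (\<lambda>p. f (k (r I (fst p), r J (snd p))))"
  have inj_g: "inj_on g (carrier P)"
  proof (rule inj_onI)
    fix p p' assume p: "p \<in> carrier P" "p' \<in> carrier P" "g p = g p'"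
    then have mem: "fst p \<in> (+>\<^bsub>A\<^esub>) I ` carrier A" "fst p' \<in> (+>\<^bsub>A\<^esub>) I ` carrier A"
        "snd p \<in> (+>\<^bsub>A\<^esub>) J ` carrier A" "snd p' \<in> (+>\<^bsub>A\<^esub>) J ` carrier A"
      unfolding P_ops(1) surj by auto
    have "(r I (fst p), r J (snd p)) = (r I (fst p'), r J (snd p'))"
      using p(3) mem f by (intro inj_onD [OF k]) (auto simp: g_def r_def inj_eq inv_into_into)
    then have "r I (fst p) = r I (fst p')" "r J (snd p) = r J (snd p')" by simp_all
    then have "fst p = fst p'" "snd p = snd p'"
      unfolding r_def using mem by (metis inv_into_injective)+
    then show "p = p'" by (rule prod_eqI)
  qed
  define B where "B = image_ring g P"
  have iso: "g \<in> ring_iso P B" unfolding B_def by (rule inj_imp_image_ring_iso [OF inj_g])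
  from P.ring_iso_imp_img_cring [OF iso] have "cring B"
    by (simp add: B_def image_ring_def image_group_def monoid.defs)
  then interpret B: cring B .
  have g: "g \<in> ring_hom P B" "g ` carrier P = carrier B"
    using iso by (auto simp: ring_iso_def bij_betw_def)
  interpret g: ring_hom_cring P B g by unfold_locales (fact g)
  have \<delta>: "\<one>\<^bsub>B\<^esub> \<ominus>\<^bsub>B\<^esub> g \<epsilon>0 = g \<delta>0"
    using \<epsilon>0(1) by (simp add: \<delta>0 [symmetric] B.minus_eq P.minus_eq)
  have g_zero: "g p = \<zero>\<^bsub>B\<^esub> \<longleftrightarrow> p = \<zero>\<^bsub>P\<^esub>" if "p \<in> carrier P" for p
    using that inj_on_eq_iff [OF inj_g that P.zero_closed] by simp
  have \<phi>0_in: "\<phi>0 a \<in> carrier P" if "a \<in> carrier A" for a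
    using ring_hom_memE(1) [OF \<phi>0 that] .
  have "split_extension A B (g \<circ> \<phi>0) S (g \<epsilon>0)"
  proof (rule split_extension.intro)
    show "cring A" "formally_real A" "cring B" "S \<subseteq> carrier A" by fact+
    show "g \<circ> \<phi>0 \<in> ring_hom A B" using \<phi>0 g(1) by (rule ring_hom_trans)
    show "g \<epsilon>0 \<in> carrier B" "g \<epsilon>0 \<otimes>\<^bsub>B\<^esub> g \<epsilon>0 = g \<epsilon>0"
      using \<epsilon>0 by (simp_all flip: g.hom_mult)
  next
    fix b assume "b \<in> carrier B"
    then obtain p where p: "p \<in> carrier P" "b = g p" using g(2) by blast
    obtain x y where xy: "x \<in> carrier A" "y \<in> carrier A" "p = \<phi>0 x \<otimes>\<^bsub>P\<^esub> \<epsilon>0 \<oplus>\<^bsub>P\<^esub> \<phi>0 y \<otimes>\<^bsub>P\<^esub> \<delta>0"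
      using span0 [OF p(1)] by blast
    then have "b = g (\<phi>0 x) \<otimes>\<^bsub>B\<^esub> g \<epsilon>0 \<oplus>\<^bsub>B\<^esub> g (\<phi>0 y) \<otimes>\<^bsub>B\<^esub> g \<delta>0"
      using p(2) \<phi>0_in \<epsilon>0 by simp
    then show "\<exists>x\<in>carrier A. \<exists>y\<in>carrier A. b = (g \<circ> \<phi>0) x \<otimes>\<^bsub>B\<^esub> g \<epsilon>0
        \<oplus>\<^bsub>B\<^esub> (g \<circ> \<phi>0) y \<otimes>\<^bsub>B\<^esub> (\<one>\<^bsub>B\<^esub> \<ominus>\<^bsub>B\<^esub> g \<epsilon>0)"
      unfolding \<delta> comp_def using xy(1,2) by blast
  next
    fix a assume a: "a \<in> carrier A"
    show "(g \<circ> \<phi>0) a \<otimes>\<^bsub>B\<^esub> g \<epsilon>0 = \<zero>\<^bsub>B\<^esub> \<longleftrightarrow> a \<in> annihilator A S"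
      using g_zero [of "\<phi>0 a \<otimes>\<^bsub>P\<^esub> \<epsilon>0"] ker0(1) [OF a] \<phi>0_in [OF a] \<epsilon>0 by (simp add: I_def)
    show "(g \<circ> \<phi>0) a \<otimes>\<^bsub>B\<^esub> (\<one>\<^bsub>B\<^esub> \<ominus>\<^bsub>B\<^esub> g \<epsilon>0) = \<zero>\<^bsub>B\<^esub> \<longleftrightarrow> a \<in> annihilator A (annihilator A S)"
      using g_zero [of "\<phi>0 a \<otimes>\<^bsub>P\<^esub> \<delta>0"] ker0(2) [OF a] \<phi>0_in [OF a] \<epsilon>0 unfolding \<delta> by (simp add: I_def J_def)
  qed
  then show ?thesis by blast
qed

theorem real_closed_star_imp_baer:
  fixes A :: "('a, 'm) ring_scheme" and f :: "'a \<Rightarrow> 'b"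
  assumes star: "real_closed_star TYPE('b) A" and f: "inj f"
  shows "baer_ring A"
proof -
  have A: "cring A" "formally_real A" using star by (simp_all add: real_closed_star_def)
  interpret A: cring A by fact
  have "\<exists>e\<in>carrier A. e \<otimes>\<^bsub>A\<^esub> e = e \<and> annihilator A S = PIdl\<^bsub>A\<^esub> e" if S: "S \<subseteq> carrier A" for S
  proof (cases "\<one>\<^bsub>A\<^esub> = \<zero>\<^bsub>A\<^esub>")
    case True
    then have "carrier A = {\<zero>\<^bsub>A\<^esub>}" by (rule A.one_zeroD)
    then have "annihilator A S = PIdl\<^bsub>A\<^esub> \<zero>\<^bsub>A\<^esub>" using S by (auto simp: annihilator_def cgenideal_def)
    then show ?thesis by (intro bexI [of _ "\<zero>\<^bsub>A\<^esub>"]) simp_all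
  next
    case False
    then obtain B :: "'b ring" and \<phi> \<epsilon> where "split_extension A B \<phi> S \<epsilon>"
      using split_extension_exists [OF A _ f S] by blast
    then interpret split_extension A B \<phi> S \<epsilon> .
    have "\<phi> ` carrier A = carrier B"
      using star formally_real integral essential unfolding real_closed_star_def by blast
    then show ?thesis by (rule surjective_imp_annihilator_principal)
  qed
  then show ?thesis using A(1) by (simp add: baer_ring_def)
qed

section \<open>Real closed * rings and Baer rings among real closed rings\<close>

theorem theorem17:
  fixes A :: "('a, 'm) ring_scheme"
  assumes "real_closed_ring A"
    and "\<exists>f :: 'a \<Rightarrow> 'b. inj f"
  shows "real_closed_star TYPE('b) A \<longleftrightarrow> baer_ring A"
proof
  show "baer_ring A" if "real_closed_star TYPE('b) A"
    using real_closed_star_imp_baer that assms(2) by blast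
next
  assume baer: "baer_ring A"
  have rcd: "\<exists>T. real_closed_domain (A Quot P) T" if "primeideal P A" for P
    using assms(1) that unfolding real_closed_ring_def Spec_def by blast
  have "cring A" using baer by (simp add: baer_ring_def)
  moreover have "formally_real A" using baer rcd by (rule baer_formally_real)
  moreover have "\<phi> ` carrier A = carrier B"
    if "formally_real B" "integral_extension A B \<phi>" "essential_extension A B \<phi>" for B :: "'b ring" and \<phi>
    using baer rcd that by (rule baer_imp_extension_surjective)
  ultimately show "real_closed_star TYPE('b) A"
    unfolding real_closed_star_def by blast
qed

end
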